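(* Let $P(u)=p_du^d+\dots+p_1u+p_0+p_{-1}u^{-1}$ be the characteristic Laurent polynomial of an aperiodic Łukasiewicz walk with $P(1)=1$ and $P'(1)=0$, and assume that there is no $\upsilon$ with $P'(\upsilon)=0$ and $P''(\upsilon)=0$. Put $\sigma=\sqrt{P''(1)}$, $\xi=P'''(1)$ and $\theta=P''''(1)$. Let $b_n^{>h}$ be the probability that the walk of length $n$ is a bridge whose height is strictly greater than $h$. Then for $x\in\,]0,+\infty[$ and $h=x\sigma\sqrt n$, as $n\to\infty$, $$\begin{aligned}b_n^{>x\sigma\sqrt n}\times\frac{\sigma\sqrt{2\pi n}}{\exp(-2x^2)}={}&He_0+\frac{He_1}{\sqrt n}\left(-\frac{3}{2\sigma}-\frac{\xi}{6\sigma^3}\right)\\&+\frac1n\Bigg(\frac{He_4}{128}+He_3\left(-\frac1{12\sigma^2}-\frac{\xi}{24\sigma^4}+\frac{\theta}{96\sigma^4}-\frac{5\xi^2}{288\sigma^6}-\frac1{16}\right)x\\&\qquad+He_2\left(\frac{5}{4\sigma^2}+\frac{7\xi}{24\sigma^4}-\frac{\theta}{32\sigma^4}+\frac{5\xi^2}{96\sigma^6}+\frac3{16}\right)\Bigg)+O\left(n^{-3/2}\right)\\={}&1+\frac{x}{\sqrt n}\left(-\frac6\sigma-\frac{2\xi}{3\sigma^3}\right)\\&+\frac1n\Bigg(-\frac5{\sigma^2}+\frac1{\sigma^4}\left(-\frac{7\xi}6+\frac\theta8\right)-\frac{5\xi^2}{24\sigma^6}-\frac38\\&\qquad+\left(\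frac{24}{\sigma^2}+\frac1{\sigma^4}\left(\frac{20\xi}3-\theta\right)+\frac{5\xi^2}{3\sigma^6}+3\right)x^2\\&\qquad+\left(-\frac{16}{3\sigma^2}+\frac1{3\sigma^4}(-8\xi+2\theta)-\frac{10\xi^2}{9\sigma^6}-2\right)x^4\Bigg)+O\left(n^{-3/2}\right).\end{aligned}$$
   Context: Here $d\ge1$ is an integer and the coefficients $p_j$ ($-1\le j\le d$) are nonnegative rational numbers with $p_{-1}>0$ and $p_d>0$; a Łukasiewicz walk is one whose only negative jump is $-1$. The walk is aperiodic if the largest integer $p\ge1$ such that $P(u)=u^bH(u^p)$ for some integer $b$ and some Laurent series $H$ is $p=1$. Since $P(1)=1$, the $p_j$ form a probability distribution; let $S_0=0$ and $S_k=X_1+\dots+X_k$ with $X_i$ i.i.d., $\Pr(X_i=j)=p_j$. A bridge of length $n$ is a walk with $S_n=0$, and its height is $\max_{0\le k\le n}S_k$. The equation $1-zP(u)=0$ has one small root $u_1(z)$ (tending to $0$ as $z\to0$) and $d$ large roots $v_1(z),\dots,v_d(z)$ (tending to infinity as $z\to0$). With $Q_k(u)=\prod_{m\neq k}(u-v_m(z))$, the generating function $B_h(z)=\sum_n b_n^{>h}z^n$ is $$B_h(z)=z\sum_{k=1}^d\left(\frac{u_1}{v_k}\right)^h\frac{Q_k(u_1)}{Q_k(v_k)}\frac{u_1'}{v_k}.$$ The height $h$ is treated formally as any positive real number: $b_n^{>h}$ for $h=x\sigma\sqrt n$ is understood through the Cauchy integral $\frac1{2\pi i}\oint B_h(z)z^{-n-1}dz$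 with this expression; the combinatorial case is that of integer $h$. The polynomials $He_i$ in $x$ are $He_i=(-1)^iQ^*_i(x)$, where $Q^*_0(x)=1$ and $Q^*_{r+1}(x)=-4x\,Q^*_r(x)+\frac{d}{dx}Q^*_r(x)$, i.e. $\frac{d^r}{dx^r}e^{-2x^2}=Q^*_r(x)e^{-2x^2}$; thus $He_0=1$, $He_1=4x$, $He_2=16x^2-4$, $He_3=64x^3-48x$, $He_4=256x^4-384x^2+48$. *)

theory Defs
  imports "HOL-Probability.Probability" "HOL-Complex_Analysis.Complex_Analysis"
    "HOL-Computational_Algebra.Formal_Laurent_Series" "HOL-Library.Landau_Symbols"
begin

(* Only the values p j with -1 <= j <= d are used.  Since 0 powi (-1) = 0 in HOL, the value at
   u = 0 is meaningless; every use below has u nonzero. *)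
definition char_P :: "nat \<Rightarrow> (int \<Rightarrow> real) \<Rightarrow> 'a::real_normed_field \<Rightarrow> 'a" where
  "char_P d p u = (\<Sum>j\<in>{-1..int d}. of_real (p j) * u powi j)"

definition char_P_fls :: "nat \<Rightarrow> (int \<Rightarrow> real) \<Rightarrow> real fls" where
  "char_P_fls d p = (\<Sum>j\<in>{-1..int d}. fls_const (p j) * fls_X_intpow j)"

(* The q >= 1 with P(u) = u^b H(u^q). *)
definition periods :: "nat \<Rightarrow> (int \<Rightarrow> real) \<Rightarrow> nat set" where
  "periods d p = {q. q \<ge> 1 \<and>
     (\<exists>(b::int) H. char_P_fls d p = fls_X_intpow b * fls_compose_power H q)}"

definition aperiodic :: "nat \<Rightarrow> (int \<Rightarrow> real) \<Rightarrow> bool" where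
  "aperiodic d p \<longleftrightarrow> 1 \<in> periods d p \<and> (\<forall>q\<in>periods d p. q \<le> 1)"

definition walk :: "(nat \<Rightarrow> 'a \<Rightarrow> int) \<Rightarrow> nat \<Rightarrow> 'a \<Rightarrow> int" where
  "walk X k \<omega> = (\<Sum>i=1..k. X i \<omega>)"

definition bridge_above_prob ::
    "'a measure \<Rightarrow> (nat \<Rightarrow> 'a \<Rightarrow> int) \<Rightarrow> nat \<Rightarrow> real \<Rightarrow> real" where
  "bridge_above_prob M X n h =
     measure M {\<omega> \<in> space M. walk X n \<omega> = 0 \<and>
       of_int (Max ((\<lambda>k. walk X k \<omega>) ` {0..n})) > h}"

(* The branch tending to 0 at z = 0, continued to the disc |z| < 1.  There |z P(u)| < 1 on
   |u| = 1, so exactly one root lies inside the unit circle and the continuation exists. *)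
definition small_root :: "nat \<Rightarrow> (int \<Rightarrow> real) \<Rightarrow> (complex \<Rightarrow> complex) \<Rightarrow> bool" where
  "small_root d p u1 \<longleftrightarrow>
     u1 holomorphic_on ball 0 1 \<and> (u1 \<longlongrightarrow> 0) (at 0) \<and>
     (\<forall>z. 0 < norm z \<and> norm z < 1 \<longrightarrow> u1 z \<noteq> 0 \<and> 1 - z * char_P d p (u1 z) = 0)"

(* For each z, v 1 z, ..., v d z lists the other roots with multiplicity.  The large roots may
   be permuted by monodromy, so no continuity in z is asked of an individual v k; gen_fun
   below is symmetric in them. *)
definition large_roots ::
    "nat \<Rightarrow> (int \<Rightarrow> real) \<Rightarrow> (complex \<Rightarrow> complex) \<Rightarrow> (nat \<Rightarrow> complex \<Rightarrow> complex) \<Rightarrow> bool" where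
  "large_roots d p u1 v \<longleftrightarrow>
     (\<forall>z. 0 < norm z \<and> norm z < 1 \<longrightarrow>
       (\<forall>u. u \<noteq> 0 \<longrightarrow>
         1 - z * char_P d p u =
           - (z * of_real (p (int d)) / u) * (u - u1 z) * (\<Prod>k=1..d. u - v k z))) \<and>
     (\<forall>k\<in>{1..d}. filterlim (v k) at_infinity (at 0))"

definition Q_poly :: "nat \<Rightarrow> (nat \<Rightarrow> complex \<Rightarrow> complex) \<Rightarrow> nat \<Rightarrow> complex \<Rightarrow> complex \<Rightarrow> complex" where
  "Q_poly d v k z u = (\<Prod>m\<in>{1..d} - {k}. u - v m z)"

(* The real power is the principal one; it is the ordinary power when h is a natural number. *)
definition gen_fun ::
    "nat \<Rightarrow> (complex \<Rightarrow> complex) \<Rightarrow> (nat \<Rightarrow> complex \<Rightarrow> complex) \<Rightarrow> real \<Rightarrow> complex \<Rightarrow> complex" where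
  "gen_fun d u1 v h z =
     z * (\<Sum>k=1..d. (u1 z / v k z) powr of_real h *
            (Q_poly d v k z (u1 z) / Q_poly d v k z (v k z)) * (deriv u1 z / v k z))"

(* The Cauchy integral over |z| = r.  For h not an integer, gen_fun is not single-valued
   analytic and the integral depends on r. *)
definition bridge_above_coeff ::
    "nat \<Rightarrow> (complex \<Rightarrow> complex) \<Rightarrow> (nat \<Rightarrow> complex \<Rightarrow> complex) \<Rightarrow> real \<Rightarrow> nat \<Rightarrow> real \<Rightarrow> complex" where
  "bridge_above_coeff d u1 v r n h =
     1 / (2 * of_real pi * \<i>) *
       contour_integral (circlepath 0 r) (\<lambda>z. gen_fun d u1 v h z / z ^ (n + 1))"

primrec Q_star :: "nat \<Rightarrow> real poly" where
  "Q_star 0 = 1"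
| "Q_star (Suc r) = [:0, -4:] * Q_star r + pderiv (Q_star r)"

definition He :: "nat \<Rightarrow> real \<Rightarrow> real" where
  "He i x = (-1) ^ i * poly (Q_star i) x"

definition expansion_He :: "real \<Rightarrow> real \<Rightarrow> real \<Rightarrow> real \<Rightarrow> real \<Rightarrow> real" where
  "expansion_He \<sigma> \<xi> \<theta> x n =
     He 0 x + He 1 x / sqrt n * (- 3 / (2 * \<sigma>) - \<xi> / (6 * \<sigma>^3))
     + 1 / n *
       (He 4 x / 128
        + He 3 x * (- 1 / (12 * \<sigma>^2) - \<xi> / (24 * \<sigma>^4) + \<theta> / (96 * \<sigma>^4)
                    - 5 * \<xi>^2 / (288 * \<sigma>^6) - 1 / 16) * x
        + He 2 x * (5 / (4 * \<sigma>^2) + 7 * \<xi> / (24 * \<sigma>^4) - \<theta> / (32 * \<sigma>^4)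
                    + 5 * \<xi>^2 / (96 * \<sigma>^6) + 3 / 16))"

definition expansion_x :: "real \<Rightarrow> real \<Rightarrow> real \<Rightarrow> real \<Rightarrow> real \<Rightarrow> real" where
  "expansion_x \<sigma> \<xi> \<theta> x n =
     1 + x / sqrt n * (- 6 / \<sigma> - 2 * \<xi> / (3 * \<sigma>^3))
     + 1 / n *
       (- 5 / \<sigma>^2 + 1 / \<sigma>^4 * (- 7 * \<xi> / 6 + \<theta> / 8) - 5 * \<xi>^2 / (24 * \<sigma>^6) - 3 / 8
        + (24 / \<sigma>^2 + 1 / \<sigma>^4 * (20 * \<xi> / 3 - \<theta>) + 5 * \<xi>^2 / (3 * \<sigma>^6) + 3) * x^2
        + (- 16 / (3 * \<sigma>^2) + 1 / (3 * \<sigma>^4) * (- 8 * \<xi> + 2 * \<theta>)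
           - 10 * \<xi>^2 / (9 * \<sigma>^6) - 2) * x^4)"

end

theory Submission
  imports Defs "HOL-Computational_Algebra.Fundamental_Theorem_Algebra" "HOL-Real_Asymp.Real_Asymp"
begin

text \<open>
  Write phi(u) = u P(u). The roots of 1 - z P(u) are the solutions of u = z phi(u). Zero drift gives
  phi'(1) = 1, so phi is nonexpansive on the closed unit disc, and for |z| < 1 the map u \<mapsto> z phi(u)
  is a contraction there: the small root is its only fixed point in the disc, it is simple, and
  every large root has modulus greater than 1 (lemmas \<open>unique_root_in_disc\<close>, \<open>norm_v\<close>). The quotients
  Q_k(u1)/Q_k(v_k) are quotients of derivatives of u - z phi(u), so that B_h(z) is the sum over the
  large roots v of -(u1/v)^(h+1) / (1 - z phi'(v)) (lemma \<open>gen_fun_eq\<close>).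

  By aperiodicity |phi| = 1 on the unit circle only at u = 1. Hence on a circle |z| = r just inside
  the unit circle the ratio u1/v is bounded away from 1 in modulus, except near z = 1 for the one
  large root that meets u1 at u = 1. As h is of order sqrt n, all other contributions are
  exponentially small; they need that 1 - z phi'(v) is at worst polynomially small in n
  (\<open>deriv_lower_bound\<close>), and, because the principal power jumps and the roots may be listed in any
  order, that the integrand is measurable (\<open>gen_fun_measurable\<close>).

  Near z = 1 put z = exp(-t^2/2). The equation P(exp s) = exp(t^2/2) has an analytic solution S(t)
  with S(0) = 0, the two roots are exp(S(t)) and exp(S(-t)), and the exceptional term of the Cauchy
  integral becomes, up to a factor, the integral of exp(n t^2/2 - (h+1)(S(t) - S(-t))) S'(t) dt
  (\<open>local_param\<close>, \<open>near_param\<close>). The integrand is analytic, so the path may be moved to the vertical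
  line Re t = 2x/sqrt n through the saddle point. There, with t = (2x + iy)/sqrt n, the leading part
  is exactly exp(-2x^2 - y^2/2), and the expansion of the rest in powers of 1/sqrt n leaves Gaussian
  integrals of polynomials (\<open>H_expansion\<close>, \<open>gauss_T\<close>, \<open>saddle_asymptotics\<close>). The Taylor coefficients
  of S are rational in sigma, xi, theta, and this yields the stated coefficients.

  If h is an integer, a bridge higher than h has to visit h + 1 on its way back, since it descends
  by unit steps. First-step recursions for the generating functions of walks that return, and of
  walks that reach h + 1 and return, have unique bounded solutions, and the expression in the roots
  solves them by a Lagrange interpolation identity (\<open>hit_gf_eq_gen_fun\<close>). So the Cauchy integral is
  the probability, and the first part applies.
\<close>

section \<open>The polynomial u P(u) on the closed unit disc\<close>

locale lukasiewicz =
  fixes d :: nat and p :: "int \<Rightarrow> real"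
  assumes d: "d \<ge> 1"
    and p_nonneg: "\<And>j. -1 \<le> j \<Longrightarrow> j \<le> int d \<Longrightarrow> p j \<ge> 0"
    and p_first: "p (-1) > 0"
    and p_last: "p (int d) > 0"
    and aper: "aperiodic d p"
    and P_1: "char_P d p (1::real) = 1"
    and P'_1: "deriv (char_P d p) (1::real) = 0"
begin

text \<open>The polynomial u P(u); it removes the pole of the Laurent polynomial P at 0.\<close>

definition phi :: "complex poly" where
  "phi = (\<Sum>j\<le>d+1. monom (of_real (p (int j - 1))) j)"

abbreviation dphi :: "complex \<Rightarrow> complex" where
  "dphi \<equiv> poly (pderiv phi)"

lemma sum_jumps: "(\<Sum>j\<in>{-1..int d}. f j) = (\<Sum>j\<le>d+1. f (int j - 1))"
proof (rule sum.reindex_bij_witness[of _ "\<lambda>j. int j - 1" "\<lambda>j. nat (j + 1)"])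
qed auto

lemma poly_phi: "poly phi u = (\<Sum>j\<le>d+1. of_real (p (int j - 1)) * u ^ j)"
  by (simp add: phi_def poly_sum poly_monom)

lemma poly_dphi: "dphi u = (\<Sum>j\<le>d+1. of_nat j * of_real (p (int j - 1)) * u ^ (j - 1))"
  using higher_pderiv_sum[of 1 "\<lambda>j. monom (of_real (p (int j - 1)) :: complex) j" "{..d+1}"]
  by (simp add: phi_def poly_sum poly_monom pderiv_monom mult_ac)

lemma char_P_eq:
  fixes u :: complex
  assumes "u \<noteq> 0" shows "char_P d p u = poly phi u / u"
proof -
  have "u powi (int j - 1) = u ^ j / u" for j
    using assms by (simp add: power_int_diff)
  then show ?thesis
    by (simp add: char_P_def sum_jumps poly_phi sum_divide_distrib del: sum.atMost_Suc)
qed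

lemma weight_nonneg: "j \<le> d + 1 \<Longrightarrow> p (int j - 1) \<ge> 0"
  by (rule p_nonneg) auto

lemma sum_p: "(\<Sum>j\<le>d+1. p (int j - 1)) = 1"
  using P_1 by (simp add: char_P_def sum_jumps del: sum.atMost_Suc)

lemma higher_deriv_char_P:
  fixes x :: real
  assumes "x > 0"
  shows "(deriv ^^ k) (char_P d p) x =
    (\<Sum>j\<in>{-1..int d}. p j * (\<Prod>i<k. real_of_int j - real i) * x powi (j - int k))"
  using assms
proof (induction k arbitrary: x)
  case 0
  then show ?case by (simp add: char_P_def)
next
  case (Suc k)
  have ev: "eventually (\<lambda>y. (deriv ^^ k) (char_P d p) y =
      (\<Sum>j\<in>{-1..int d}. p j * (\<Prod>i<k. real_of_int j - real i) * y powi (j - int k))) (nhds x)"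
    using eventually_nhds_in_open[of "{0<..}" x] Suc.prems
    by (auto elim!: eventually_mono intro!: Suc.IH)
  have "((\<lambda>y. \<Sum>j\<in>{-1..int d}. p j * (\<Prod>i<k. real_of_int j - real i) * y powi (j - int k))
      has_real_derivative (\<Sum>j\<in>{-1..int d}. p j * (\<Prod>i<k. real_of_int j - real i) *
         (of_int (j - int k) * x powi (j - int k - 1)))) (at x)"
    using Suc.prems by (auto intro!: derivative_eq_intros sum.cong)
  then have "deriv (\<lambda>y. \<Sum>j\<in>{-1..int d}. p j * (\<Prod>i<k. real_of_int j - real i) * y powi (j - int k)) x
     = (\<Sum>j\<in>{-1..int d}. p j * (\<Prod>i<k. real_of_int j - real i) *
         (of_int (j - int k) * x powi (j - int k - 1)))"
    by (rule DERIV_imp_deriv)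
  then show ?case
    unfolding funpow.simps comp_def deriv_cong_ev[OF ev refl]
    by (auto intro!: sum.cong simp: algebra_simps)
qed

lemma deriv_char_P_1:
  "(deriv ^^ k) (char_P d p) (1::real) = (\<Sum>j\<in>{-1..int d}. p j * (\<Prod>i<k. real_of_int j - real i))"
  by (simp add: higher_deriv_char_P)

lemma mean_0: "(\<Sum>j\<in>{-1..int d}. p j * real_of_int j) = 0"
  using P'_1 deriv_char_P_1[of 1] by simp

lemma sum_jp: "(\<Sum>j\<le>d+1. real j * p (int j - 1)) = 1"
proof -
  have "(\<Sum>j\<le>d+1. p (int j - 1) * (real j - 1)) = 0"
    using mean_0 by (simp add: sum_jumps del: sum.atMost_Suc)
  then show ?thesis
    using sum_p by (simp add: algebra_simps sum_subtractf del: sum.atMost_Suc)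
qed

lemma norm_phi_le:
  assumes "norm u \<le> 1" shows "norm (poly phi u) \<le> 1"
proof -
  have "norm (poly phi u) \<le> (\<Sum>j\<le>d+1. norm (of_real (p (int j - 1)) * u ^ j))"
    unfolding poly_phi by (rule norm_sum)
  also have "\<dots> \<le> (\<Sum>j\<le>d+1. p (int j - 1))"
    using assms by (intro sum_mono)
      (auto simp: norm_mult norm_power weight_nonneg abs_of_nonneg power_le_one intro!: mult_left_le)
  finally show ?thesis using sum_p by simp
qed

lemma norm_dphi_le:
  assumes "norm u \<le> 1" shows "norm (dphi u) \<le> 1"
proof -
  have "norm (dphi u) \<le> (\<Sum>j\<le>d+1. norm (of_nat j * of_real (p (int j - 1)) * u ^ (j - 1)))"
    unfolding poly_dphi by (rule norm_sum)
  also have "\<dots> \<le> (\<Sum>j\<le>d+1. real j * p (int j - 1))"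
    using assms by (intro sum_mono)
      (auto simp: norm_mult norm_power weight_nonneg abs_of_nonneg power_le_one intro!: mult_left_le)
  finally show ?thesis using sum_jp by simp
qed

text \<open>Each power u^j is Lipschitz with constant j on the closed unit disc, and zero drift
  makes the weighted sum of these constants equal to 1. This estimate takes the place of an
  application of Rouche's theorem.\<close>

lemma phi_nonexpansive:
  assumes "norm u \<le> 1" "norm w \<le> 1"
  shows "norm (poly phi u - poly phi w) \<le> norm (u - w)"
proof -
  have "norm (poly phi u - poly phi w) =
      norm (\<Sum>j\<le>d+1. of_real (p (int j - 1)) * (u ^ j - w ^ j))"
    by (simp add: poly_phi sum_subtractf algebra_simps del: sum.atMost_Suc)
  also have "\<dots> \<le> (\<Sum>j\<le>d+1. norm (of_real (p (int j - 1)) * (u ^ j - w ^ j)))"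
    by (rule norm_sum)
  also have "\<dots> \<le> (\<Sum>j\<le>d+1. p (int j - 1) * (real j * norm (u - w)))"
  proof (rule sum_mono)
    fix j assume "j \<in> {..d+1}"
    then show "norm (of_real (p (int j - 1)) * (u ^ j - w ^ j)) \<le> p (int j - 1) * (real j * norm (u - w))"
      using norm_power_diff[OF assms, of j] weight_nonneg[of j]
      by (auto simp: norm_mult abs_of_nonneg intro!: mult_left_mono)
  qed
  also have "\<dots> = (\<Sum>j\<le>d+1. real j * p (int j - 1)) * norm (u - w)"
    by (simp add: sum_distrib_right sum_distrib_left algebra_simps del: sum.atMost_Suc)
  finally show ?thesis using sum_jp by simp
qed

lemma unique_root_in_disc:
  assumes "norm z < 1" "norm u \<le> 1" "norm w \<le> 1" "u = z * poly phi u" "w = z * poly phi w"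
  shows "u = w"
proof (rule ccontr)
  assume "u \<noteq> w"
  have "norm (u - w) = norm z * norm (poly phi u - poly phi w)"
    using assms(4,5) by (metis norm_mult right_diff_distrib)
  also have "\<dots> \<le> norm z * norm (u - w)"
    using phi_nonexpansive[OF assms(2,3)] by (simp add: mult_left_mono)
  also have "\<dots> < norm (u - w)" using \<open>u \<noteq> w\<close> assms(1) by simp
  finally show False by simp
qed

lemma root_in_disc_simple:
  assumes "norm z < 1" "norm u \<le> 1" shows "1 - z * dphi u \<noteq> 0"
proof
  assume "1 - z * dphi u = 0"
  then have "norm (z * dphi u) = 1" by simp
  moreover have "norm (z * dphi u) < 1"
    using norm_dphi_le[OF assms(2)] assms(1)
    by (metis mult_le_cancel_left2 norm_ge_zero norm_mult not_le order_le_less_trans)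
  ultimately show False by simp
qed

lemma zP_iff:
  fixes u z :: complex
  assumes "u \<noteq> 0" shows "1 - z * char_P d p u = 0 \<longleftrightarrow> u = z * poly phi u"
  using assms by (auto simp: char_P_eq field_simps)

text \<open>All exponents in the support lie in -1 + q Z, because -1 is itself in the
  support.\<close>

lemma in_periods:
  assumes "q \<ge> 1" and dv: "\<And>j. j \<in> {-1..int d} \<Longrightarrow> p j \<noteq> 0 \<Longrightarrow> int q dvd (j + 1)"
  shows "q \<in> periods d p"
proof -
  define H :: "real fls" where
    "H = (\<Sum>j\<in>{-1..int d}. fls_const (p j) * fls_X_intpow ((j + 1) div int q))"
  have cp: "fls_compose_power (\<Sum>j\<in>A. g j) q = (\<Sum>j\<in>A. fls_compose_power (g j) q)"
    for A and g :: "int \<Rightarrow> real fls"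
    by (induction A rule: infinite_finite_induct) auto
  have "fls_X_intpow (-1) * fls_compose_power H q =
      (\<Sum>j\<in>{-1..int d}. fls_X_intpow (-1) * (fls_const (p j) * fls_X_intpow (int q * ((j + 1) div int q))))"
    using assms(1) by (simp add: H_def cp sum_distrib_left)
  also have "\<dots> = (\<Sum>j\<in>{-1..int d}. fls_const (p j) * fls_X_intpow j)"
  proof (intro sum.cong refl)
    fix j assume j: "j \<in> {-1..int d}"
    show "fls_X_intpow (-1) * (fls_const (p j) * fls_X_intpow (int q * ((j + 1) div int q)))
        = fls_const (p j) * fls_X_intpow j"
    proof (cases "p j = 0")
      case False
      then have "int q * ((j + 1) div int q) = j + 1" using dv[OF j] by auto
      moreover have "fls_X_intpow (-1) * fls_X_intpow (j + 1) = (fls_X_intpow j :: real fls)"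
        by (simp add: fls_shifted_times_simps)
      ultimately show ?thesis by (simp add: mult_ac)
    qed simp
  qed
  finally have "char_P_fls d p = fls_X_intpow (-1) * fls_compose_power H q"
    by (simp add: char_P_fls_def)
  then show ?thesis using assms(1) unfolding periods_def by blast
qed

text \<open>Equality in the triangle inequality forces u^j to be the same for all j in the
  shifted support, hence 1, as j = 0 belongs to it. The order of u then divides every j and is a
  period, so it is 1.\<close>

lemma phi_on_unit_circle:
  assumes u: "norm u = 1" and "norm (poly phi u) \<ge> 1"
  shows "u = 1"
proof -
  define c where "c = poly phi u"
  have nc: "norm c = 1" using norm_phi_le[of u] assms c_def by simp
  have cc: "cnj c * c = 1" using nc by (metis complex_norm_square mult.commute of_real_1 one_power2)
  have le: "Re (cnj c * u ^ j) \<le> 1" for j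
    using complex_Re_le_cmod[of "cnj c * u ^ j"] nc u by (simp add: norm_mult norm_power)
  have "(\<Sum>j\<le>d+1. p (int j - 1) * (1 - Re (cnj c * u ^ j))) =
        (\<Sum>j\<le>d+1. p (int j - 1)) - (\<Sum>j\<le>d+1. Re (cnj c * (of_real (p (int j - 1)) * u ^ j)))"
    unfolding sum_subtractf[symmetric] by (intro sum.cong refl) (simp add: algebra_simps)
  also have "\<dots> = 1 - Re (cnj c * (\<Sum>j\<le>d+1. of_real (p (int j - 1)) * u ^ j))"
    unfolding sum_p Re_sum[symmetric] sum_distrib_left ..
  also have "\<dots> = 0" using cc unfolding poly_phi[symmetric] c_def[symmetric] by simp
  finally have z: "\<forall>j\<in>{..d+1}. p (int j - 1) * (1 - Re (cnj c * u ^ j)) = 0"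
    using le weight_nonneg by (subst (asm) sum_nonneg_eq_0_iff) auto
  have uj: "u ^ j = c" if j: "j \<le> d + 1" "p (int j - 1) \<noteq> 0" for j
  proof -
    have "Re (cnj c * u ^ j) = 1" using z j by force
    moreover have "norm (cnj c * u ^ j) = 1" using nc u by (simp add: norm_mult norm_power)
    ultimately have "Im (cnj c * u ^ j) = 0"
      using cmod_power2[of "cnj c * u ^ j"] by simp
    then have "cnj c * u ^ j = 1"
      using \<open>Re (cnj c * u ^ j) = 1\<close> by (simp only: complex_eq_iff one_complex.sel)
    then have "c * (cnj c * u ^ j) = c" by simp
    then show ?thesis using cc by (metis mult.assoc mult.commute mult_1)
  qed
  have "c = 1" using uj[of 0] p_first by simp
  with uj have one: "u ^ j = 1" if "j \<le> d + 1" "p (int j - 1) \<noteq> 0" for j using that by simp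
  define q where "q = (LEAST k. k \<ge> 1 \<and> u ^ k = 1)"
  have ex: "d + 1 \<ge> 1 \<and> u ^ (d + 1) = 1" using one[of "d+1"] p_last by simp
  have q: "q \<ge> 1 \<and> u ^ q = 1" unfolding q_def by (rule LeastI[where P = "\<lambda>k. k \<ge> 1 \<and> u ^ k = 1", OF ex])
  have min: "q \<le> k" if "k \<ge> 1" "u ^ k = 1" for k
    unfolding q_def by (rule Least_le) (use that in auto)
  have dv: "q dvd k" if "u ^ k = 1" for k
  proof -
    have "u ^ k = u ^ (q * (k div q) + k mod q)" by simp
    also have "\<dots> = u ^ (k mod q)" using q by (simp only: power_add power_mult) simp
    finally have "u ^ (k mod q) = 1" using that by simp
    moreover have "k mod q < q" using q by simp
    ultimately have "\<not> k mod q \<ge> 1" using min by force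
    then show ?thesis by (simp add: dvd_eq_mod_eq_0)
  qed
  have "q \<in> periods d p"
  proof (rule in_periods)
    fix j assume j: "j \<in> {-1..int d}" "p j \<noteq> 0"
    then have "q dvd nat (j + 1)" using one[of "nat (j+1)"] by (intro dv) auto
    then show "int q dvd (j + 1)" using j by (metis atLeastAtMost_iff int_dvd_int_iff int_nat_eq
        add.commute add_increasing diff_ge_0_iff_ge diff_minus_eq_add)
  qed (use q in simp)
  then have "q = 1" using aper q unfolding aperiodic_def by force
  then show ?thesis using q by simp
qed

end

section \<open>The small root and the large roots\<close>

context lukasiewicz
begin

text \<open>The polynomial whose roots are the small root and the large roots.\<close>

definition fz :: "complex \<Rightarrow> complex poly" where
  "fz z = [:0, 1:] - smult z phi"

lemma poly_fz: "poly (fz z) u = u - z * poly phi u"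
  by (simp add: fz_def)

lemma poly_pderiv_fz: "poly (pderiv (fz z)) u = 1 - z * dphi u"
  by (simp add: fz_def pderiv_diff pderiv_smult pderiv_pCons)

lemma phi_0: "poly phi 0 = of_real (p (-1))"
  by (simp add: poly_phi power_0_left if_distrib[of "\<lambda>x. _ * x"] sum.delta del: sum.atMost_Suc cong: if_cong)

lemma coeff_phi: "coeff phi j = (if j \<le> d + 1 then of_real (p (int j - 1)) else 0)"
  by (simp add: phi_def coeff_sum sum.delta' del: sum.atMost_Suc)

lemma degree_phi: "degree phi = d + 1"
proof (rule antisym)
  show "degree phi \<le> d + 1" by (rule degree_le) (simp add: coeff_phi)
  show "d + 1 \<le> degree phi" using p_last by (intro le_degree) (simp add: coeff_phi)
qed

lemma degree_fz: "z \<noteq> 0 \<Longrightarrow> degree (fz z) = d + 1"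
proof -
  assume "z \<noteq> 0"
  have "degree (fz z) = degree (- smult z phi + [:0,1:])" by (simp add: fz_def)
  also have "\<dots> = degree (- smult z phi)"
    using d \<open>z \<noteq> 0\<close> by (intro degree_add_eq_left) (simp add: degree_phi)
  finally show ?thesis using \<open>z \<noteq> 0\<close> by (simp add: degree_phi)
qed

lemma lead_coeff_fz: "z \<noteq> 0 \<Longrightarrow> lead_coeff (fz z) = - z * of_real (p (int d))"
proof -
  assume "z \<noteq> 0"
  have "coeff (fz z) (d + 1) = - z * of_real (p (int d))"
    using d by (simp add: fz_def coeff_phi coeff_pCons split: nat.splits)
  then show ?thesis unfolding degree_fz[OF \<open>z \<noteq> 0\<close>] .
qed

lemma poly_pderiv_at_root:
  "poly (pderiv (smult c ([:- a, 1:] * q))) a = c * poly q (a :: complex)"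
  by (simp only: pderiv_smult pderiv_mult poly_smult poly_add poly_mult) (simp add: pderiv_pCons)

end

text \<open>Only the factorization part of the definition of the large roots is assumed. That
  they tend to infinity follows, and is proved inside this locale when the large roots are
  constructed.\<close>

locale lukasiewicz_roots = lukasiewicz +
  fixes u1 :: "complex \<Rightarrow> complex" and v :: "nat \<Rightarrow> complex \<Rightarrow> complex"
  assumes small: "small_root d p u1"
    and factor: "\<And>z u. 0 < norm z \<Longrightarrow> norm z < 1 \<Longrightarrow> u \<noteq> 0 \<Longrightarrow>
      1 - z * char_P d p u = - (z * of_real (p (int d)) / u) * (u - u1 z) * (\<Prod>k=1..d. u - v k z)"
begin

lemma u1_holomorphic: "u1 holomorphic_on ball 0 1"
  using small by (simp add: small_root_def)

lemma u1_0: "u1 0 = 0"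
proof -
  have "continuous (at 0) u1"
    using u1_holomorphic by (meson centre_in_ball holomorphic_on_imp_continuous_on
        continuous_on_eq_continuous_at open_ball zero_less_one)
  then have "(u1 \<longlongrightarrow> u1 0) (at 0)" by (simp add: continuous_at)
  moreover have "(u1 \<longlongrightarrow> 0) (at 0)" using small by (simp add: small_root_def)
  ultimately show ?thesis using LIM_unique by blast
qed

lemma u1_nonzero: "0 < norm z \<Longrightarrow> norm z < 1 \<Longrightarrow> u1 z \<noteq> 0"
  using small by (auto simp: small_root_def)

lemma u1_root: assumes "norm z < 1" shows "u1 z = z * poly phi (u1 z)"
proof (cases "z = 0")
  case False
  then have "0 < norm z" by simp
  then have "u1 z \<noteq> 0 \<and> 1 - z * char_P d p (u1 z) = 0"
    using small assms unfolding small_root_def by blast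
  then show ?thesis using zP_iff by blast
qed (simp add: u1_0)

text \<open>Along the segment from 0 to z the modulus of the root is continuous and starts at 0.
  If it reached 1, the bound |phi| \<le> 1 on the disc would give |z| \<ge> 1.\<close>

lemma norm_u1: assumes "norm z < 1" shows "norm (u1 z) < 1"
proof (rule ccontr)
  assume "\<not> norm (u1 z) < 1"
  then have ge: "1 \<le> norm (u1 z)" by simp
  have seg: "of_real s * z \<in> ball 0 1" if "s \<in> {0..1}" for s :: real
  proof -
    have "\<bar>s\<bar> * norm z \<le> norm z" using that by (intro mult_left_le_one_le) auto
    then show ?thesis using assms by (simp add: norm_mult)
  qed
  have cont: "continuous_on {0..1} (\<lambda>s::real. norm (u1 (of_real s * z)))"
    by (intro continuous_on_norm continuous_on_compose2[OF holomorphic_on_imp_continuous_on[OF u1_holomorphic]]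
         continuous_intros) (use seg in auto)
  obtain s :: real where s: "0 \<le> s" "s \<le> 1" "norm (u1 (of_real s * z)) = 1"
    using IVT'[of "\<lambda>s::real. norm (u1 (of_real s * z))" 0 1 1] cont ge u1_0 by auto
  have n1: "norm (of_real s * z) < 1" using seg[of s] s by simp
  have "1 = norm (of_real s * z) * norm (poly phi (u1 (of_real s * z)))"
    using u1_root[OF n1] s(3) by (metis norm_mult)
  also have "\<dots> \<le> norm (of_real s * z) * 1"
    using s(3) by (intro mult_left_mono norm_phi_le) auto
  finally show False using n1 by simp
qed

lemma u1_unique: "norm z < 1 \<Longrightarrow> norm u \<le> 1 \<Longrightarrow> u = z * poly phi u \<Longrightarrow> u = u1 z"
  using unique_root_in_disc[of z u "u1 z"] u1_root norm_u1 by (simp add: less_imp_le)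

lemma fz_factor:
  assumes "0 < norm z" "norm z < 1"
  shows "fz z = smult (- z * of_real (p (int d))) ([:- u1 z, 1:] * (\<Prod>k=1..d. [:- v k z, 1:]))"
    (is "_ = ?R")
proof -
  have "poly (fz z) u = poly ?R u" if "u \<noteq> 0" for u
  proof -
    have "1 - z * char_P d p u = - (z * of_real (p (int d)) / u) * (u - u1 z) * (\<Prod>k=1..d. u - v k z)"
      by (rule factor[OF assms that])
    then have "u * (1 - z * (poly phi u / u)) =
        u * (- (z * of_real (p (int d)) / u) * (u - u1 z) * (\<Prod>k=1..d. u - v k z))"
      unfolding char_P_eq[OF that] by (rule arg_cong)
    then have "u - z * poly phi u = - (z * of_real (p (int d))) * (u - u1 z) * (\<Prod>k=1..d. u - v k z)"
      using that by (simp add: right_diff_distrib)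
    then show ?thesis by (simp add: poly_fz poly_prod algebra_simps)
  qed
  then have "poly [:0,1:] u * poly (fz z) u = poly [:0,1:] u * poly ?R u" for u
    by (cases "u = 0") simp_all
  then have "poly ([:0,1:] * fz z) = poly ([:0,1:] * ?R)"
    unfolding poly_mult by (intro ext)
  then have "[:0,1:] * fz z = [:0,1:] * ?R" by (simp only: poly_eq_poly_eq_iff)
  then show ?thesis by (simp only: mult_cancel_left) auto
qed

lemma poly_fz_factor:
  assumes "0 < norm z" "norm z < 1"
  shows "u - z * poly phi u = - z * of_real (p (int d)) * (u - u1 z) * (\<Prod>k=1..d. u - v k z)"
  using arg_cong[OF fz_factor[OF assms], of "\<lambda>q. poly q u"] by (simp add: poly_fz poly_prod algebra_simps)

lemma root_cases:
  assumes "0 < norm z" "norm z < 1" "u = z * poly phi u"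
  shows "u = u1 z \<or> (\<exists>k\<in>{1..d}. u = v k z)"
  using poly_fz_factor[OF assms(1,2), of u] assms p_last by auto

lemma v_root:
  assumes "0 < norm z" "norm z < 1" "k \<in> {1..d}"
  shows "v k z = z * poly phi (v k z)"
proof -
  have "(\<Prod>m=1..d. v k z - v m z) = 0" by (rule prod_zero) (use assms(3) in \<open>auto intro!: bexI[of _ k]\<close>)
  then have "v k z - z * poly phi (v k z) = 0"
    unfolding poly_fz_factor[OF assms(1,2)] by (simp only: mult_zero_right)
  then show ?thesis by simp
qed

lemma v_nonzero:
  assumes "0 < norm z" "norm z < 1" "k \<in> {1..d}" shows "v k z \<noteq> 0"
  using v_root[OF assms] phi_0 p_first assms by (metis less_irrefl mult_eq_0_iff of_real_eq_0_iff norm_zero)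

lemma deriv_fz_u1:
  assumes "0 < norm z" "norm z < 1"
  shows "1 - z * dphi (u1 z) = - z * of_real (p (int d)) * (\<Prod>m=1..d. u1 z - v m z)"
  unfolding poly_pderiv_fz[symmetric] fz_factor[OF assms] poly_pderiv_at_root
  by (simp add: poly_prod)

text \<open>A large root in the closed disc would coincide with the small root, which would then
  be a double root.\<close>

lemma norm_v:
  assumes "0 < norm z" "norm z < 1" "k \<in> {1..d}" shows "norm (v k z) > 1"
proof (rule ccontr)
  assume "\<not> norm (v k z) > 1"
  then have "v k z = u1 z" using u1_unique v_root assms by simp
  then have "(\<Prod>m=1..d. u1 z - v m z) = 0" using \<open>v k z = u1 z\<close>
    by (intro prod_zero) (use assms(3) in \<open>auto intro!: bexI[of _ k]\<close>)
  then have "1 - z * dphi (u1 z) = 0" using deriv_fz_u1[OF assms(1,2)] by simp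
  then show False using root_in_disc_simple[OF assms(2)] norm_u1[OF assms(2)] by simp
qed

lemma deriv_fz_v:
  assumes "0 < norm z" "norm z < 1" "k \<in> {1..d}"
  shows "1 - z * dphi (v k z) =
    - z * of_real (p (int d)) * (v k z - u1 z) * (\<Prod>m\<in>{1..d}-{k}. v k z - v m z)"
proof -
  have "(\<Prod>m=1..d. [:- v m z, 1:]) = [:- v k z, 1:] * (\<Prod>m\<in>{1..d}-{k}. [:- v m z, 1:])"
    using assms(3) by (subst prod.remove[of _ k]) auto
  then have f: "fz z = smult (- z * of_real (p (int d)))
      ([:- v k z, 1:] * ([:- u1 z, 1:] * (\<Prod>m\<in>{1..d}-{k}. [:- v m z, 1:])))"
    using fz_factor[OF assms(1,2)] by (simp only: mult.left_commute)
  show ?thesis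
    unfolding poly_pderiv_fz[symmetric] f poly_pderiv_at_root
    by (simp add: poly_prod left_diff_distrib)
qed

lemma deriv_u1:
  assumes "norm z < 1"
  shows "deriv u1 z * (1 - z * dphi (u1 z)) = poly phi (u1 z)"
proof -
  have D: "(u1 has_field_derivative deriv u1 z) (at z)"
    using u1_holomorphic assms by (intro holomorphic_derivI[of _ "ball 0 1"]) auto
  have ev: "eventually (\<lambda>w. u1 w = w * poly phi (u1 w)) (nhds z)"
    using eventually_nhds_in_open[of "ball 0 1" z] assms
    by (auto elim!: eventually_mono intro!: u1_root)
  have "((\<lambda>w. w * poly phi (u1 w)) has_field_derivative
      (poly phi (u1 z) + z * (dphi (u1 z) * deriv u1 z))) (at z)"
    by (rule derivative_eq_intros poly_DERIV[THEN DERIV_chain2] D refl)+ simp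
  then have "(u1 has_field_derivative (poly phi (u1 z) + z * (dphi (u1 z) * deriv u1 z))) (at z)"
    using DERIV_cong_ev[OF refl ev refl] by blast
  then have "deriv u1 z = poly phi (u1 z) + z * (dphi (u1 z) * deriv u1 z)"
    using D DERIV_unique by blast
  then show ?thesis by (simp add: algebra_simps)
qed

text \<open>The contribution of the large root u to the generating function, written so that it
  depends on z and u alone and not on the labelling of the roots.\<close>

definition root_term :: "real \<Rightarrow> complex \<Rightarrow> complex \<Rightarrow> complex" where
  "root_term h z u = - ((u1 z / u) powr of_real h * (u1 z / u) / (1 - z * dphi u))"

text \<open>Up to a common constant, Q_k(u1) (u1 - v_k) and Q_k(v_k) (v_k - u1) are the
  derivatives of u - z phi(u) at u1 and v_k. At a multiple root both sides contain a division by
  zero, and both vanish.\<close>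

lemma gen_fun_eq:
  assumes "0 < norm z" "norm z < 1"
  shows "gen_fun d u1 v h z = (\<Sum>k=1..d. root_term h z (v k z))"
  unfolding gen_fun_def sum_distrib_left
proof (rule sum.cong[OF refl])
  fix k assume k: "k \<in> {1..d}"
  let ?c = "- z * of_real (p (int d))" and ?A = "1 - z * dphi (u1 z)" and ?B = "1 - z * dphi (v k z)"
  have c: "?c \<noteq> 0" using assms p_last by auto
  have ne: "u1 z - v k z \<noteq> 0" "v k z - u1 z \<noteq> 0"
    using norm_u1[OF assms(2)] norm_v[OF assms k] by auto
  have A0: "?A \<noteq> 0" using root_in_disc_simple[OF assms(2)] norm_u1[OF assms(2)] by simp
  have "(\<Prod>m=1..d. u1 z - v m z) = (u1 z - v k z) * Q_poly d v k z (u1 z)"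
    unfolding Q_poly_def using k by (subst prod.remove[of _ k]) auto
  then have QA: "Q_poly d v k z (u1 z) = ?A / (?c * (u1 z - v k z))"
    unfolding deriv_fz_u1[OF assms] using c ne by simp
  have QB: "Q_poly d v k z (v k z) = ?B / (?c * (v k z - u1 z))"
    unfolding Q_poly_def deriv_fz_v[OF assms k] using c ne by simp
  have quo: "Q_poly d v k z (u1 z) / Q_poly d v k z (v k z) = - (?A / ?B)"
  proof (cases "?B = 0")
    case False
    have "?c * (v k z - u1 z) = - (?c * (u1 z - v k z))" by (simp add: algebra_simps)
    then show ?thesis unfolding QA QB using False A0 c ne
      by (simp only: ) (simp add: divide_simps)
  qed (simp add: QB)
  have du: "z * deriv u1 z = u1 z / ?A"
    using deriv_u1[OF assms(2)] u1_root[OF assms(2)] A0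
    by (metis mult.assoc nonzero_eq_divide_eq)
  have "z * ((u1 z / v k z) powr of_real h * (Q_poly d v k z (u1 z) / Q_poly d v k z (v k z)) * (deriv u1 z / v k z))
    = (u1 z / v k z) powr of_real h * (- (?A / ?B)) * ((z * deriv u1 z) / v k z)"
    unfolding quo by simp
  also have "\<dots> = root_term h z (v k z)"
    unfolding du root_term_def using A0 by simp
  finally show "z * ((u1 z / v k z) powr of_real h * (Q_poly d v k z (u1 z) / Q_poly d v k z (v k z)) * (deriv u1 z / v k z))
    = root_term h z (v k z)" .
qed

lemma norm_root_term:
  "norm (root_term h z u) = norm (u1 z / u) powr h * norm (u1 z / u) / norm (1 - z * dphi u)"
  by (simp add: root_term_def norm_mult norm_divide norm_powr_real_powr')

end

section \<open>The two roots that meet at u = 1\<close>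

lemma has_fps_expansion_remainder:
  fixes f :: "complex \<Rightarrow> complex"
  assumes "f has_fps_expansion F"
  obtains C r where "C > 0" "r > 0"
    "\<And>z. norm z < r \<Longrightarrow> norm (f z - (\<Sum>k<n. fps_nth F k * z ^ k)) \<le> C * norm z ^ n"
proof -
  define g where "g = eval_fps (fps_shift n F)"
  have rad: "fps_conv_radius (fps_shift n F) > 0"
    using assms by (simp add: has_fps_expansion_def)
  then have g: "g has_fps_expansion fps_shift n F"
    unfolding g_def by (rule eval_fps_has_fps_expansion)
  have "(\<lambda>z. (\<Sum>k<n. fps_nth F k * z ^ k) + z ^ n * g z) has_fps_expansion
      ((\<Sum>k<n. fps_const (fps_nth F k) * fps_X ^ k) + fps_X ^ n * fps_shift n F)"
    by (intro fps_expansion_intros g)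
  moreover have "(\<Sum>k<n. fps_const (fps_nth F k) * fps_X ^ k) + fps_X ^ n * fps_shift n F = F"
    by (rule fps_ext) (auto simp: fps_sum_nth fps_X_power_mult_nth fps_mult_left_const_nth
        fps_X_power_nth if_distrib sum.delta cong: if_cong)
  ultimately have "(\<lambda>z. (\<Sum>k<n. fps_nth F k * z ^ k) + z ^ n * g z) has_fps_expansion F"
    by simp
  then have ev: "eventually (\<lambda>z. f z = (\<Sum>k<n. fps_nth F k * z ^ k) + z ^ n * g z) (nhds 0)"
    using assms unfolding has_fps_expansion_def by (auto elim: eventually_elim2)
  have "isCont g 0" using g by (rule has_fps_expansion_imp_continuous)
  then have "eventually (\<lambda>z. norm (g z) < norm (g 0) + 1) (nhds 0)"
    unfolding isCont_def tendsto_at_iff_tendsto_nhds by (intro order_tendstoD(2)[OF tendsto_norm]) auto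
  with ev have "eventually (\<lambda>z. norm (f z - (\<Sum>k<n. fps_nth F k * z ^ k)) \<le> (norm (g 0) + 1) * norm z ^ n) (nhds 0)"
  proof eventually_elim
    case (elim z)
    have "norm (f z - (\<Sum>k<n. fps_nth F k * z ^ k)) = norm (g z) * norm z ^ n"
      using elim(1) by (simp add: norm_mult norm_power)
    also have "\<dots> \<le> (norm (g 0) + 1) * norm z ^ n"
      using elim(2) by (intro mult_right_mono) auto
    finally show ?case .
  qed
  then obtain r where "r > 0" "\<And>z. norm z < r \<Longrightarrow>
      norm (f z - (\<Sum>k<n. fps_nth F k * z ^ k)) \<le> (norm (g 0) + 1) * norm z ^ n"
    by (auto simp: eventually_nhds_metric)
  then show ?thesis using that[of "norm (g 0) + 1" r] by (auto simp: add_nonneg_pos)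
qed

context lukasiewicz
begin

definition mu :: "nat \<Rightarrow> real" where
  "mu k = (\<Sum>j\<in>{-1..int d}. p j * real_of_int j ^ k)"

text \<open>The k-th derivative of s \<mapsto> P(exp s), the moment generating function of a
  step.\<close>

definition mgf :: "nat \<Rightarrow> complex \<Rightarrow> complex" where
  "mgf k s = (\<Sum>j\<in>{-1..int d}. of_real (p j) * of_int j ^ k * exp (of_int j * s))"

lemma mgf_0: "mgf k 0 = of_real (mu k)"
  by (simp add: mgf_def mu_def)

lemma mgf_deriv: "(mgf k has_field_derivative mgf (Suc k) s) (at s)"
  unfolding mgf_def by (auto intro!: derivative_eq_intros sum.cong)

lemma mgf_holomorphic: "mgf k holomorphic_on A"
  unfolding mgf_def by (intro holomorphic_intros)

lemma mgf_phi: "mgf 0 s = poly phi (exp s) / exp s"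
proof -
  have "exp (of_int (int j - 1) * s) = exp s ^ j / exp s" for j
    by (simp add: left_diff_distrib exp_diff exp_of_nat_mult)
  then show ?thesis
    by (simp add: mgf_def sum_jumps poly_phi sum_divide_distrib del: sum.atMost_Suc)
qed

lemma mgf_1_phi: "mgf 1 s = dphi (exp s) - mgf 0 s"
proof -
  have "((\<lambda>s. poly phi (exp s) / exp s) has_field_derivative
      ((dphi (exp s) * exp s) * exp s - poly phi (exp s) * exp s) / (exp s * exp s)) (at s)"
    by (auto intro!: derivative_eq_intros poly_DERIV[THEN DERIV_chain2])
  moreover have "mgf 0 = (\<lambda>s. poly phi (exp s) / exp s)" using mgf_phi by auto
  ultimately have "mgf 1 s = ((dphi (exp s) * exp s) * exp s - poly phi (exp s) * exp s) / (exp s * exp s)"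
    using mgf_deriv[of 0 s] DERIV_unique by fastforce
  then show ?thesis by (simp add: mgf_phi diff_divide_distrib)
qed

lemma mu_0: "mu 0 = 1" and mu_1: "mu 1 = 0"
  using P_1 mean_0 by (simp_all add: mu_def char_P_def)

lemma mu_2_pos: "mu 2 > 0"
proof -
  have "0 < p (-1) * real_of_int (-1) ^ 2" using p_first by simp
  also have "\<dots> \<le> mu 2"
    unfolding mu_def by (rule member_le_sum) (auto intro!: mult_nonneg_nonneg p_nonneg)
  finally show ?thesis .
qed

definition sg :: real where "sg = sqrt (mu 2)"

lemma sg_pos: "sg > 0" and sg_sq: "sg ^ 2 = mu 2"
  using mu_2_pos by (auto simp: sg_def)

text \<open>The Taylor coefficients of the solution S of P(exp(S t)) = exp(t^2/2); see
  \<open>local_inverse_fps\<close>.\<close>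

definition c1 :: real where "c1 = 1 / sg"
definition c2 :: real where "c2 = - mu 3 / (6 * sg ^ 4)"
definition c3 :: real where
  "c3 = (1 / 8 - mu 4 / (24 * sg ^ 4) + 5 * mu 3 ^ 2 / (72 * sg ^ 6)) / sg"

lemma sg_deriv: "sg = sqrt ((deriv ^^ 2) (char_P d p) 1)"
  and mu_3_deriv: "mu 3 = (deriv ^^ 3) (char_P d p) (1::real) + 3 * sg ^ 2"
  and mu_4_deriv: "mu 4 = (deriv ^^ 4) (char_P d p) (1::real) + 6 * (deriv ^^ 3) (char_P d p) 1 + 7 * sg ^ 2"
proof -
  let ?s = "\<lambda>f::int \<Rightarrow> real. \<Sum>j\<in>{-1..int d}. p j * f j"
  have s: "?s (\<lambda>j. \<Prod>i<k. real_of_int j - real i) = (deriv ^^ k) (char_P d p) 1" for k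
    by (simp add: deriv_char_P_1)
  have mu1: "?s (\<lambda>j. real_of_int j) = 0" using mu_1 by (simp add: mu_def)
  have "(deriv ^^ 2) (char_P d p) 1 = ?s (\<lambda>j. real_of_int j ^ 2 - real_of_int j)"
    unfolding s[symmetric] by (intro sum.cong refl) (simp add: numeral_eq_Suc algebra_simps)
  also have "\<dots> = mu 2" using mu1 by (simp add: mu_def right_diff_distrib sum_subtractf)
  finally have 2: "(deriv ^^ 2) (char_P d p) 1 = mu 2" .
  then show "sg = sqrt ((deriv ^^ 2) (char_P d p) 1)" by (simp add: sg_def)
  have "(deriv ^^ 3) (char_P d p) 1 = ?s (\<lambda>j. real_of_int j ^ 3 - 3 * real_of_int j ^ 2 + 2 * real_of_int j)"
    unfolding s[symmetric] by (intro sum.cong refl) (simp add: numeral_eq_Suc algebra_simps)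
  also have "\<dots> = mu 3 - 3 * mu 2 + 2 * ?s (\<lambda>j. real_of_int j)"
    unfolding mu_def sum_distrib_left sum_subtractf[symmetric] sum.distrib[symmetric]
    by (intro sum.cong refl) (simp add: algebra_simps)
  finally have 3: "(deriv ^^ 3) (char_P d p) 1 = mu 3 - 3 * mu 2" using mu1 by simp
  then show "mu 3 = (deriv ^^ 3) (char_P d p) (1::real) + 3 * sg ^ 2" by (simp add: sg_sq)
  have "(deriv ^^ 4) (char_P d p) 1 =
      ?s (\<lambda>j. real_of_int j ^ 4 - 6 * real_of_int j ^ 3 + 11 * real_of_int j ^ 2 - 6 * real_of_int j)"
    unfolding s[symmetric] by (intro sum.cong refl) (simp add: numeral_eq_Suc algebra_simps)
  also have "\<dots> = mu 4 - 6 * mu 3 + 11 * mu 2 - 6 * ?s (\<lambda>j. real_of_int j)"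
    unfolding mu_def sum_distrib_left sum_subtractf[symmetric] sum.distrib[symmetric]
    by (intro sum.cong refl) (simp add: algebra_simps)
  finally have "(deriv ^^ 4) (char_P d p) 1 = mu 4 - 6 * mu 3 + 11 * mu 2" using mu1 by simp
  then show "mu 4 = (deriv ^^ 4) (char_P d p) (1::real) + 6 * (deriv ^^ 3) (char_P d p) 1 + 7 * sg ^ 2"
    using 3 by (simp add: sg_sq)
qed

lemma mgf_fps: "mgf 0 has_fps_expansion Abs_fps (\<lambda>k. of_real (mu k) / fact k)"
proof -
  have "(\<lambda>s. \<Sum>j\<in>{-1..int d}. of_real (p j) * exp (of_int j * s)) has_fps_expansion
      (\<Sum>j\<in>{-1..int d}. fps_const (of_real (p j)) * fps_exp (of_int j :: complex))"
    by (intro fps_expansion_intros)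
  moreover have "(\<Sum>j\<in>{-1..int d}. fps_const (of_real (p j)) * fps_exp (of_int j :: complex))
      = Abs_fps (\<lambda>k. of_real (mu k) / fact k)"
    by (rule fps_ext) (simp add: fps_sum_nth mu_def sum_divide_distrib)
  ultimately show ?thesis unfolding mgf_def by simp
qed

text \<open>Comparing the coefficients of t^2, t^3 and t^4 on both sides determines the first
  three coefficients of S one after the other; the first one only up to sign.\<close>

lemma local_inverse_fps:
  assumes F: "S has_fps_expansion F" and F0: "fps_nth F 0 = 0"
    and ev: "eventually (\<lambda>t. mgf 0 (S t) = exp (t ^ 2 / 2)) (nhds 0)"
  shows "of_real (mu 2) * fps_nth F 1 ^ 2 = 1"
    and "fps_nth F 1 = of_real c1 \<Longrightarrow> fps_nth F 2 = of_real c2"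
    and "fps_nth F 1 = of_real c1 \<Longrightarrow> fps_nth F 3 = of_real c3"
proof -
  let ?M = "Abs_fps (\<lambda>k. of_real (mu k) / fact k) :: complex fps"
  let ?E = "fps_compose (fps_exp 1) (fps_const (1/2) * fps_X ^ 2) :: complex fps"
  have 1: "(mgf 0 \<circ> S) has_fps_expansion fps_compose ?M F"
    by (intro fps_expansion_intros mgf_fps F F0)
  have "(exp \<circ> (\<lambda>t::complex. (1/2) * t ^ 2)) has_fps_expansion ?E"
    by (intro fps_expansion_intros) (simp add: fps_X_power_nth)
  then have "(mgf 0 \<circ> S) has_fps_expansion ?E"
    using ev unfolding has_fps_expansion_def by (auto elim: eventually_elim2)
  with 1 have eq: "fps_compose ?M F = ?E" by (rule fps_expansion_unique_complex)
  define a b c where "a = fps_nth F 1" and "b = fps_nth F 2" and "c = fps_nth F 3"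
  note ev = fps_compose_nth numeral_eq_Suc fps_mult_nth power_Suc fps_X_power_nth fps_X_nth
  have F': "fps_nth F (Suc 0) = a" "fps_nth F (Suc (Suc 0)) = b" "fps_nth F (Suc (Suc (Suc 0))) = c"
    by (simp_all add: a_def b_def c_def numeral_eq_Suc)
  have mu': "mu (Suc 0) = 0" using mu_1 by simp
  have e2: "fps_nth (fps_compose ?M F) 2 = fps_nth ?E 2"
    and e3: "fps_nth (fps_compose ?M F) 3 = fps_nth ?E 3"
    and e4: "fps_nth (fps_compose ?M F) 4 = fps_nth ?E 4" by (simp_all only: eq)
  have r2: "of_real (mu 2) * a ^ 2 = 1"
    using e2 by (simp add: ev F0 F' mu')
  have r3: "of_real (mu 2) * a * b + of_real (mu 3) * a ^ 3 / 6 = 0"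
    using e3 by (simp add: ev F0 F' mu' field_simps)
  have r4: "of_real (mu 2) * (b ^ 2 + 2 * a * c) / 2 + of_real (mu 3) * (3 * a ^ 2 * b) / 6
      + of_real (mu 4) * a ^ 4 / 24 = 1 / 8"
    using e4 by (simp add: ev F0 F' mu' field_simps)
  show "of_real (mu 2) * fps_nth F 1 ^ 2 = 1" using r2 by (simp add: a_def)
  show *: "fps_nth F 2 = of_real c2" if "fps_nth F 1 = of_real c1"
  proof -
    have a: "a = 1 / of_real sg" using that by (simp add: a_def c1_def)
    have "of_real (sg ^ 2) * a * b + of_real (mu 3) * a ^ 3 / 6 = 0"
      using r3 by (simp add: sg_sq)
    then have "6 * of_real sg ^ 4 * b = - of_real (mu 3)"
      using sg_pos unfolding eq_neg_iff_add_eq_0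
      by (simp add: a field_simps power2_eq_square power3_eq_cube power4_eq_xxxx)
    then have "b = of_real c2"
      using sg_pos by (simp add: c2_def field_simps)
    then show ?thesis by (simp add: b_def)
  qed
  show "fps_nth F 3 = of_real c3" if "fps_nth F 1 = of_real c1"
  proof -
    have a: "a = 1 / of_real sg" using that by (simp add: a_def c1_def)
    have b: "b = of_real c2" using *[OF that] by (simp add: b_def)
    have s0: "(of_real sg :: complex) \<noteq> 0" using sg_pos by simp
    have "of_real (sg ^ 2) * (b ^ 2 + 2 * a * c) / 2 + of_real (mu 3) * (3 * a ^ 2 * b) / 6
      + of_real (mu 4) * a ^ 4 / 24 = 1 / 8"
      using r4 by (simp add: sg_sq)
    moreover have "of_real (sg ^ 2) * (b ^ 2 + 2 * a * c) / 2 = of_real sg ^ 2 * b ^ 2 / 2 + of_real sg * c"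
      using s0 by (simp add: a field_simps power2_eq_square)
    moreover have "y = e - x - A - B" if "w + A + B = e" "w = x + y" for w x y A B e :: complex
      using that by (simp add: algebra_simps)
    ultimately have "of_real sg * c = 1 / 8 - of_real sg ^ 2 * b ^ 2 / 2 - of_real (mu 3) * (3 * a ^ 2 * b) / 6
      - of_real (mu 4) * a ^ 4 / 24" by blast
    also have "\<dots> = of_real (sg * c3)"
      using s0 sg_pos by (simp add: a b c2_def c3_def field_simps eval_nat_numeral)
    finally have "c = of_real c3" using s0 by simp
    then show ?thesis by (simp add: c_def)
  qed
qed


text \<open>As the drift is zero, 2 log P(exp s) has a double zero at s = 0, so it is the square
  of a local coordinate G. The inverse of G, with the sign that makes its derivative positive,
  is S. The last clause holds because G(s)^2 = t^2 has only the solutions S(t) and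
  S(-t).\<close>

lemma local_param:
  obtains S \<rho> C \<epsilon> where "S holomorphic_on ball 0 \<rho>" "\<rho> > 0" "C > 0" "S 0 = 0" "\<epsilon> > 0"
    "\<And>t. norm t < \<rho> \<Longrightarrow> mgf 0 (S t) = exp (t ^ 2 / 2)"
    "\<And>t. norm t < \<rho> \<Longrightarrow> norm (S t - (of_real c1 * t + of_real c2 * t ^ 2 + of_real c3 * t ^ 3)) \<le> C * norm t ^ 4"
    "\<And>t. norm t < \<rho> \<Longrightarrow> norm (deriv S t - (of_real c1 + 2 * of_real c2 * t + 3 * of_real c3 * t ^ 2)) \<le> C * norm t ^ 3"
    "\<And>s t. norm s < \<epsilon> \<Longrightarrow> norm t < \<epsilon> \<Longrightarrow> mgf 0 s = exp (t ^ 2 / 2) \<Longrightarrow> s = S t \<or> s = S (- t)"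
proof -
  define U where "U = {s. mgf 0 s \<notin> \<real>\<^sub>\<le>\<^sub>0}"
  have cont: "continuous_on UNIV (mgf 0)"
    using mgf_holomorphic holomorphic_on_imp_continuous_on by blast
  have "U = - (mgf 0 -` \<real>\<^sub>\<le>\<^sub>0)" by (auto simp: U_def)
  moreover have "closed (mgf 0 -` \<real>\<^sub>\<le>\<^sub>0)"
    by (intro closed_vimage closed_nonpos_Reals_complex cont)
  ultimately have "open U" using open_Compl by metis
  have "0 \<in> U" by (simp add: U_def mgf_0 mu_0)
  define L where "L = (\<lambda>s. 2 * Ln (mgf 0 s))"
  have L_hol: "L holomorphic_on U"
    unfolding L_def by (intro holomorphic_intros mgf_holomorphic) (auto simp: U_def)
  have nz: "mgf 0 s \<noteq> 0" if "s \<in> U" for s using that by (auto simp: U_def)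
  have dL: "deriv L s = 2 * (mgf 1 s / mgf 0 s)" if "s \<in> U" for s
    unfolding L_def
    by (rule DERIV_imp_deriv) (use that nz mgf_deriv[of 0] in \<open>auto intro!: derivative_eq_intros simp: U_def divide_inverse mult_ac\<close>)
  have dL0: "deriv L 0 = 0"
    using \<open>0 \<in> U\<close> mu_1 by (simp add: dL mgf_0[of 1, simplified])
  have "deriv (deriv L) 0 = deriv (\<lambda>s. 2 * (mgf 1 s / mgf 0 s)) 0"
    using eventually_nhds_in_open[OF \<open>open U\<close> \<open>0 \<in> U\<close>] dL
    by (intro deriv_cong_ev refl) (auto elim: eventually_mono)
  also have "\<dots> = 2 * of_real (mu 2)"
  proof -
    have "((\<lambda>s. 2 * (mgf 1 s / mgf 0 s)) has_field_derivative
        2 * ((mgf (Suc 1) 0 * mgf 0 0 - mgf 1 0 * mgf (Suc 0) 0) / (mgf 0 0 * mgf 0 0))) (at 0)"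
      using nz[OF \<open>0 \<in> U\<close>] by (intro DERIV_cmult DERIV_divide mgf_deriv)
    then show ?thesis using mu_0 mu_1 by (simp add: DERIV_imp_deriv mgf_0 numeral_2_eq_2)
  qed
  finally have ddL: "(deriv ^^ 2) L 0 \<noteq> 0" using mu_2_pos by (simp add: numeral_2_eq_2)
  have L0: "L 0 = 0" by (simp add: L_def mgf_0 mu_0)
  obtain g r where r: "r > 0" and g_hol: "g holomorphic_on ball 0 r"
    and Lg: "\<And>w. w \<in> ball 0 r \<Longrightarrow> L w - L 0 = ((w - 0) * g w) ^ 2"
    and g_nz: "\<And>w. w \<in> ball 0 r \<Longrightarrow> g w \<noteq> 0"
    by (rule holomorphic_factor_order_of_zero_strong[OF L_hol \<open>open U\<close> \<open>0 \<in> U\<close> _ ddL])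
       (auto simp: dL0 less_Suc_eq numeral_2_eq_2)
  obtain r0 where r0: "r0 > 0" "ball (0::complex) r0 \<subseteq> U"
    using \<open>open U\<close> \<open>0 \<in> U\<close> by (auto simp: open_contains_ball)
  define G where "G = (\<lambda>s. s * g s)"
  have G_hol: "G holomorphic_on ball 0 (min r r0)"
    unfolding G_def by (intro holomorphic_intros holomorphic_on_subset[OF g_hol]) auto
  have "(G has_field_derivative 1 * g 0 + deriv g 0 * 0) (at 0)"
    unfolding G_def
    by (intro DERIV_mult DERIV_ident holomorphic_derivI[OF g_hol]) (use r in auto)
  then have dG: "deriv G 0 \<noteq> 0" using g_nz[of 0] r by (simp add: DERIV_imp_deriv)
  have in0: "0 \<in> ball (0::complex) (min r r0)" using r r0 by simp
  obtain r1 where r1: "r1 > 0" "ball 0 r1 \<subseteq> ball (0::complex) (min r r0)" "open (G ` ball 0 r1)" "inj_on G (ball 0 r1)"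
    using has_complex_derivative_locally_invertible[OF G_hol in0 open_ball dG] by blast
  obtain S0 where S0: "S0 holomorphic_on (G ` ball 0 r1)" and S0G: "\<And>z. z \<in> ball 0 r1 \<Longrightarrow> S0 (G z) = z"
    using holomorphic_has_inverse[OF holomorphic_on_subset[OF G_hol r1(2)] open_ball r1(4)] by metis
  have "0 \<in> G ` ball 0 r1" using r1(1) by (auto simp: G_def intro!: image_eqI[of _ _ 0])
  then obtain \<rho>1 where \<rho>1: "\<rho>1 > 0" "ball 0 \<rho>1 \<subseteq> G ` ball 0 r1"
    using r1(3) by (auto simp: open_contains_ball)
  have LG: "L s = G s ^ 2" "s \<in> U" if "norm s < r1" for s
  proof -
    have "s \<in> ball 0 (min r r0)" using r1(2) that by (auto simp: subset_iff)
    then show "L s = G s ^ 2" "s \<in> U" using Lg[of s] r0(2) by (auto simp: G_def L0 subset_iff)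
  qed
  have S0_eq: "mgf 0 (S0 t) = exp (t ^ 2 / 2)" if t: "norm t < \<rho>1" for t
  proof -
    obtain s where s: "norm s < r1" "t = G s" using t \<rho>1(2) by (auto simp: subset_iff)
    then have "L s = t ^ 2" "S0 t = s" using LG S0G[of s] by auto
    then have "exp (t ^ 2 / 2) = exp (Ln (mgf 0 (S0 t)))" by (simp add: L_def flip: \<open>L s = t ^ 2\<close>)
    then show ?thesis using nz[OF LG(2)[OF s(1)]] \<open>S0 t = s\<close> by simp
  qed
  have S0_0: "S0 0 = 0" using S0G[of 0] r1(1) by (simp add: G_def)
  have S0_uniq: "s = S0 t \<or> s = S0 (- t)"
    if "norm s < r1" "norm t < 1" "mgf 0 s = exp (t ^ 2 / 2)" for s t
  proof -
    have "\<bar>Im (t ^ 2 / 2)\<bar> < 1"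
      using abs_Im_le_cmod[of "t ^ 2 / 2"] that(2) power_le_one[of "norm t" 2]
      by (simp add: norm_divide norm_power)
    then have "Ln (exp (t ^ 2 / 2)) = t ^ 2 / 2" using pi_gt3 by (intro Ln_exp) auto
    then have "L s = t ^ 2" unfolding L_def that(3) by (simp only:) simp
    then have "G s ^ 2 = t ^ 2" using LG[OF that(1)] by simp
    then have "G s = t \<or> G s = - t" by (simp add: power2_eq_iff)
    then show ?thesis using S0G[of s] that(1) by auto
  qed
  define F0 where "F0 = fps_expansion S0 0"
  have S0_hol: "S0 holomorphic_on ball 0 \<rho>1" using S0 \<rho>1(2) by (rule holomorphic_on_subset)
  have F0: "S0 has_fps_expansion F0"
    unfolding F0_def by (rule has_fps_expansion_fps_expansion[OF _ _ S0_hol]) (use \<rho>1 in auto)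
  have "F0 $ 0 = 0" using has_fps_expansion_imp_0_eq_fps_nth_0[OF F0] S0_0 by simp
  moreover have "eventually (\<lambda>t. mgf 0 (S0 t) = exp (t ^ 2 / 2)) (nhds 0)"
    using eventually_nhds_in_open[of "ball 0 \<rho>1" 0] \<rho>1(1) S0_eq by (auto elim!: eventually_mono)
  ultimately have "of_real (mu 2) * (F0 $ 1) ^ 2 = 1" by (rule local_inverse_fps(1)[OF F0])
  then have "(of_real sg * F0 $ 1) ^ 2 = 1"
    by (simp only: power_mult_distrib of_real_power[symmetric] sg_sq)
  then have "of_real sg * F0 $ 1 = 1 \<or> of_real sg * F0 $ 1 = -1"
    by (simp only: power2_eq_1_iff)
  then have "F0 $ 1 = of_real c1 \<or> - (F0 $ 1) = of_real c1"
    using sg_pos by (auto simp: c1_def field_simps)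
  then obtain e :: complex where e: "e = 1 \<or> e = -1" "e * F0 $ 1 = of_real c1"
    by (metis mult_1 mult_minus1)
  have ne: "norm (e * t) = norm t" "e ^ 2 = 1" for t using e(1) by (auto simp: norm_mult)
  define S where "S = (\<lambda>t. S0 (e * t))"
  have S_hol: "S holomorphic_on ball 0 \<rho>1"
    unfolding S_def
    by (rule holomorphic_on_compose_gen[unfolded o_def, OF _ S0_hol, where f = "\<lambda>t. e * t"])
       (use ne in \<open>auto intro!: holomorphic_intros\<close>)
  have S_0: "S 0 = 0" by (simp add: S_def S0_0)
  have S_eq: "mgf 0 (S t) = exp (t ^ 2 / 2)" if "norm t < \<rho>1" for t
    using S0_eq[of "e * t"] that ne by (simp add: S_def power_mult_distrib)
  define F where "F = fps_expansion S 0"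
  have F: "S has_fps_expansion F"
    unfolding F_def by (rule has_fps_expansion_fps_expansion[OF _ _ S_hol]) (use \<rho>1 in auto)
  have Fz: "F $ 0 = 0" using has_fps_expansion_imp_0_eq_fps_nth_0[OF F] S_0 by simp
  have F1: "F $ 1 = of_real c1"
  proof -
    have D0: "(S0 has_field_derivative deriv S0 0) (at 0)"
      by (rule holomorphic_derivI[OF S0_hol]) (use \<rho>1 in auto)
    have "(S has_field_derivative deriv S0 0 * (e * 1)) (at 0)"
      unfolding S_def by (rule DERIV_chain2[where f = S0 and g = "\<lambda>t. e * t"])
        (use D0 in \<open>auto intro!: derivative_eq_intros\<close>)
    then show ?thesis
      using fps_nth_fps_expansion[OF F, of 1] fps_nth_fps_expansion[OF F0, of 1] e(2)
      by (simp add: DERIV_imp_deriv mult.commute)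
  qed
  have ev: "eventually (\<lambda>t. mgf 0 (S t) = exp (t ^ 2 / 2)) (nhds 0)"
    using eventually_nhds_in_open[of "ball 0 \<rho>1" 0] \<rho>1(1) S_eq by (auto elim!: eventually_mono)
  have F2: "F $ 2 = of_real c2" and F3: "F $ 3 = of_real c3"
    using local_inverse_fps(2,3)[OF F Fz ev F1] .
  obtain C1 \<rho>2 where C1: "C1 > 0" "\<rho>2 > 0"
    "\<And>z. norm z < \<rho>2 \<Longrightarrow> norm (S z - (\<Sum>k<4. F $ k * z ^ k)) \<le> C1 * norm z ^ 4"
    using has_fps_expansion_remainder[OF F, of 4] by metis
  obtain C2 \<rho>3 where C2: "C2 > 0" "\<rho>3 > 0"
    "\<And>z. norm z < \<rho>3 \<Longrightarrow> norm (deriv S z - (\<Sum>k<3. fps_deriv F $ k * z ^ k)) \<le> C2 * norm z ^ 3"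
    using has_fps_expansion_remainder[OF has_fps_expansion_deriv[OF F], of 3] by metis
  have s4: "(\<Sum>k<4. F $ k * z ^ k) = of_real c1 * z + of_real c2 * z ^ 2 + of_real c3 * z ^ 3" for z
    using Fz F1 F2 F3 by (simp add: eval_nat_numeral)
  have s3: "(\<Sum>k<3. fps_deriv F $ k * z ^ k) = of_real c1 + 2 * of_real c2 * z + 3 * of_real c3 * z ^ 2" for z
    using Fz F1 F2 F3 by (simp add: eval_nat_numeral algebra_simps)
  define \<rho> C \<epsilon> where "\<rho> = min \<rho>1 (min \<rho>2 \<rho>3)" and "C = max C1 C2" and "\<epsilon> = min r1 1"
  show ?thesis
  proof (rule that[of S \<rho> C \<epsilon>])
    show "S holomorphic_on ball 0 \<rho>" by (rule holomorphic_on_subset[OF S_hol]) (auto simp: \<rho>_def)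
    show "\<rho> > 0" "C > 0" "\<epsilon> > 0" using \<rho>1 C1 C2 r1 by (auto simp: \<rho>_def C_def \<epsilon>_def)
    show "S 0 = 0" by (rule S_0)
    fix t :: complex
    show "mgf 0 (S t) = exp (t ^ 2 / 2)" if "norm t < \<rho>" using S_eq that by (simp add: \<rho>_def)
    show "norm (S t - (of_real c1 * t + of_real c2 * t ^ 2 + of_real c3 * t ^ 3)) \<le> C * norm t ^ 4"
      if "norm t < \<rho>"
      using C1(3)[of t] that mult_right_mono[of C1 C "norm t ^ 4"] by (simp add: s4 \<rho>_def C_def)
    show "norm (deriv S t - (of_real c1 + 2 * of_real c2 * t + 3 * of_real c3 * t ^ 2)) \<le> C * norm t ^ 3"
      if "norm t < \<rho>"
      using C2(3)[of t, unfolded s3] that mult_right_mono[of C2 C "norm t ^ 3"] by (simp add: \<rho>_def C_def)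
    show "s = S t \<or> s = S (- t)" if "norm s < \<epsilon>" "norm t < \<epsilon>" "mgf 0 s = exp (t ^ 2 / 2)" for s
      using S0_uniq[of s "e * t"] S0_uniq[of s t] that e(1) by (auto simp: S_def \<epsilon>_def)
  qed
qed

end

section \<open>The other roots stay away from the small root\<close>

context lukasiewicz_roots
begin

text \<open>A compactness argument: on the closed set of pairs (z, u) with u = z phi(u) and |z -
  1| \<ge> \<epsilon> in the closed bidisc, the modulus of u attains its maximum, and the value
  1 would force u = 1 and z = 1.\<close>

lemma norm_u1_away_from_1:
  assumes "\<epsilon> > 0"
  obtains \<delta> where "\<delta> > 0" "\<delta> < 1"
    "\<And>z. norm z < 1 \<Longrightarrow> norm (z - 1) \<ge> \<epsilon> \<Longrightarrow> norm (u1 z) \<le> 1 - \<delta>"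
proof -
  define K where "K = {x. x \<in> cball 0 1 \<times> cball 0 1 \<and> norm (fst x - 1) \<ge> \<epsilon> \<and> snd x = fst x * poly phi (snd x)}"
  have "closed {x :: complex \<times> complex. norm (fst x - 1) \<ge> \<epsilon>}"
    by (intro closed_Collect_le continuous_intros)
  moreover have "closed {x. snd x = fst x * poly phi (snd x)}"
    by (intro closed_Collect_eq continuous_intros)
  ultimately have "closed ({x :: complex \<times> complex. norm (fst x - 1) \<ge> \<epsilon>} \<inter> {x. snd x = fst x * poly phi (snd x)})"
    by (rule closed_Int)
  moreover have K_eq: "K = (cball 0 1 \<times> cball 0 1) \<inter> ({x. norm (fst x - 1) \<ge> \<epsilon>} \<inter> {x. snd x = fst x * poly phi (snd x)})"
    unfolding K_def by blast
  ultimately have K: "compact K"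
    unfolding K_eq by (intro compact_Int_closed compact_Times compact_cball)
  have lt: "norm (snd x) < 1" if "x \<in> K" for x
  proof (rule ccontr)
    assume "\<not> norm (snd x) < 1"
    then have 1: "norm (snd x) = 1" using that by (auto simp: K_def)
    have "1 = norm (fst x) * norm (poly phi (snd x))"
      using that 1 by (metis (mono_tags, lifting) K_def mem_Collect_eq norm_mult)
    moreover have "norm (fst x) * norm (poly phi (snd x)) \<le> 1 * norm (poly phi (snd x))"
      using that by (intro mult_right_mono) (auto simp: K_def)
    ultimately have "snd x = 1" using phi_on_unit_circle[OF 1] by simp
    then have "1 = fst x * poly phi 1" using that by (metis (mono_tags, lifting) K_def mem_Collect_eq)
    moreover have "poly phi 1 = 1"
      using sum_p by (simp add: poly_phi del: sum.atMost_Suc flip: of_real_sum)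
    ultimately have "fst x = 1" by simp
    then show False using that assms by (auto simp: K_def)
  qed
  show ?thesis
  proof (cases "K = {}")
    case True
    show ?thesis
    proof (rule that[of "1/2"])
      fix z :: complex assume z: "norm z < 1" "norm (z - 1) \<ge> \<epsilon>"
      then have "(z, u1 z) \<in> K" using norm_u1[of z] u1_root[of z] by (auto simp: K_def)
      then show "norm (u1 z) \<le> 1 - 1 / 2" using True by simp
    qed auto
  next
    case False
    have "continuous_on K (\<lambda>x. norm (snd x))" by (intro continuous_intros)
    then obtain x where x: "x \<in> K" "\<And>y. y \<in> K \<Longrightarrow> norm (snd y) \<le> norm (snd x)"
      using continuous_attains_sup[OF K False] by blast
    show ?thesis
    proof (rule that[of "(1 - norm (snd x)) / 2"])
      show "(1 - norm (snd x)) / 2 > 0" "(1 - norm (snd x)) / 2 < 1"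
        using lt[OF x(1)] by (auto simp: field_simps intro: add_pos_nonneg)
      fix z :: complex assume z: "norm z < 1" "norm (z - 1) \<ge> \<epsilon>"
      then have "(z, u1 z) \<in> K" using norm_u1[of z] u1_root[of z] by (auto simp: K_def)
      from x(2)[OF this] show "norm (u1 z) \<le> 1 - (1 - norm (snd x)) / 2"
        using lt[OF x(1)] by (simp add: field_simps)
    qed
  qed
qed

text \<open>Again by compactness: a limit of roots with |u| \<rightarrow> 1 and z \<rightarrow>
  1 satisfies phi(u) = u with |u| = 1, hence u = 1.\<close>

lemma roots_near_circle:
  assumes "\<epsilon> > 0"
  obtains \<delta> where "\<delta> > 0" "\<And>z u. norm z < 1 \<Longrightarrow> norm (z - 1) < \<delta> \<Longrightarrow> u = z * poly phi u \<Longrightarrow>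
    1 \<le> norm u \<Longrightarrow> norm u < 1 + \<delta> \<Longrightarrow> norm (u - 1) < \<epsilon>"
proof -
  define K where "K = {x. x \<in> cball 0 1 \<times> cball 0 2 \<and> norm (snd x - 1) \<ge> \<epsilon> \<and> norm (snd x) \<ge> 1 \<and> snd x = fst x * poly phi (snd x)}"
  have "closed ({x :: complex \<times> complex. norm (snd x - 1) \<ge> \<epsilon>} \<inter> ({x. norm (snd x) \<ge> 1} \<inter> {x. snd x = fst x * poly phi (snd x)}))"
    by (intro closed_Int closed_Collect_le closed_Collect_eq continuous_intros)
  moreover have K_eq: "K = (cball 0 1 \<times> cball 0 2) \<inter> ({x. norm (snd x - 1) \<ge> \<epsilon>} \<inter> ({x. norm (snd x) \<ge> 1} \<inter> {x. snd x = fst x * poly phi (snd x)}))"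
    unfolding K_def by blast
  ultimately have K: "compact K"
    unfolding K_eq by (intro compact_Int_closed compact_Times compact_cball)
  define f :: "complex \<times> complex \<Rightarrow> real" where "f = (\<lambda>x. max (norm (fst x - 1)) (norm (snd x) - 1))"
  have pos: "f x > 0" if "x \<in> K" for x
  proof (rule ccontr)
    assume "\<not> f x > 0"
    then have 1: "fst x = 1" "norm (snd x) = 1" using that by (auto simp: K_def f_def max_def split: if_splits)
    then have "snd x = poly phi (snd x)" using that by (auto simp: K_def)
    then have "snd x = 1" using phi_on_unit_circle[OF 1(2)] 1 by simp
    then show False using that assms by (auto simp: K_def)
  qed
  have mem: "(z, u) \<in> K" if "norm z < 1" "u = z * poly phi u" "1 \<le> norm u" "norm u < 2" "\<not> norm (u - 1) < \<epsilon>" for z u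
    using that by (auto simp: K_def)
  show ?thesis
  proof (cases "K = {}")
    case True
    have "norm (u - 1) < \<epsilon>" if "norm z < 1" "u = z * poly phi u" "1 \<le> norm u" "norm u < 1 + 1" for z u
      using mem[of z u] that True by auto
    then show ?thesis by (intro that[of 1]) auto
  next
    case False
    have "continuous_on K f" unfolding f_def by (intro continuous_intros)
    then obtain x where x: "x \<in> K" "\<And>y. y \<in> K \<Longrightarrow> f x \<le> f y"
      using continuous_attains_inf[OF K False] by blast
    show ?thesis
    proof (rule that[of "min 1 (f x)"])
      show "min 1 (f x) > 0" using pos[OF x(1)] by simp
      fix z u assume *: "norm z < 1" "norm (z - 1) < min 1 (f x)" "u = z * poly phi u"
        "1 \<le> norm u" "norm u < 1 + min 1 (f x)"
      show "norm (u - 1) < \<epsilon>"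
      proof (rule ccontr)
        assume "\<not> norm (u - 1) < \<epsilon>"
        then have "(z, u) \<in> K" using * by (intro mem) auto
        from x(2)[OF this] show False using * by (auto simp: f_def)
      qed
    qed
  qed
qed

text \<open>The sector |Im t| < Re t is where |z| < 1 for z = exp(-t^2/2). There Re S(-t) < 0 <
  Re S(t), which tells the small root from the large one; by \<open>local_param\<close> no
  further root is near 1, so the remaining large roots keep a fixed distance from the unit
  circle.\<close>

lemma near_param:
  obtains S \<rho> C \<delta> where "S holomorphic_on ball 0 \<rho>" "\<rho> > 0" "\<rho> \<le> 1" "C > 0" "S 0 = 0" "\<delta> > 0"
    "\<And>t. norm t < \<rho> \<Longrightarrow> norm (S t - (of_real c1 * t + of_real c2 * t ^ 2 + of_real c3 * t ^ 3)) \<le> C * norm t ^ 4"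
    "\<And>t. norm t < \<rho> \<Longrightarrow> norm (deriv S t - (of_real c1 + 2 * of_real c2 * t + 3 * of_real c3 * t ^ 2)) \<le> C * norm t ^ 3"
    "\<And>t. norm t < \<rho> \<Longrightarrow> Re t > 0 \<Longrightarrow> \<bar>Im t\<bar> < Re t \<Longrightarrow> \<exists>k0\<in>{1..d}.
       (\<forall>h. root_term h (exp (- (t ^ 2 / 2))) (v k0 (exp (- (t ^ 2 / 2)))) =
         exp (- of_real (h + 1) * (S t - S (- t))) * deriv S t / t) \<and>
       (\<forall>k\<in>{1..d}-{k0}. norm (v k (exp (- (t ^ 2 / 2)))) \<ge> 1 + \<delta>)"
proof -
  obtain S \<rho>1 C \<epsilon> where S: "S holomorphic_on ball 0 \<rho>1" "\<rho>1 > 0" "C > 0" "S 0 = 0" "\<epsilon> > 0"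
    and S_eq: "\<And>t. norm t < \<rho>1 \<Longrightarrow> mgf 0 (S t) = exp (t ^ 2 / 2)"
    and S_b: "\<And>t. norm t < \<rho>1 \<Longrightarrow> norm (S t - (of_real c1 * t + of_real c2 * t ^ 2 + of_real c3 * t ^ 3)) \<le> C * norm t ^ 4"
    and S'_b: "\<And>t. norm t < \<rho>1 \<Longrightarrow> norm (deriv S t - (of_real c1 + 2 * of_real c2 * t + 3 * of_real c3 * t ^ 2)) \<le> C * norm t ^ 3"
    and S_u: "\<And>s t. norm s < \<epsilon> \<Longrightarrow> norm t < \<epsilon> \<Longrightarrow> mgf 0 s = exp (t ^ 2 / 2) \<Longrightarrow> s = S t \<or> s = S (- t)"
    by (rule local_param) (rule that)
  have "isCont Ln 1" by (intro continuous_at_Ln) auto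
  then obtain \<epsilon>1 where \<epsilon>1: "\<epsilon>1 > 0" "\<And>u. norm (u - 1) < \<epsilon>1 \<Longrightarrow> norm (Ln u) < \<epsilon>"
    using \<open>\<epsilon> > 0\<close> unfolding continuous_at_eps_delta by (auto simp: dist_norm)
  obtain \<delta> where \<delta>: "\<delta> > 0" "\<And>z u. norm z < 1 \<Longrightarrow> norm (z - 1) < \<delta> \<Longrightarrow> u = z * poly phi u \<Longrightarrow>
    1 \<le> norm u \<Longrightarrow> norm u < 1 + \<delta> \<Longrightarrow> norm (u - 1) < \<epsilon>1"
    using roots_near_circle[OF \<epsilon>1(1)] by metis
  have "isCont (\<lambda>t::complex. exp (- (t ^ 2 / 2))) 0" by (intro continuous_intros) auto
  then obtain \<rho>2 where \<rho>2: "\<rho>2 > 0" "\<And>t::complex. norm t < \<rho>2 \<Longrightarrow> norm (exp (- (t ^ 2 / 2)) - 1) < \<delta>"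
    using \<delta>(1) unfolding continuous_at_eps_delta by (auto simp: dist_norm)
  have c1: "c1 > 0" using sg_pos by (simp add: c1_def)
  define B where "B = \<bar>c2\<bar> + \<bar>c3\<bar> + C"
  have B: "B > 0" using S(3) by (simp add: B_def add_nonneg_pos)
  define \<rho> where "\<rho> = min (min 1 (min \<rho>1 \<epsilon>)) (min \<rho>2 (min (c1 / (2 * B)) (1 / (c1 + B))))"
  have \<rho>: "\<rho> > 0" "\<rho> \<le> 1" "\<rho> \<le> \<rho>1" "\<rho> \<le> \<epsilon>" "\<rho> \<le> \<rho>2" "\<rho> \<le> c1 / (2 * B)" "\<rho> \<le> 1 / (c1 + B)"
    using S \<rho>2 B c1 by (auto simp: \<rho>_def)
  have Sb2: "norm (S t - of_real c1 * t) \<le> B * norm t ^ 2" if t: "norm t < \<rho>" for t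
  proof -
    have "norm t ^ 3 \<le> norm t ^ 2" "norm t ^ 4 \<le> norm t ^ 2"
      using t \<rho> by (auto intro!: power_decreasing)
    then have le: "\<bar>c3\<bar> * norm t ^ 3 \<le> \<bar>c3\<bar> * norm t ^ 2" "C * norm t ^ 4 \<le> C * norm t ^ 2"
      using S(3) by (auto intro!: mult_left_mono)
    have "S t - of_real c1 * t = (S t - (of_real c1 * t + of_real c2 * t ^ 2 + of_real c3 * t ^ 3))
        + of_real c2 * t ^ 2 + of_real c3 * t ^ 3" by simp
    also have "norm \<dots> \<le> C * norm t ^ 4 + \<bar>c2\<bar> * norm t ^ 2 + \<bar>c3\<bar> * norm t ^ 3"
      by (intro norm_triangle_mono S_b) (use t \<rho> in \<open>auto simp: norm_mult norm_power\<close>)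
    also have "\<dots> \<le> B * norm t ^ 2" using le by (simp add: B_def algebra_simps)
    finally show ?thesis .
  qed
  have Sb1: "norm (S t) \<le> 1" if t: "norm t < \<rho>" for t
  proof -
    have "norm (S t) \<le> c1 * norm t + B * norm t ^ 2"
      using norm_triangle_ineq[of "S t - of_real c1 * t" "of_real c1 * t"] Sb2[OF t] c1
      by (simp add: norm_mult)
    also have "B * norm t ^ 2 \<le> B * norm t"
      using t \<rho> B power_decreasing[of 1 2 "norm t"] by (intro mult_left_mono) auto
    also have "c1 * norm t + B * norm t = (c1 + B) * norm t" by (simp add: algebra_simps)
    also have "\<dots> \<le> (c1 + B) * (1 / (c1 + B))" using t \<rho> c1 B by (intro mult_left_mono) auto
    also have "\<dots> = 1" using c1 B by simp
    finally show ?thesis by simp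
  qed
  have key: "\<exists>k0\<in>{1..d}.
       (\<forall>h. root_term h (exp (- (t ^ 2 / 2))) (v k0 (exp (- (t ^ 2 / 2)))) =
         exp (- of_real (h + 1) * (S t - S (- t))) * deriv S t / t) \<and>
       (\<forall>k\<in>{1..d}-{k0}. norm (v k (exp (- (t ^ 2 / 2)))) \<ge> 1 + \<delta>)"
    if t: "norm t < \<rho>" "Re t > 0" "\<bar>Im t\<bar> < Re t" for t
  proof -
    define z where "z = exp (- (t ^ 2 / 2))"
    have t0: "t \<noteq> 0" using t by auto
    have "Im t ^ 2 < Re t ^ 2" using t by (metis abs_ge_zero abs_of_pos power2_abs power_strict_mono zero_less_numeral)
    then have nz: "norm z < 1" "0 < norm z" by (simp_all add: z_def Re_power2)
    have z1: "norm (z - 1) < \<delta>" using \<rho>2(2)[of t] t \<rho> by (simp add: z_def)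
    have root: "exp (S t') = z * poly phi (exp (S t'))" if "t' = t \<or> t' = - t" for t'
    proof -
      have "norm t' < \<rho>1" "t' ^ 2 = t ^ 2" using that t \<rho> by auto
      then have "poly phi (exp (S t')) / exp (S t') = inverse z"
        using S_eq[of t'] mgf_phi[of "S t'"] by (simp add: z_def exp_minus)
      then show ?thesis using nz by (auto simp: field_simps)
    qed
    have Re_t: "norm t \<le> 2 * Re t" using cmod_le[of t] t by simp
    have "B * norm t ^ 2 < c1 * Re t"
    proof -
      have "B * norm t ^ 2 < B * ((c1 / (2 * B)) * norm t)"
        unfolding power2_eq_square using t \<rho> B t0 by (intro mult_strict_left_mono mult_strict_right_mono) auto
      also have "\<dots> = c1 * (norm t / 2)" using B by simp
      also have "\<dots> \<le> c1 * Re t" using Re_t c1 by (intro mult_left_mono) auto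
      finally show ?thesis .
    qed
    then have ReS: "Re (S t) > 0" "Re (S (- t)) < 0"
      using abs_Re_le_cmod[of "S t - of_real c1 * t"] Sb2[of t]
        abs_Re_le_cmod[of "S (- t) - of_real c1 * (- t)"] Sb2[of "- t"] t by auto
    have u1: "u1 z = exp (S (- t))"
      using ReS root[of "- t"] by (intro u1_unique[symmetric] nz) auto
    have "exp (S t) \<noteq> u1 z"
      using ReS u1 by (metis norm_exp_eq_Re exp_less_one_iff not_less_iff_gr_or_eq one_less_exp_iff)
    then obtain k0 where k0: "k0 \<in> {1..d}" "v k0 z = exp (S t)"
      using root_cases[OF nz(2,1) root[of t]] by auto
    have dS: "(S has_field_derivative deriv S t) (at t)"
      by (rule holomorphic_derivI[OF S(1)]) (use t \<rho> in auto)
    have ev: "eventually (\<lambda>t. mgf 0 (S t) = exp (t ^ 2 / 2)) (nhds t)"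
      using eventually_nhds_in_open[of "ball 0 \<rho>1" t] t \<rho> S_eq by (auto elim!: eventually_mono)
    have "((\<lambda>t. exp (t ^ 2 / 2)) has_field_derivative mgf 1 (S t) * deriv S t) (at t)"
      using DERIV_chain2[OF mgf_deriv[of 0 "S t"] dS] DERIV_cong_ev[OF refl ev refl] by simp
    moreover have "((\<lambda>t. exp (t ^ 2 / 2)) has_field_derivative exp (t ^ 2 / 2) * t) (at t)"
      by (auto intro!: derivative_eq_intros)
    ultimately have "mgf 1 (S t) * deriv S t = exp (t ^ 2 / 2) * t" using DERIV_unique by blast
    then have "(dphi (exp (S t)) - 1 / z) * deriv S t = t / z"
      unfolding mgf_1_phi using S_eq[of t] t \<rho> by (simp add: z_def exp_minus field_simps)
    then have dphi_v: "(1 - z * dphi (exp (S t))) * deriv S t = - t"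
      using nz by (auto simp: field_simps)
    then have ne: "1 - z * dphi (exp (S t)) \<noteq> 0" "deriv S t \<noteq> 0" using t0 by auto
    have "root_term h z (v k0 z) = exp (- of_real (h + 1) * (S t - S (- t))) * deriv S t / t" for h
    proof -
      have q: "u1 z / v k0 z = exp (S (- t) - S t)" by (simp add: u1 k0 exp_diff)
      have "norm (S (- t) - S t) \<le> 2"
        using norm_triangle_ineq4[of "S (- t)" "S t"] Sb1[of t] Sb1[of "- t"] t by simp
      then have "\<bar>Im (S (- t) - S t)\<bar> < pi"
        using abs_Im_le_cmod[of "S (- t) - S t"] pi_gt3 by linarith
      then have "Ln (exp (S (- t) - S t)) = S (- t) - S t" by (intro Ln_exp) auto
      then have pw: "(u1 z / v k0 z) powr of_real h = exp (of_real h * (S (- t) - S t))"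
        unfolding q powr_def by simp
      have "1 - z * dphi (v k0 z) = - t / deriv S t"
        using dphi_v ne unfolding k0(2) by (simp add: field_simps)
      then have "root_term h z (v k0 z) = exp (of_real h * (S (- t) - S t)) * exp (S (- t) - S t) * deriv S t / t"
        unfolding root_term_def pw unfolding q by simp
      also have "exp (of_real h * (S (- t) - S t)) * exp (S (- t) - S t) = exp (- of_real (h + 1) * (S t - S (- t)))"
        unfolding exp_add[symmetric] by (simp add: algebra_simps)
      finally show ?thesis .
    qed
    moreover have "norm (v k z) \<ge> 1 + \<delta>" if k: "k \<in> {1..d} - {k0}" for k
    proof (rule ccontr)
      assume "\<not> norm (v k z) \<ge> 1 + \<delta>"
      then have "norm (v k z - 1) < \<epsilon>1"
        using k norm_v[OF nz(2,1), of k] v_root[OF nz(2,1), of k] by (intro \<delta>(2)[OF nz(1) z1]) auto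
      then have Ln: "norm (Ln (v k z)) < \<epsilon>" by (rule \<epsilon>1)
      have v0: "v k z \<noteq> 0" using k v_nonzero[OF nz(2,1)] by auto
      have "v k z = z * poly phi (v k z)" using k v_root[OF nz(2,1), of k] by auto
      then have "poly phi (v k z) / v k z = inverse z" using v0 nz by (auto simp: field_simps)
      then have "mgf 0 (Ln (v k z)) = exp (t ^ 2 / 2)"
        using v0 by (simp add: mgf_phi z_def exp_minus)
      then have "Ln (v k z) = S t \<or> Ln (v k z) = S (- t)"
        using S_u[OF Ln, of t] t \<rho> by auto
      then have "v k z = exp (S t) \<or> v k z = exp (S (- t))" using v0 by (metis exp_Ln)
      moreover have "v k z \<noteq> exp (S (- t))"
        using k norm_v[OF nz(2,1), of k] norm_u1[OF nz(1)] u1 by auto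
      ultimately have "v k z = v k0 z" using k0 by simp
      then have "(\<Prod>m\<in>{1..d}-{k0}. v k0 z - v m z) = 0" using k by (intro prod_zero bexI[of _ k]) auto
      then have "1 - z * dphi (v k0 z) = 0"
        using deriv_fz_v[OF nz(2,1) k0(1)] by simp
      then show False using ne k0 by simp
    qed
    ultimately show ?thesis using k0(1) unfolding z_def by blast
  qed
  show ?thesis
    by (rule that[of S \<rho> C \<delta>]) (use S S_b S'_b \<delta>(1) \<rho> key in \<open>auto intro: holomorphic_on_subset\<close>)
qed

end

section \<open>The generating function on circles\<close>

lemma borel_measurable_locally:
  fixes f :: "real \<Rightarrow> complex"
  assumes "\<And>x. \<exists>T. open T \<and> x \<in> T \<and> f \<in> borel_measurable (restrict_space borel T)"
  shows "f \<in> borel_measurable borel"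
proof -
  define F where "F = {T. open T \<and> f \<in> borel_measurable (restrict_space borel T)}"
  obtain C where C: "C \<subseteq> F" "countable C" "\<Union>C = \<Union>F"
    using Lindelof[of F] by (auto simp: F_def)
  have "x \<in> \<Union>F" for x
    using assms[of x] unfolding F_def by blast
  then have "\<Union>C = UNIV" using C(3) by auto
  show ?thesis
  proof (rule measurable_piecewise_restrict[OF C(2)])
    fix T assume "T \<in> C"
    then have T: "open T" "f \<in> borel_measurable (restrict_space borel T)" using C(1) by (auto simp: F_def)
    show "T \<inter> space borel \<in> sets borel" using T(1) by simp
    show "f \<in> borel_measurable (restrict_space borel T)" by (rule T(2))
  qed (simp add: \<open>\<Union>C = UNIV\<close>)
qed

text \<open>The principal logarithm jumps at the negative real axis, but it is continuous on the
  axis and off it.\<close>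

lemma borel_measurable_powr_complex:
  "(\<lambda>w::complex. w powr a) \<in> borel_measurable borel"
proof -
  let ?N = "\<real>\<^sub>\<le>\<^sub>0 :: complex set"
  have Ln: "Ln w = of_real (ln (norm w)) + \<i> * of_real pi" if w: "w \<in> ?N" "w \<noteq> 0" for w
  proof -
    obtain x where x: "w = of_real x" "x \<le> 0" using w(1) by (auto simp: nonpos_Reals_def)
    then have "w = - of_real (- x)" "- x > 0" using w(2) by auto
    then show ?thesis using Ln_minus[of "of_real (- x)"] Ln_of_real[of "- x"] x by auto
  qed
  have eq: "(\<lambda>w::complex. w powr a) = (\<lambda>w. if w \<in> ?N then (if w = 0 then 0 else exp (a * (of_real (ln (norm w)) + \<i> * of_real pi)))
      else exp (a * Ln w))"
    by (intro ext) (auto simp: powr_def Ln)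
  have N: "?N \<in> sets borel" by (intro borel_closed closed_nonpos_Reals_complex)
  have m1: "(\<lambda>w::complex. if w = 0 then 0 else exp (a * (of_real (ln (norm w)) + \<i> * of_real pi))) \<in> borel_measurable borel"
    by measurable
  have "continuous_on (- ?N) (\<lambda>w. exp (a * Ln w))" by (intro continuous_intros) auto
  then have m2: "(\<lambda>w. exp (a * Ln w)) \<in> borel_measurable (restrict_space borel (- ?N))"
    by (rule borel_measurable_continuous_on_restrict)
  show ?thesis unfolding eq
  proof (rule measurable_If_restrict_space_iff[THEN iffD2, OF _ conjI])
    show "(\<lambda>w::complex. if w = 0 then 0 else exp (a * (of_real (ln (norm w)) + \<i> * of_real pi)))
       \<in> borel_measurable (restrict_space borel {w. w \<in> ?N})"
      by (rule measurable_restrict_space1[OF m1])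
    show "(\<lambda>w. exp (a * Ln w)) \<in> borel_measurable (restrict_space borel {w. w \<notin> ?N})"
      using m2 by (simp add: Compl_eq)
    show "{x \<in> space borel. x \<in> ?N} \<in> sets borel" using N by simp
  qed
qed

context lukasiewicz_roots
begin

text \<open>The solutions u on the circle |z| = r other than the small root.\<close>

definition outer_root :: "real \<Rightarrow> complex \<Rightarrow> complex \<Rightarrow> bool" where
  "outer_root r z u \<longleftrightarrow> norm z = r \<and> u = z * poly phi u \<and> 1 \<le> norm u"

lemma outer_root_v: "0 < r \<Longrightarrow> r < 1 \<Longrightarrow> norm z = r \<Longrightarrow> k \<in> {1..d} \<Longrightarrow> outer_root r z (v k z)"
  using norm_v[of z k] v_root[of z k] by (auto simp: outer_root_def)

lemma root_quotient: "u = z * poly phi u \<Longrightarrow> poly phi u \<noteq> 0 \<Longrightarrow> z = u / poly phi u"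
  by (simp add: eq_divide_eq)

lemma outer_root_bound:
  assumes "1 / 2 \<le> r" "outer_root r z u"
  shows "norm u \<le> 3 / p (int d)"
proof -
  have u1: "norm u \<ge> 1" and u: "u = z * poly phi u" and z: "norm z \<ge> 1 / 2"
    using assms by (auto simp: outer_root_def)
  have "norm u = norm z * norm (poly phi u)" using u by (metis norm_mult)
  moreover have "(1 / 2) * norm (poly phi u) \<le> norm z * norm (poly phi u)"
    using z by (intro mult_right_mono) auto
  ultimately have phi_u: "norm (poly phi u) \<le> 2 * norm u" by simp
  have ge1: "norm u \<le> norm u ^ d" using u1 d by (metis power_increasing power_one_right)
  have "norm (\<Sum>j\<le>d. of_real (p (int j - 1)) * u ^ j) \<le> (\<Sum>j\<le>d. p (int j - 1) * norm u ^ d)"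
    using u1 weight_nonneg
    by (intro order_trans[OF norm_sum] sum_mono)
       (auto simp: norm_mult norm_power abs_of_nonneg intro!: mult_left_mono power_increasing)
  also have "\<dots> = (\<Sum>j\<le>d. p (int j - 1)) * norm u ^ d" by (simp add: sum_distrib_right)
  also have "\<dots> \<le> 1 * norm u ^ d"
    using sum_p p_last by (intro mult_right_mono) auto
  finally have low: "norm (\<Sum>j\<le>d. of_real (p (int j - 1)) * u ^ j) \<le> norm u ^ d" by simp
  have "of_real (p (int d)) * u ^ (d + 1) = poly phi u - (\<Sum>j\<le>d. of_real (p (int j - 1)) * u ^ j)"
    by (simp add: poly_phi)
  then have "norm (of_real (p (int d)) * u ^ (d + 1)) \<le> 2 * norm u + norm u ^ d"
    using norm_triangle_ineq4[of "poly phi u" "\<Sum>j\<le>d. of_real (p (int j - 1)) * u ^ j"] phi_u low by simp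
  then have "(p (int d) * norm u) * norm u ^ d \<le> 3 * norm u ^ d"
    using ge1 p_last by (simp add: norm_mult norm_power mult.assoc)
  then have "p (int d) * norm u \<le> 3"
    by (rule mult_right_le_imp_le) (use u1 in \<open>auto intro!: zero_less_power\<close>)
  then show ?thesis using p_last by (simp add: field_simps)
qed

text \<open>This is -u^2 P'(u), so its zeros are the critical points of P; at a root, 1 - z
  phi'(u) = psi(u)/phi(u).\<close>

definition psi :: "complex poly" where "psi = phi - pCons 0 (pderiv phi)"

lemma poly_psi: "poly psi u = poly phi u - u * dphi u"
  by (simp add: psi_def)

lemma psi_nonzero: "psi \<noteq> 0"
proof -
  have "coeff psi (Suc d) = - of_nat d * of_real (p (int d))"
    by (simp add: psi_def coeff_phi coeff_pderiv algebra_simps)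
  then show ?thesis using d p_last by auto
qed

text \<open>On the circle |z| = r one has |P(u)| = 1/r. If |P(y)| = 1 at the critical point y,
  the two values differ by at least 1/r - 1, which is of order 1/n; otherwise they stay a fixed
  distance apart. As P is Lipschitz on bounded sets, u cannot be much closer to y than that.
  Multiplying with y and u avoids the pole of P.\<close>

lemma distance_to_critical_point:
  assumes r: "\<And>n. 0 < r n \<and> r n < 1" and a: "a > 0" "eventually (\<lambda>n. a / real n \<le> 1 - r n) sequentially"
    and lim: "r \<longlonglongrightarrow> 1" and y: "poly psi y = 0"
  shows "\<exists>c>0. eventually (\<lambda>n. \<forall>z u. outer_root (r n) z u \<longrightarrow> c / real n \<le> norm (u - y)) sequentially"
proof -
  have y0: "y \<noteq> 0" using y phi_0 p_first by (auto simp: poly_psi)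
  define w where "w = smult y phi - smult (poly phi y) [:0, 1:]"
  have w: "poly w u = y * poly phi u - poly phi y * u" for u by (simp add: w_def)
  have "poly w y = 0" by (simp add: w)
  then obtain q where q: "w = [:- y, 1:] * q" unfolding poly_eq_0_iff_dvd by (auto simp: dvd_def)
  have "compact (poly q ` cball 0 (3 / p (int d)))"
    by (intro compact_continuous_image compact_cball continuous_intros)
  then obtain B where B: "B > 0" "\<And>u. norm u \<le> 3 / p (int d) \<Longrightarrow> norm (poly q u) \<le> B"
    using compact_imp_bounded bounded_pos by (metis (no_types, lifting) image_eqI mem_cball_0)
  define g where "g = (\<lambda>n. \<bar>norm y / r n - norm (poly phi y)\<bar>)"
  have key: "g n / B \<le> norm (u - y)" if "r n \<ge> 1 / 2" "outer_root (r n) z u" for n z u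
  proof -
    have u: "norm z = r n" "u = z * poly phi u" "1 \<le> norm u" using that(2) by (auto simp: outer_root_def)
    have z0: "z \<noteq> 0" using u(1) r[of n] by auto
    have phi_u: "poly phi u = u / z" using u(2) z0 by (auto simp: field_simps)
    have "poly w u = u * (y / z - poly phi y)" by (simp add: w phi_u algebra_simps)
    then have "norm (poly w u) = norm u * norm (y / z - poly phi y)" by (simp add: norm_mult)
    moreover have "g n \<le> norm (y / z - poly phi y)"
      using norm_triangle_ineq3[of "y / z" "poly phi y"] u(1) by (simp add: g_def norm_divide)
    moreover have "1 * norm (y / z - poly phi y) \<le> norm u * norm (y / z - poly phi y)"
      using u(3) by (intro mult_right_mono) auto
    ultimately have "g n \<le> norm (poly w u)" by simp
    also have "poly w u = (u - y) * poly q u" by (simp add: q algebra_simps)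
    also have "norm \<dots> \<le> norm (u - y) * B"
      unfolding norm_mult by (intro mult_left_mono B(2) outer_root_bound[OF that]) auto
    finally show ?thesis using B(1) by (simp add: field_simps)
  qed
  have r_half: "eventually (\<lambda>n. r n \<ge> 1 / 2) sequentially"
    using order_tendstoD(1)[OF lim, of "1/2"] by (auto elim: eventually_mono)
  have "\<exists>c>0. eventually (\<lambda>n. c / real n \<le> g n) sequentially"
  proof (cases "norm (poly phi y) = norm y")
    case True
    have "eventually (\<lambda>n. (norm y * a) / real n \<le> g n) sequentially"
      using a(2)
    proof eventually_elim
      case (elim n)
      have rn: "0 < r n" "r n < 1" using r by auto
      have "1 - r n \<le> 1 / r n - 1"
      proof -
        have "r n * (1 - r n) \<le> 1 * (1 - r n)" using rn by (intro mult_right_mono) auto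
        then show ?thesis using rn by (simp add: field_simps)
      qed
      with elim have "norm y * (a / real n) \<le> norm y * (1 / r n - 1)" by (intro mult_left_mono) auto
      also have "\<dots> \<le> g n" unfolding g_def True by (simp add: algebra_simps)
      finally show ?case by simp
    qed
    then show ?thesis using y0 a(1) by (intro exI[of _ "norm y * a"]) auto
  next
    case False
    define e where "e = \<bar>norm y - norm (poly phi y)\<bar>"
    have e: "e > 0" using False by (simp add: e_def)
    have "g \<longlonglongrightarrow> \<bar>norm y / 1 - norm (poly phi y)\<bar>"
      unfolding g_def by (intro tendsto_intros lim) auto
    then have "eventually (\<lambda>n. e / 2 < g n) sequentially"
      by (rule order_tendstoD) (use e in \<open>simp add: e_def\<close>)
    moreover have "eventually (\<lambda>n. n \<ge> 1) sequentially" by (rule eventually_ge_at_top)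
    ultimately have "eventually (\<lambda>n. (e / 2) / real n \<le> g n) sequentially"
    proof eventually_elim
      case (elim n)
      have "(e / 2) / real n \<le> (e / 2) / 1" using elim e by (intro divide_left_mono) auto
      then show ?case using elim by simp
    qed
    then show ?thesis using e by (intro exI[of _ "e / 2"]) auto
  qed
  then obtain c where c: "c > 0" "eventually (\<lambda>n. c / real n \<le> g n) sequentially" by blast
  have "eventually (\<lambda>n. \<forall>z u. outer_root (r n) z u \<longrightarrow> (c / B) / real n \<le> norm (u - y)) sequentially"
    using c(2) r_half
  proof eventually_elim
    case (elim n)
    have "(c / B) / real n \<le> g n / B" using elim(1) B(1) by (simp add: field_simps)
    then show ?case using key[OF elim(2)] by (meson order_trans)
  qed
  then show ?thesis using c(1) B(1) by (intro exI[of _ "c / B"]) auto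
qed

text \<open>The polynomial psi splits into linear factors, each of which is at least of order
  1/n. The exponent is immaterial because it competes with exp(-c sqrt n).\<close>

lemma deriv_lower_bound:
  assumes r: "\<And>n. 0 < r n \<and> r n < 1" and a: "a > 0" "eventually (\<lambda>n. a / real n \<le> 1 - r n) sequentially"
    and lim: "r \<longlonglongrightarrow> 1"
  obtains c m where "c > 0"
    "eventually (\<lambda>n. \<forall>z u. outer_root (r n) z u \<longrightarrow> c / real n ^ m \<le> norm (1 - z * dphi u)) sequentially"
proof -
  obtain A where A: "psi = smult (lead_coeff psi) (\<Prod>y\<in>#A. [:-y, 1:])"
    using alg_closed_imp_factorization[OF psi_nonzero] by blast
  have "\<exists>c>0. eventually (\<lambda>n. \<forall>z u. outer_root (r n) z u \<longrightarrow>
      c / real n ^ size A' \<le> norm (poly (\<Prod>y\<in>#A'. [:-y, 1:]) u)) sequentially"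
    if "\<And>y. y \<in># A' \<Longrightarrow> poly psi y = 0" for A'
    using that
  proof (induction A')
    case empty
    show ?case by (intro exI[of _ 1]) auto
  next
    case (add y A')
    obtain c1 where c1: "c1 > 0" "eventually (\<lambda>n. \<forall>z u. outer_root (r n) z u \<longrightarrow>
      c1 / real n ^ size A' \<le> norm (poly (\<Prod>y\<in>#A'. [:-y, 1:]) u)) sequentially"
      using add by auto
    obtain c2 where c2: "c2 > 0" "eventually (\<lambda>n. \<forall>z u. outer_root (r n) z u \<longrightarrow> c2 / real n \<le> norm (u - y)) sequentially"
      using distance_to_critical_point[OF r a lim, of y] add.prems by auto
    have "eventually (\<lambda>n. \<forall>z u. outer_root (r n) z u \<longrightarrow>
      (c1 * c2) / real n ^ size (add_mset y A') \<le> norm (poly (\<Prod>y\<in>#add_mset y A'. [:-y, 1:]) u)) sequentially"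
      using c1(2) c2(2)
    proof eventually_elim
      case (elim n)
      show ?case
      proof (intro allI impI)
        fix z u assume "outer_root (r n) z u"
        then have "(c2 / real n) * (c1 / real n ^ size A') \<le> norm (u - y) * norm (poly (\<Prod>y\<in>#A'. [:-y, 1:]) u)"
          using elim c1(1) c2(1) by (intro mult_mono) auto
        also have "\<dots> = norm (poly (\<Prod>y\<in>#add_mset y A'. [:-y, 1:]) u)"
          by (simp add: norm_mult[symmetric] algebra_simps)
        finally show "(c1 * c2) / real n ^ size (add_mset y A') \<le> norm (poly (\<Prod>y\<in>#add_mset y A'. [:-y, 1:]) u)"
          by (simp add: mult_ac)
      qed
    qed
    then show ?case using c1(1) c2(1) by (intro exI[of _ "c1 * c2"]) auto
  qed
  moreover have "poly psi y = 0" if "y \<in># A" for y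
    using that by (subst A) (auto simp: poly_prod_mset)
  ultimately obtain c where c: "c > 0" "eventually (\<lambda>n. \<forall>z u. outer_root (r n) z u \<longrightarrow>
      c / real n ^ size A \<le> norm (poly (\<Prod>y\<in>#A. [:-y, 1:]) u)) sequentially" by blast
  define lc where "lc = norm (lead_coeff psi)"
  have lc: "lc > 0" using psi_nonzero by (simp add: lc_def)
  define R where "R = 3 / p (int d)"
  have R: "R > 0" using p_last by (simp add: R_def)
  have r_half: "eventually (\<lambda>n. r n \<ge> 1 / 2) sequentially"
    using order_tendstoD(1)[OF lim, of "1/2"] by (auto elim: eventually_mono)
  have "eventually (\<lambda>n. \<forall>z u. outer_root (r n) z u \<longrightarrow> (lc * c / (2 * R)) / real n ^ size A \<le> norm (1 - z * dphi u)) sequentially"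
    using c(2) r_half
  proof eventually_elim
    case (elim n)
    show ?case
    proof (intro allI impI)
      fix z u assume o: "outer_root (r n) z u"
      then have u: "norm z = r n" "u = z * poly phi u" "1 \<le> norm u" by (auto simp: outer_root_def)
      have z0: "z \<noteq> 0" and u0: "u \<noteq> 0" using u r[of n] by auto
      have phi_u: "poly phi u = u / z" using u(2) z0 by (auto simp: field_simps)
      have "1 - z * dphi u = poly psi u * (z / u)"
        using u0 z0 by (simp add: poly_psi phi_u field_simps)
      then have eq: "norm (1 - z * dphi u) = norm (poly psi u) * (r n / norm u)"
        by (simp add: norm_mult norm_divide u(1))
      have "norm (poly psi u) = lc * norm (poly (\<Prod>y\<in>#A. [:-y, 1:]) u)"
        by (subst A) (simp add: norm_mult lc_def)
      also have "\<dots> \<ge> lc * (c / real n ^ size A)"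
        using elim(1) o lc by (intro mult_left_mono) auto
      finally have 1: "norm (poly psi u) \<ge> lc * (c / real n ^ size A)" .
      have "norm u \<le> R" using outer_root_bound[OF elim(2) o] by (simp add: R_def)
      then have 2: "r n / norm u \<ge> (1/2) / R" using elim(2) u(3) R by (intro frac_le) auto
      have "(lc * (c / real n ^ size A)) * ((1/2) / R) \<le> norm (1 - z * dphi u)"
        unfolding eq using 1 2 lc c(1) R by (intro mult_mono) auto
      then show "(lc * c / (2 * R)) / real n ^ size A \<le> norm (1 - z * dphi u)" by (simp add: mult_ac)
    qed
  qed
  then show ?thesis using that[of "lc * c / (2 * R)" "size A"] lc c(1) R by simp
qed

text \<open>Where all large roots are simple they are locally given by inverse branches of
  u/phi(u). The branches take values in disjoint cells, so at each z they list the d roots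
  without repetition, in whatever order v lists them.\<close>

lemma local_sections:
  assumes z0: "0 < norm z0" "norm z0 < 1"
    and simple: "\<And>k. k \<in> {1..d} \<Longrightarrow> 1 - z0 * dphi (v k z0) \<noteq> 0"
  obtains N w where "open N" "z0 \<in> N" "N \<subseteq> ball 0 1 - {0}"
    "\<And>k. k \<in> {1..d} \<Longrightarrow> continuous_on N (w k)"
    "\<And>z k. z \<in> N \<Longrightarrow> k \<in> {1..d} \<Longrightarrow> outer_root (norm z) z (w k z) \<and> 1 - z * dphi (w k z) \<noteq> 0"
    "\<And>z (f :: complex \<Rightarrow> complex). z \<in> N \<Longrightarrow> (\<Sum>k=1..d. f (v k z)) = (\<Sum>k=1..d. f (w k z))"
proof -
  define b where "b = (\<lambda>k. v k z0)"
  have b_neq: "b k \<noteq> b m" if "k \<in> {1..d}" "m \<in> {1..d}" "k \<noteq> m" for k m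
  proof
    assume "b k = b m"
    then have "(\<Prod>m\<in>{1..d}-{k}. v k z0 - v m z0) = 0"
      using that by (intro prod_zero bexI[of _ m]) (auto simp: b_def)
    then show False using simple[OF that(1)] deriv_fz_v[OF z0 that(1)] by simp
  qed
  have b_root: "b k = z0 * poly phi (b k)" "norm (b k) > 1" if "k \<in> {1..d}" for k
    using v_root[OF z0 that] norm_v[OF z0 that] by (simp_all add: b_def)
  \<comment> \<open>the Voronoi cell of the k-th root, which keeps the branches apart\<close>
  define U where "U = (\<lambda>k. {u. poly phi u \<noteq> 0} \<inter> {u. poly psi u \<noteq> 0} \<inter> {u. 1 < norm u} \<inter>
      (\<Inter>m\<in>{1..d}-{k}. {u. dist u (b k) < dist u (b m)}))"
  have openU: "open (U k)" for k
    unfolding U_def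
    by (intro open_Int open_INT ballI open_Collect_neq open_Collect_less continuous_intros) auto
  have bU: "b k \<in> U k" if k: "k \<in> {1..d}" for k
  proof -
    have z0': "z0 \<noteq> 0" using z0 by auto
    have nz: "b k \<noteq> 0" "poly phi (b k) \<noteq> 0" using b_root[OF k] by auto
    have "1 - z0 * dphi (b k) = poly psi (b k) / poly phi (b k)"
    proof -
      have "z0 = b k / poly phi (b k)" by (rule root_quotient[OF b_root(1)[OF k] nz(2)])
      then show ?thesis using nz by (simp add: poly_psi field_simps)
    qed
    then have "poly psi (b k) \<noteq> 0" using simple[OF k] by (auto simp: b_def)
    then show ?thesis using nz b_root[OF k] b_neq[OF k] by (auto simp: U_def)
  qed
  have "\<exists>T g. open T \<and> z0 \<in> T \<and> continuous_on T g \<and> (\<forall>z\<in>T. g z \<in> U k \<and> g z = z * poly phi (g z))"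
    if k: "k \<in> {1..d}" for k
  proof -
    define Phi where "Phi = (\<lambda>u. u / poly phi u)"
    have hol: "Phi holomorphic_on U k"
      unfolding Phi_def by (intro holomorphic_intros) (auto simp: U_def)
    have nz: "poly phi (b k) \<noteq> 0" "poly psi (b k) \<noteq> 0" using bU[OF k] by (auto simp: U_def)
    have "(Phi has_field_derivative (1 * poly phi (b k) - b k * dphi (b k)) / (poly phi (b k) * poly phi (b k))) (at (b k))"
      unfolding Phi_def using nz by (intro DERIV_divide DERIV_ident poly_DERIV)
    then have "deriv Phi (b k) = poly psi (b k) / (poly phi (b k) * poly phi (b k))"
      by (simp add: DERIV_imp_deriv poly_psi)
    then have dP: "deriv Phi (b k) \<noteq> 0" using nz by simp
    obtain e where e: "e > 0" "ball (b k) e \<subseteq> U k" "open (Phi ` ball (b k) e)" "inj_on Phi (ball (b k) e)"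
      using has_complex_derivative_locally_invertible[OF hol bU[OF k] openU dP] by blast
    obtain g where g: "g holomorphic_on (Phi ` ball (b k) e)" "\<And>u. u \<in> ball (b k) e \<Longrightarrow> g (Phi u) = u"
      using holomorphic_has_inverse[OF holomorphic_on_subset[OF hol e(2)] open_ball e(4)] by metis
    have "z0 = Phi (b k)" unfolding Phi_def by (rule root_quotient[OF b_root(1)[OF k] nz(1)])
    then have "z0 \<in> Phi ` ball (b k) e" by (rule image_eqI) (use e(1) in simp)
    moreover have "g z \<in> U k \<and> g z = z * poly phi (g z)" if z: "z \<in> Phi ` ball (b k) e" for z
    proof -
      obtain u where u: "u \<in> ball (b k) e" "z = Phi u" using z by blast
      then have "g z = u" "u \<in> U k" using g(2) e(2) by auto
      moreover then have "poly phi u \<noteq> 0" by (auto simp: U_def)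
      ultimately show ?thesis using u by (simp add: Phi_def)
    qed
    ultimately show ?thesis
      using e(3) holomorphic_on_imp_continuous_on[OF g(1)]
      by (intro exI[of _ "Phi ` ball (b k) e"] exI[of _ g]) blast
  qed
  then obtain T w where Tw: "\<And>k. k \<in> {1..d} \<Longrightarrow> open (T k) \<and> z0 \<in> T k \<and> continuous_on (T k) (w k) \<and>
      (\<forall>z\<in>T k. w k z \<in> U k \<and> w k z = z * poly phi (w k z))" by metis
  define N where "N = (\<Inter>k\<in>{1..d}. T k) \<inter> (ball 0 1 - {0})"
  have wN: "w k z \<in> U k" "w k z = z * poly phi (w k z)" "0 < norm z" "norm z < 1"
    if "z \<in> N" "k \<in> {1..d}" for z k using that Tw[OF that(2)] by (auto simp: N_def)
  show ?thesis
  proof (rule that[of N w])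
    show "open N" unfolding N_def using Tw by (intro open_Int open_INT open_Diff) auto
    show "z0 \<in> N" using Tw z0 by (auto simp: N_def)
    show "N \<subseteq> ball 0 1 - {0}" by (auto simp: N_def)
    show "continuous_on N (w k)" if "k \<in> {1..d}" for k
      using Tw[OF that] that by (auto simp: N_def intro: continuous_on_subset)
    show "outer_root (norm z) z (w k z) \<and> 1 - z * dphi (w k z) \<noteq> 0" if zk: "z \<in> N" "k \<in> {1..d}" for z k
    proof -
      have nz: "poly phi (w k z) \<noteq> 0" "poly psi (w k z) \<noteq> 0" "1 < norm (w k z)"
        using wN(1)[OF zk] by (auto simp: U_def)
      have "(1 - z * dphi (w k z)) * poly phi (w k z) = poly phi (w k z) - (z * poly phi (w k z)) * dphi (w k z)"
        by (simp add: algebra_simps)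
      also have "\<dots> = poly psi (w k z)" unfolding wN(2)[OF zk, symmetric] poly_psi ..
      finally have "1 - z * dphi (w k z) \<noteq> 0" using nz by auto
      then show ?thesis using nz(3) wN(2)[OF zk] unfolding outer_root_def by (intro conjI) (rule refl, assumption, simp)
    qed
    show "(\<Sum>k=1..d. f (v k z)) = (\<Sum>k=1..d. f (w k z))" if z: "z \<in> N" for z and f :: "complex \<Rightarrow> complex"
    proof -
      have "inj_on (\<lambda>k. w k z) {1..d}"
      proof (rule inj_onI, rule ccontr)
        fix k m assume km: "k \<in> {1..d}" "m \<in> {1..d}" "w k z = w m z" "k \<noteq> m"
        then have "dist (w k z) (b k) < dist (w k z) (b m)" "dist (w m z) (b m) < dist (w m z) (b k)"
          using wN(1)[OF z km(1)] wN(1)[OF z km(2)] by (auto simp: U_def)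
        then show False using km(3) by simp
      qed
      then have cw: "card ((\<lambda>k. w k z) ` {1..d}) = d" by (simp add: card_image)
      have sub: "(\<lambda>k. w k z) ` {1..d} \<subseteq> (\<lambda>k. v k z) ` {1..d}"
      proof (rule image_subsetI)
        fix k assume k: "k \<in> {1..d}"
        have "w k z \<noteq> u1 z" using wN(1)[OF z k] norm_u1[OF wN(4)[OF z k]] by (auto simp: U_def)
        then show "w k z \<in> (\<lambda>k. v k z) ` {1..d}"
          using root_cases[OF wN(3,4)[OF z k] wN(2)[OF z k]] by auto
      qed
      have "card ((\<lambda>k. v k z) ` {1..d}) \<le> d" using card_image_le[of "{1..d}" "\<lambda>k. v k z"] by simp
      then have eq: "(\<lambda>k. w k z) ` {1..d} = (\<lambda>k. v k z) ` {1..d}"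
        using sub cw by (intro card_seteq) auto
      then have "card ((\<lambda>k. v k z) ` {1..d}) = card {1..d}" using cw by simp
      then have injv: "inj_on (\<lambda>k. v k z) {1..d}" by (rule eq_card_imp_inj_on[rotated]) simp
      have "(\<Sum>k=1..d. f (v k z)) = sum f ((\<lambda>k. v k z) ` {1..d})"
        using injv by (simp add: sum.reindex)
      also have "\<dots> = (\<Sum>k=1..d. f (w k z))"
        unfolding eq[symmetric] using \<open>inj_on (\<lambda>k. w k z) {1..d}\<close> by (simp add: sum.reindex)
      finally show ?thesis .
    qed
  qed
qed

text \<open>Neither the labelling of the roots nor the principal power is continuous in z, so
  integrability on the circle has to come from measurability. Locally the sum may be taken over
  continuous branches instead.\<close>

lemma gen_fun_measurable:
  assumes r: "0 < r" "r < 1" and simple: "\<And>z u. outer_root r z u \<Longrightarrow> 1 - z * dphi u \<noteq> 0"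
  shows "(\<lambda>t. gen_fun d u1 v h (of_real r * cis t)) \<in> borel_measurable borel"
proof (rule borel_measurable_locally)
  fix t0 :: real
  define z where "z = (\<lambda>t. of_real r * cis t)"
  have nz: "norm (z t) = r" for t using r by (simp add: z_def norm_mult)
  obtain N w where N: "open N" "z t0 \<in> N" "N \<subseteq> ball 0 1 - {0}"
    "\<And>k. k \<in> {1..d} \<Longrightarrow> continuous_on N (w k)"
    "\<And>z k. z \<in> N \<Longrightarrow> k \<in> {1..d} \<Longrightarrow> outer_root (norm z) z (w k z) \<and> 1 - z * dphi (w k z) \<noteq> 0"
    "\<And>z (f :: complex \<Rightarrow> complex). z \<in> N \<Longrightarrow> (\<Sum>k=1..d. f (v k z)) = (\<Sum>k=1..d. f (w k z))"
  proof (rule local_sections[of "z t0"])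
    show "1 - z t0 * dphi (v k (z t0)) \<noteq> 0" if "k \<in> {1..d}" for k
      using simple outer_root_v[OF r nz that] by blast
  qed (use nz r in auto)
  define T where "T = z -` N"
  have cz: "continuous_on A z" for A unfolding z_def by (intro continuous_intros)
  have T: "open T" "t0 \<in> T"
    unfolding T_def using N cz by (auto intro: open_vimage)
  have m: "(\<lambda>t. root_term h (z t) (w k (z t))) \<in> borel_measurable (restrict_space borel T)" if k: "k \<in> {1..d}" for k
  proof -
    have cw: "continuous_on T (\<lambda>t. w k (z t))"
      by (rule continuous_on_compose2[OF N(4)[OF k] cz]) (auto simp: T_def)
    have cu: "continuous_on T (\<lambda>t. u1 (z t))"
      by (rule continuous_on_compose2[OF holomorphic_on_imp_continuous_on[OF u1_holomorphic] cz])
         (use nz r in auto)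
    have w0: "w k (z t) \<noteq> 0" if "t \<in> T" for t
      using N(5)[OF _ k, of "z t"] that by (auto simp: T_def outer_root_def)
    have mq: "(\<lambda>t. u1 (z t) / w k (z t)) \<in> borel_measurable (restrict_space borel T)"
      by (intro borel_measurable_continuous_on_restrict continuous_on_divide cu cw) (use w0 in auto)
    have md: "(\<lambda>t. 1 - z t * dphi (w k (z t))) \<in> borel_measurable (restrict_space borel T)"
      by (intro borel_measurable_continuous_on_restrict continuous_intros cw cz)
    have "(\<lambda>t. (u1 (z t) / w k (z t)) powr of_real h) \<in> borel_measurable (restrict_space borel T)"
      by (rule measurable_compose[OF mq borel_measurable_powr_complex])
    then show ?thesis unfolding root_term_def
      by (intro borel_measurable_uminus borel_measurable_divide borel_measurable_times mq md)
  qed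
  have "(\<lambda>t. \<Sum>k=1..d. root_term h (z t) (w k (z t))) \<in> borel_measurable (restrict_space borel T)"
    using m by (intro borel_measurable_sum)
  moreover have "gen_fun d u1 v h (z t) = (\<Sum>k=1..d. root_term h (z t) (w k (z t)))" if "t \<in> T" for t
    using gen_fun_eq[of "z t" h] N(6)[of "z t" "root_term h (z t)"] that nz r by (simp add: T_def)
  ultimately have "(\<lambda>t. gen_fun d u1 v h (z t)) \<in> borel_measurable (restrict_space borel T)"
    by (subst measurable_cong[where g = "\<lambda>t. \<Sum>k=1..d. root_term h (z t) (w k (z t))"]) (auto simp: space_restrict_space)
  then show "\<exists>T. open T \<and> t0 \<in> T \<and> (\<lambda>t. gen_fun d u1 v h (of_real r * cis t)) \<in> borel_measurable (restrict_space borel T)"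
    using T unfolding z_def by blast
qed

end

section \<open>The saddle point integral\<close>

text \<open>The data of the solution S near 0. The number 1/c1 is sigma, so that the height is
  (x/c1) sqrt n.\<close>

locale saddle =
  fixes S :: "complex \<Rightarrow> complex" and \<rho> C c1 c2 c3 x :: real
  assumes S_hol: "S holomorphic_on ball 0 \<rho>" and rho: "0 < \<rho>" "\<rho> \<le> 1"
    and C: "C > 0" and c1: "c1 > 0" and x: "x > 0"
    and S_bound: "\<And>t. norm t < \<rho> \<Longrightarrow>
      norm (S t - (of_real c1 * t + of_real c2 * t ^ 2 + of_real c3 * t ^ 3)) \<le> C * norm t ^ 4"
    and S'_bound: "\<And>t. norm t < \<rho> \<Longrightarrow>
      norm (deriv S t - (of_real c1 + 2 * of_real c2 * t + 3 * of_real c3 * t ^ 2)) \<le> C * norm t ^ 3"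
begin

text \<open>Here \<tau> stands for 1/sqrt n and w for sqrt n t.\<close>

definition region :: "(complex \<times> real) set" where
  "region = {(w, \<tau>). 0 < \<tau> \<and> \<tau> \<le> 1 \<and> \<tau> * norm w < \<rho>}"

text \<open>A bound of order \<tau>^k, uniform in the region up to polynomial growth in w. Such
  bounds can be added and multiplied, which keeps the bookkeeping of the error terms
  mechanical.\<close>

definition bd :: "(complex \<Rightarrow> real \<Rightarrow> complex) \<Rightarrow> nat \<Rightarrow> nat \<Rightarrow> bool" where
  "bd f k j \<longleftrightarrow> (\<exists>K\<ge>0. \<forall>w \<tau>. (w, \<tau>) \<in> region \<longrightarrow> norm (f w \<tau>) \<le> K * \<tau> ^ k * (1 + norm w) ^ j)"

lemma bdI: "K \<ge> 0 \<Longrightarrow> (\<And>w \<tau>. (w, \<tau>) \<in> region \<Longrightarrow> norm (f w \<tau>) \<le> K * \<tau> ^ k * (1 + norm w) ^ j) \<Longrightarrow> bd f k j"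
  unfolding bd_def by blast

lemma bd_add: assumes "bd f k j" "bd g k j" shows "bd (\<lambda>w \<tau>. f w \<tau> + g w \<tau>) k j"
proof -
  obtain K1 K2 where K: "K1 \<ge> 0" "K2 \<ge> 0"
    "\<And>w \<tau>. (w, \<tau>) \<in> region \<Longrightarrow> norm (f w \<tau>) \<le> K1 * \<tau> ^ k * (1 + norm w) ^ j"
    "\<And>w \<tau>. (w, \<tau>) \<in> region \<Longrightarrow> norm (g w \<tau>) \<le> K2 * \<tau> ^ k * (1 + norm w) ^ j"
    using assms unfolding bd_def by blast
  show ?thesis
  proof (rule bdI[of "K1 + K2"])
    fix w \<tau> assume "(w, \<tau>) \<in> region"
    from norm_triangle_mono[OF K(3,4)[OF this]]
    show "norm (f w \<tau> + g w \<tau>) \<le> (K1 + K2) * \<tau> ^ k * (1 + norm w) ^ j"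
      by (simp add: distrib_right)
  qed (use K in auto)
qed

lemma bd_mult: assumes "bd f k j" "bd g k' j'" shows "bd (\<lambda>w \<tau>. f w \<tau> * g w \<tau>) (k + k') (j + j')"
proof -
  obtain K1 K2 where K: "K1 \<ge> 0" "K2 \<ge> 0"
    "\<And>w \<tau>. (w, \<tau>) \<in> region \<Longrightarrow> norm (f w \<tau>) \<le> K1 * \<tau> ^ k * (1 + norm w) ^ j"
    "\<And>w \<tau>. (w, \<tau>) \<in> region \<Longrightarrow> norm (g w \<tau>) \<le> K2 * \<tau> ^ k' * (1 + norm w) ^ j'"
    using assms unfolding bd_def by blast
  show ?thesis
  proof (rule bdI[of "K1 * K2"])
    fix w \<tau> assume r: "(w, \<tau>) \<in> region"
    then have "\<tau> > 0" by (simp add: region_def)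
    then have "norm (f w \<tau>) * norm (g w \<tau>) \<le>
        (K1 * \<tau> ^ k * (1 + norm w) ^ j) * (K2 * \<tau> ^ k' * (1 + norm w) ^ j')"
      using K(1) by (intro mult_mono K(3,4)[OF r]) auto
    then show "norm (f w \<tau> * g w \<tau>) \<le> K1 * K2 * \<tau> ^ (k + k') * (1 + norm w) ^ (j + j')"
      by (simp add: norm_mult power_add mult_ac)
  qed (use K in auto)
qed

lemma bd_mono: assumes "bd f k j" "k' \<le> k" "j \<le> j'" shows "bd f k' j'"
proof -
  obtain K where K: "K \<ge> 0" "\<And>w \<tau>. (w, \<tau>) \<in> region \<Longrightarrow> norm (f w \<tau>) \<le> K * \<tau> ^ k * (1 + norm w) ^ j"
    using assms unfolding bd_def by blast
  show ?thesis
  proof (rule bdI[OF K(1)])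
    fix w \<tau> assume r: "(w, \<tau>) \<in> region"
    then have t: "0 < \<tau>" "\<tau> \<le> 1" by (auto simp: region_def)
    have "K * \<tau> ^ k * (1 + norm w) ^ j \<le> K * \<tau> ^ k' * (1 + norm w) ^ j'"
      using t K(1) assms(2,3) by (intro mult_mono power_decreasing power_increasing) auto
    then show "norm (f w \<tau>) \<le> K * \<tau> ^ k' * (1 + norm w) ^ j'" using K(2)[OF r] by simp
  qed
qed

lemma bd_const: "bd (\<lambda>_ _. a) 0 0"
  by (rule bdI[of "norm a"]) auto
lemma bd_w: "bd (\<lambda>w _. w) 0 1"
  by (rule bdI[of 1]) auto
lemma bd_tau: "bd (\<lambda>_ \<tau>. of_real \<tau>) 1 0"
  by (rule bdI[of 1]) (auto simp: region_def)
lemma bd_pow: "bd f k j \<Longrightarrow> bd (\<lambda>w \<tau>. f w \<tau> ^ m) (m * k) (m * j)"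
proof (induction m)
  case 0 show ?case using bd_const[of 1] by simp
next
  case (Suc m) then show ?case using bd_mult[of f k j "\<lambda>w \<tau>. f w \<tau> ^ m" "m * k" "m * j"] by simp
qed

lemma bd_mono_term: "k \<le> k' \<Longrightarrow> j' \<le> j \<Longrightarrow> bd (\<lambda>w \<tau>. a * of_real \<tau> ^ k' * w ^ j') k j"
  using bd_mult[OF bd_mult[OF bd_const[of a] bd_pow[OF bd_tau, of k']] bd_pow[OF bd_w, of j']]
  by (rule bd_mono) auto

text \<open>The logarithm of the quotient of the two roots; only the odd part of S
  enters.\<close>

definition DD :: "complex \<Rightarrow> complex" where "DD t = S t - S (- t)"

lemma DD_bound:
  assumes "norm t < \<rho>"
  shows "norm (DD t - (2 * of_real c1 * t + 2 * of_real c3 * t ^ 3)) \<le> 2 * C * norm t ^ 4"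
proof -
  let ?f = "\<lambda>t. S t - (of_real c1 * t + of_real c2 * t ^ 2 + of_real c3 * t ^ 3)"
  have "DD t - (2 * of_real c1 * t + 2 * of_real c3 * t ^ 3) = ?f t - ?f (- t)"
    by (simp add: DD_def algebra_simps)
  also have "norm \<dots> \<le> norm (?f t) + norm (?f (- t))" by (rule norm_triangle_ineq4)
  also have "\<dots> \<le> C * norm t ^ 4 + C * norm t ^ 4"
    using S_bound[of t] S_bound[of "- t"] assms by (intro add_mono) simp_all
  finally show ?thesis by simp
qed

text \<open>The exponent that remains after exp(w^2/2 - 2xw) has been split off from the
  integrand, and E0 its part up to order \<tau>^2.\<close>

definition E :: "complex \<Rightarrow> real \<Rightarrow> complex" where
  "E w \<tau> = of_real (2 * x) * w - of_real (x / (c1 * \<tau>) + 1) * DD (of_real \<tau> * w)"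

definition E0 :: "complex \<Rightarrow> real \<Rightarrow> complex" where
  "E0 w \<tau> = of_real \<tau> * (- 2 * of_real c1 * w) + of_real \<tau> ^ 2 * (- 2 * of_real (x / c1 * c3) * w ^ 3)"

lemma E_minus_E0_bound:
  assumes "(w, \<tau>) \<in> region"
  shows "norm (E w \<tau> - E0 w \<tau>) \<le> 2 * \<bar>c3\<bar> * \<tau> ^ 3 * norm w ^ 3 + (x / c1 + 1) * (2 * C) * \<tau> ^ 3 * norm w ^ 4"
proof -
  have t: "0 < \<tau>" "\<tau> \<le> 1" "\<tau> * norm w < \<rho>" using assms by (auto simp: region_def)
  define t' where "t' = of_real \<tau> * w"
  have nt: "norm t' = \<tau> * norm w" using t by (simp add: t'_def norm_mult)
  define \<delta> where "\<delta> = DD t' - (2 * of_real c1 * t' + 2 * of_real c3 * t' ^ 3)"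
  have \<delta>: "norm \<delta> \<le> 2 * C * (\<tau> * norm w) ^ 4"
    using DD_bound[of t'] t nt by (simp add: \<delta>_def)
  have DD: "DD t' = 2 * of_real c1 * t' + 2 * of_real c3 * t' ^ 3 + \<delta>" by (simp add: \<delta>_def)
  have "E w \<tau> - E0 w \<tau> = - 2 * of_real c3 * of_real \<tau> ^ 3 * w ^ 3 - of_real (x / (c1 * \<tau>) + 1) * \<delta>"
    unfolding E_def E0_def t'_def[symmetric] DD
    using t(1) c1 by (simp add: t'_def field_simps power2_eq_square power3_eq_cube)
  also have "norm \<dots> \<le> 2 * \<bar>c3\<bar> * \<tau> ^ 3 * norm w ^ 3 + (x / (c1 * \<tau>) + 1) * norm \<delta>"
    using t(1) x c1 by (intro order_trans[OF norm_triangle_ineq4] add_mono)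
      (auto simp: norm_mult norm_power abs_of_pos simp del: of_real_add)
  also have "(x / (c1 * \<tau>) + 1) * norm \<delta> \<le> ((x / c1 + 1) / \<tau>) * (2 * C * (\<tau> * norm w) ^ 4)"
  proof (rule mult_mono[OF _ \<delta>])
    have "1 \<le> 1 / \<tau>" using t by simp
    then show "x / (c1 * \<tau>) + 1 \<le> (x / c1 + 1) / \<tau>" by (simp add: add_divide_distrib)
  qed (use t x c1 in auto)
  also have "\<dots> = (x / c1 + 1) * (2 * C) * \<tau> ^ 3 * norm w ^ 4"
    using t(1) by (simp add: power_mult_distrib field_simps eval_nat_numeral)
  finally show ?thesis by simp
qed

lemma bd_E_minus_E0: "bd (\<lambda>w \<tau>. E w \<tau> - E0 w \<tau>) 3 4"
proof (rule bdI[of "2 * \<bar>c3\<bar> + (x / c1 + 1) * (2 * C)"])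
  show "0 \<le> 2 * \<bar>c3\<bar> + (x / c1 + 1) * (2 * C)" using x c1 C by simp
  fix w \<tau> assume r: "(w, \<tau>) \<in> region"
  then have t: "0 < \<tau>" by (simp add: region_def)
  have p3: "norm w ^ 3 \<le> (1 + norm w) ^ 4"
    by (rule order_trans[OF power_mono[of "norm w" "1 + norm w"] power_increasing]) auto
  have p4: "norm w ^ 4 \<le> (1 + norm w) ^ 4" by (intro power_mono) auto
  have "2 * \<bar>c3\<bar> * \<tau> ^ 3 * norm w ^ 3 + (x / c1 + 1) * (2 * C) * \<tau> ^ 3 * norm w ^ 4
     \<le> 2 * \<bar>c3\<bar> * \<tau> ^ 3 * (1 + norm w) ^ 4 + (x / c1 + 1) * (2 * C) * \<tau> ^ 3 * (1 + norm w) ^ 4"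
    using p3 p4 t x c1 C by (intro add_mono mult_left_mono) auto
  then show "norm (E w \<tau> - E0 w \<tau>) \<le> (2 * \<bar>c3\<bar> + (x / c1 + 1) * (2 * C)) * \<tau> ^ 3 * (1 + norm w) ^ 4"
    using E_minus_E0_bound[OF r] by (simp add: algebra_simps)
qed

text \<open>For small \<tau> this keeps exp(E) below exp(|w|^2/8), which the Gaussian weight
  absorbs on the whole segment of length of order sqrt n.\<close>

lemma E_linear_bound:
  obtains K where "K > 0" "\<And>w \<tau>. (w, \<tau>) \<in> region \<Longrightarrow> norm (E w \<tau>) \<le> 2 * c1 + K * \<tau> * norm w ^ 2"
proof (rule that)
  let ?A = "2 * (x / c1) * \<bar>c3\<bar>" and ?B = "2 * \<bar>c3\<bar>" and ?C = "(x / c1 + 1) * (2 * C)"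
  show "?A + ?B + ?C > 0" using x c1 C by (intro add_nonneg_pos mult_pos_pos add_pos_pos divide_pos_pos) auto
  fix w \<tau> assume r: "(w, \<tau>) \<in> region"
  then have t: "0 < \<tau>" "\<tau> \<le> 1" "\<tau> * norm w < 1" using rho by (auto simp: region_def)
  define s where "s = \<tau> * norm w"
  have s: "0 \<le> s" "s \<le> 1" using t by (auto simp: s_def)
  define q where "q = \<tau> * norm w ^ 2"
  have q: "0 \<le> q" using t by (simp add: q_def)
  have "norm (E0 w \<tau>) \<le> norm (of_real \<tau> * (- 2 * of_real c1 * w)) + norm (of_real \<tau> ^ 2 * (- 2 * of_real (x / c1 * c3) * w ^ 3))"
    unfolding E0_def by (rule norm_triangle_ineq)
  also have "\<dots> = 2 * c1 * s + ?A * (s * q)"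
    using t c1 x by (simp add: s_def q_def norm_mult norm_divide norm_power abs_mult eval_nat_numeral)
  also have "\<dots> \<le> 2 * c1 * 1 + ?A * q"
    using s q c1 x by (intro add_mono mult_left_mono mult_left_le_one_le) auto
  finally have 1: "norm (E0 w \<tau>) \<le> 2 * c1 + ?A * q" by simp
  have "norm (E w \<tau> - E0 w \<tau>) \<le> ?B * ((\<tau> * s) * q) + ?C * ((s * s) * q)"
    using E_minus_E0_bound[OF r] by (simp add: s_def q_def eval_nat_numeral mult_ac)
  also have "\<dots> \<le> ?B * q + ?C * q"
    using s t q x c1 C by (intro add_mono mult_left_mono mult_left_le_one_le mult_le_one) auto
  finally have "norm (E w \<tau>) \<le> (2 * c1 + ?A * q) + (?B * q + ?C * q)"
    using 1 norm_triangle_ineq[of "E0 w \<tau>" "E w \<tau> - E0 w \<tau>"] by simp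
  also have "\<dots> = 2 * c1 + (?A + ?B + ?C) * q" by (simp only: distrib_right add.assoc)
  finally show "norm (E w \<tau>) \<le> 2 * c1 + (?A + ?B + ?C) * \<tau> * norm w ^ 2"
    by (simp only: q_def mult.assoc)
qed

definition H :: "complex \<Rightarrow> real \<Rightarrow> complex" where
  "H w \<tau> = exp (E w \<tau>) * deriv S (of_real \<tau> * w)"

text \<open>The expansion of H up to order \<tau>^2.\<close>

definition T :: "complex \<Rightarrow> real \<Rightarrow> complex" where
  "T w \<tau> = of_real c1 + of_real \<tau> * (2 * of_real c2 - 2 * of_real c1 ^ 2) * w
     + of_real \<tau> ^ 2 * ((3 * of_real c3 - 4 * of_real c1 * of_real c2 + 2 * of_real c1 ^ 3) * w ^ 2
                        - 2 * of_real (x * c3) * w ^ 3)"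

text \<open>The exponential is replaced by its quadratic Taylor polynomial in E, and E and S' by
  their expansions; every remainder is of order \<tau>^3 times a power of 1 + |w|.\<close>

lemma H_expansion:
  obtains K \<tau>0 where "K \<ge> 0" "0 < \<tau>0" "\<tau>0 \<le> 1"
    "\<And>w \<tau>. (w, \<tau>) \<in> region \<Longrightarrow> \<tau> \<le> \<tau>0 \<Longrightarrow>
       norm (H w \<tau> - T w \<tau>) \<le> K * \<tau> ^ 3 * (1 + norm w) ^ 15 * exp (norm w ^ 2 / 8)"
proof -
  obtain KE where KE: "KE > 0" "\<And>w \<tau>. (w, \<tau>) \<in> region \<Longrightarrow> norm (E w \<tau>) \<le> 2 * c1 + KE * \<tau> * norm w ^ 2"
    using E_linear_bound by blast
  define e1 e2 :: "complex \<Rightarrow> complex" where "e1 = (\<lambda>w. - 2 * of_real c1 * w)"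
    and "e2 = (\<lambda>w. - 2 * of_real (x / c1 * c3) * w ^ 3)"
  define A0 where "A0 = (\<lambda>w \<tau>. 1 + of_real \<tau> * e1 w + of_real \<tau> ^ 2 * (e2 w + e1 w ^ 2 / 2))"
  define B where "B = (\<lambda>w (\<tau>::real). deriv S (of_real \<tau> * w))"
  define B0 :: "complex \<Rightarrow> real \<Rightarrow> complex" where
    "B0 = (\<lambda>w \<tau>. of_real c1 + 2 * of_real c2 * (of_real \<tau> * w) + 3 * of_real c3 * (of_real \<tau> * w) ^ 2)"
  have te1: "bd (\<lambda>w \<tau>. of_real \<tau> * e1 w) 1 1"
    using bd_mono_term[of 1 1 1 1 "- 2 * of_real c1"] by (simp add: e1_def mult_ac)
  have te2: "bd (\<lambda>w \<tau>. of_real \<tau> ^ 2 * e2 w) 2 3"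
    using bd_mono_term[of 2 2 3 3 "- 2 * of_real (x / c1 * c3)"] by (simp add: e2_def mult_ac)
  have te11: "bd (\<lambda>w \<tau>. of_real \<tau> ^ 2 * (e1 w ^ 2 / 2)) 2 2"
    using bd_mono_term[of 2 2 2 2 "2 * of_real c1 ^ 2"] by (simp add: e1_def mult_ac power_mult_distrib)
  have d1: "bd (\<lambda>w \<tau>. E w \<tau> - of_real \<tau> * e1 w) 2 4"
  proof -
    have "bd (\<lambda>w \<tau>. (E w \<tau> - E0 w \<tau>) + of_real \<tau> ^ 2 * e2 w) 2 4"
      by (intro bd_add bd_mono[OF bd_E_minus_E0] bd_mono[OF te2]) auto
    then show ?thesis by (simp add: E0_def e1_def e2_def)
  qed
  have E1: "bd E 1 4"
  proof -
    have "bd (\<lambda>w \<tau>. (E w \<tau> - of_real \<tau> * e1 w) + of_real \<tau> * e1 w) 1 4"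
      by (intro bd_add bd_mono[OF d1] bd_mono[OF te1]) auto
    then show ?thesis by simp
  qed
  have B_B0: "bd (\<lambda>w \<tau>. B w \<tau> - B0 w \<tau>) 3 3"
  proof (rule bdI[of C])
    fix w \<tau> assume r: "(w, \<tau>) \<in> region"
    then have t: "0 < \<tau>" "\<tau> * norm w < \<rho>" by (auto simp: region_def)
    then have "norm (B w \<tau> - B0 w \<tau>) \<le> C * (\<tau> * norm w) ^ 3"
      using S'_bound[of "of_real \<tau> * w"] by (simp add: B_def B0_def norm_mult)
    also have "\<dots> = C * \<tau> ^ 3 * norm w ^ 3" by (simp add: power_mult_distrib)
    also have "\<dots> \<le> C * \<tau> ^ 3 * (1 + norm w) ^ 3"
      using C t by (intro mult_left_mono power_mono) auto
    finally show "norm (B w \<tau> - B0 w \<tau>) \<le> C * \<tau> ^ 3 * (1 + norm w) ^ 3" .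
  qed (use C in auto)
  have B0_bd: "bd B0 0 2"
  proof -
    have "bd (\<lambda>w \<tau>. of_real c1 * of_real \<tau> ^ 0 * w ^ 0 + 2 * of_real c2 * of_real \<tau> ^ 1 * w ^ 1
        + 3 * of_real c3 * of_real \<tau> ^ 2 * w ^ 2) 0 2"
      by (intro bd_add bd_mono_term) auto
    then show ?thesis by (simp add: B0_def mult_ac power_mult_distrib)
  qed
  have B_bd: "bd B 0 3"
  proof -
    have "bd (\<lambda>w \<tau>. (B w \<tau> - B0 w \<tau>) + B0 w \<tau>) 0 3"
      by (intro bd_add bd_mono[OF B_B0] bd_mono[OF B0_bd]) auto
    then show ?thesis by simp
  qed
  have A0_bd: "bd A0 0 4"
  proof -
    have "bd (\<lambda>w \<tau>. 1 + of_real \<tau> * e1 w + (of_real \<tau> ^ 2 * e2 w + of_real \<tau> ^ 2 * (e1 w ^ 2 / 2))) 0 4"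
      by (intro bd_add bd_mono[OF te1] bd_mono[OF te2] bd_mono[OF te11] bd_mono[OF bd_const]) auto
    then show ?thesis by (simp add: A0_def distrib_left)
  qed
  have quad: "bd (\<lambda>w \<tau>. E w \<tau> + E w \<tau> ^ 2 / 2 - (A0 w \<tau> - 1)) 3 8"
  proof -
    have "bd (\<lambda>w \<tau>. (E w \<tau> - E0 w \<tau>) + (1/2) * ((E w \<tau> - of_real \<tau> * e1 w) * (E w \<tau> + of_real \<tau> * e1 w))) 3 8"
    proof (intro bd_add)
      show "bd (\<lambda>w \<tau>. E w \<tau> - E0 w \<tau>) 3 8" by (rule bd_mono[OF bd_E_minus_E0]) auto
      have "bd (\<lambda>w \<tau>. E w \<tau> + of_real \<tau> * e1 w) 1 4"
        by (intro bd_add E1 bd_mono[OF te1]) auto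
      from bd_mult[OF bd_const[of "1/2"] bd_mult[OF d1 this]]
      show "bd (\<lambda>w \<tau>. (1/2) * ((E w \<tau> - of_real \<tau> * e1 w) * (E w \<tau> + of_real \<tau> * e1 w))) 3 8" by simp
    qed
    moreover have "(E w \<tau> - E0 w \<tau>) + (1/2) * ((E w \<tau> - of_real \<tau> * e1 w) * (E w \<tau> + of_real \<tau> * e1 w))
       = E w \<tau> + E w \<tau> ^ 2 / 2 - (A0 w \<tau> - 1)" for w \<tau>
    proof -
      have "E0 w \<tau> = of_real \<tau> * e1 w + of_real \<tau> ^ 2 * e2 w" by (simp add: E0_def e1_def e2_def)
      then show ?thesis by (simp add: A0_def field_simps power2_eq_square)
    qed
    ultimately show ?thesis by (simp only:)
  qed
  have prodT: "bd (\<lambda>w \<tau>. A0 w \<tau> * B0 w \<tau> - T w \<tau>) 3 15"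
  proof -
    let ?c1 = "of_real c1 :: complex" and ?c2 = "of_real c2 :: complex" and ?c3 = "of_real c3 :: complex"
    let ?g = "of_real (x / c1 * c3) :: complex"
    have "bd (\<lambda>w \<tau>. (- 6 * ?c1 * ?c3 + 4 * ?c1 ^ 2 * ?c2) * of_real \<tau> ^ 3 * w ^ 3
        + (- 4 * ?g * ?c2) * of_real \<tau> ^ 3 * w ^ 4
        + (6 * ?c1 ^ 2 * ?c3) * of_real \<tau> ^ 4 * w ^ 4 + (- 6 * ?g * ?c3) * of_real \<tau> ^ 4 * w ^ 5) 3 15"
      by (intro bd_add bd_mono_term) auto
    moreover have "A0 w \<tau> * B0 w \<tau> - T w \<tau> = (- 6 * ?c1 * ?c3 + 4 * ?c1 ^ 2 * ?c2) * of_real \<tau> ^ 3 * w ^ 3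
        + (- 4 * ?g * ?c2) * of_real \<tau> ^ 3 * w ^ 4
        + (6 * ?c1 ^ 2 * ?c3) * of_real \<tau> ^ 4 * w ^ 4 + (- 6 * ?g * ?c3) * of_real \<tau> ^ 4 * w ^ 5" for w \<tau>
    proof -
      have id: "(1 + t * (- 2 * a * w) + t ^ 2 * (- 2 * g * w ^ 3 + (- 2 * a * w) ^ 2 / 2)) *
            (a + 2 * b * (t * w) + 3 * c * (t * w) ^ 2)
          - (a + t * (2 * b - 2 * a ^ 2) * w + t ^ 2 * ((3 * c - 4 * a * b + 2 * a ^ 3) * w ^ 2 - 2 * (a * g) * w ^ 3))
          = (- 6 * a * c + 4 * a ^ 2 * b) * t ^ 3 * w ^ 3 + (- 4 * g * b) * t ^ 3 * w ^ 4
            + (6 * a ^ 2 * c) * t ^ 4 * w ^ 4 + (- 6 * g * c) * t ^ 4 * w ^ 5" for a b c g t w :: complex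
        by (simp add: algebra_simps eval_nat_numeral)
      have g: "of_real (x * c3) = ?c1 * ?g" using c1 by simp
      show ?thesis unfolding A0_def B0_def T_def e1_def e2_def g by (rule id)
    qed
    ultimately show ?thesis by simp
  qed
  obtain KA where KA: "KA \<ge> 0" "\<And>w \<tau>. (w, \<tau>) \<in> region \<Longrightarrow> norm (E w \<tau>) \<le> KA * \<tau> ^ 1 * (1 + norm w) ^ 4"
    using E1 unfolding bd_def by blast
  obtain KB where KB: "KB \<ge> 0" "\<And>w \<tau>. (w, \<tau>) \<in> region \<Longrightarrow> norm (B w \<tau>) \<le> KB * \<tau> ^ 0 * (1 + norm w) ^ 3"
    using B_bd unfolding bd_def by blast
  have "bd (\<lambda>w \<tau>. (E w \<tau> + E w \<tau> ^ 2 / 2 - (A0 w \<tau> - 1)) * B w \<tau>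
      + A0 w \<tau> * (B w \<tau> - B0 w \<tau>) + (A0 w \<tau> * B0 w \<tau> - T w \<tau>)) 3 15"
    by (intro bd_add bd_mono[OF bd_mult[OF quad B_bd]] bd_mono[OF bd_mult[OF A0_bd B_B0]] prodT) auto
  then obtain KR where KR: "KR \<ge> 0" "\<And>w \<tau>. (w, \<tau>) \<in> region \<Longrightarrow>
      norm ((E w \<tau> + E w \<tau> ^ 2 / 2 - (A0 w \<tau> - 1)) * B w \<tau>
      + A0 w \<tau> * (B w \<tau> - B0 w \<tau>) + (A0 w \<tau> * B0 w \<tau> - T w \<tau>)) \<le> KR * \<tau> ^ 3 * (1 + norm w) ^ 15"
    unfolding bd_def by blast
  define \<tau>0 where "\<tau>0 = min 1 (1 / (8 * KE))"
  show ?thesis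
  proof (rule that[of "exp (2 * c1) * KA ^ 3 * KB + KR" \<tau>0])
    show "0 \<le> exp (2 * c1) * KA ^ 3 * KB + KR" using KA KB KR by simp
    show "0 < \<tau>0" "\<tau>0 \<le> 1" using KE by (auto simp: \<tau>0_def)
    fix w \<tau> assume r: "(w, \<tau>) \<in> region" and le: "\<tau> \<le> \<tau>0"
    have t: "0 < \<tau>" using r by (auto simp: region_def)
    have "KE * \<tau> \<le> 1 / 8" using le KE(1) by (simp add: \<tau>0_def field_simps)
    then have "KE * \<tau> * norm w ^ 2 \<le> 1 / 8 * norm w ^ 2" by (intro mult_right_mono) auto
    then have nE: "norm (E w \<tau>) \<le> 2 * c1 + norm w ^ 2 / 8" using KE(2)[OF r] by simp
    have "norm (exp (E w \<tau>) - (\<Sum>i\<le>2. E w \<tau> ^ i / fact i)) \<le> exp (norm (E w \<tau>)) * norm (E w \<tau>) ^ 3 / 2"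
      using Taylor_exp_field[of "E w \<tau>" 2] by (simp add: numeral_3_eq_3 numeral_2_eq_2)
    also have "\<dots> \<le> exp (norm (E w \<tau>)) * norm (E w \<tau>) ^ 3" by simp
    also have "\<dots> \<le> exp (2 * c1 + norm w ^ 2 / 8) * (KA * \<tau> * (1 + norm w) ^ 4) ^ 3"
      using nE KA(2)[OF r] by (intro mult_mono power_mono) auto
    finally have R3: "norm (exp (E w \<tau>) - 1 - E w \<tau> - E w \<tau> ^ 2 / 2) \<le> exp (2 * c1 + norm w ^ 2 / 8) * (KA * \<tau> * (1 + norm w) ^ 4) ^ 3"
      by (simp add: numeral_2_eq_2 algebra_simps)
    have split: "H w \<tau> - T w \<tau> = (exp (E w \<tau>) - 1 - E w \<tau> - E w \<tau> ^ 2 / 2) * B w \<tau> +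
       ((E w \<tau> + E w \<tau> ^ 2 / 2 - (A0 w \<tau> - 1)) * B w \<tau>
      + A0 w \<tau> * (B w \<tau> - B0 w \<tau>) + (A0 w \<tau> * B0 w \<tau> - T w \<tau>))"
      by (simp add: H_def B_def algebra_simps)
    have 1: "norm ((exp (E w \<tau>) - 1 - E w \<tau> - E w \<tau> ^ 2 / 2) * B w \<tau>) \<le>
        (exp (2 * c1 + norm w ^ 2 / 8) * (KA * \<tau> * (1 + norm w) ^ 4) ^ 3) * (KB * (1 + norm w) ^ 3)"
      unfolding norm_mult using R3 KB(2)[OF r] KA(1) t
      by (intro mult_mono) (auto intro!: mult_nonneg_nonneg zero_le_power)
    have e: "(KA * \<tau> * (1 + norm w) ^ 4) ^ 3 * (KB * (1 + norm w) ^ 3) = KA ^ 3 * KB * \<tau> ^ 3 * (1 + norm w) ^ 15"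
    proof -
      have "((1 + norm w) ^ 4) ^ 3 * (1 + norm w) ^ 3 = (1 + norm w) ^ 15"
        unfolding power_mult[symmetric] power_add[symmetric] by simp
      then show ?thesis by (simp add: power_mult_distrib mult_ac)
    qed
    have 2: "KR * \<tau> ^ 3 * (1 + norm w) ^ 15 * 1 \<le> KR * \<tau> ^ 3 * (1 + norm w) ^ 15 * exp (norm w ^ 2 / 8)"
      using KR(1) t by (intro mult_left_mono) auto
    have "norm (H w \<tau> - T w \<tau>) \<le> (exp (2 * c1 + norm w ^ 2 / 8) * (KA * \<tau> * (1 + norm w) ^ 4) ^ 3) * (KB * (1 + norm w) ^ 3)
        + KR * \<tau> ^ 3 * (1 + norm w) ^ 15"
      unfolding split by (rule norm_triangle_mono[OF 1 KR(2)[OF r]])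
    also have "(exp (2 * c1 + norm w ^ 2 / 8) * (KA * \<tau> * (1 + norm w) ^ 4) ^ 3) * (KB * (1 + norm w) ^ 3)
       = exp (2 * c1) * exp (norm w ^ 2 / 8) * (KA ^ 3 * KB * \<tau> ^ 3 * (1 + norm w) ^ 15)"
      unfolding e[symmetric] exp_add by (simp add: mult_ac)
    finally show "norm (H w \<tau> - T w \<tau>) \<le> (exp (2 * c1) * KA ^ 3 * KB + KR) * \<tau> ^ 3 * (1 + norm w) ^ 15 * exp (norm w ^ 2 / 8)"
      using 2 by (simp add: algebra_simps)
  qed
qed

end

lemma power_le_fact_exp:
  assumes "(s::real) \<ge> 0" shows "s ^ k \<le> fact k * exp s"
proof -
  have "(\<Sum>n\<in>{k}. s ^ n /\<^sub>R fact n) \<le> exp s"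
    unfolding exp_def by (rule sum_le_suminf[OF summable_exp_generic]) (use assms in auto)
  then show ?thesis by (simp add: field_simps)
qed

text \<open>From 1 + s \<le> 3 + s^2/8, a power of 1 + s costs only a further factor
  exp(s^2/8).\<close>

lemma power_le_gauss:
  assumes "s \<ge> (0::real)" shows "(1 + s) ^ k * exp (s ^ 2 / 8) \<le> fact k * exp 3 * exp (s ^ 2 / 4)"
proof -
  have "0 \<le> (s - 4) ^ 2" by simp
  then have "1 + s \<le> 3 + s ^ 2 / 8" by (simp add: power2_eq_square algebra_simps)
  then have "exp (1 + s) \<le> exp (3 + s ^ 2 / 8)" by simp
  then have "(1 + s) ^ k \<le> fact k * exp (3 + s ^ 2 / 8)"
    using power_le_fact_exp[of "1 + s" k] assms by (meson add_increasing fact_ge_zero mult_left_mono order_trans zero_le_one)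
  then have "(1 + s) ^ k * exp (s ^ 2 / 8) \<le> fact k * exp (3 + s ^ 2 / 8) * exp (s ^ 2 / 8)"
    by (intro mult_right_mono) auto
  also have "\<dots> = fact k * exp 3 * exp (s ^ 2 / 8 + s ^ 2 / 8)" by (simp only: exp_add mult.assoc)
  finally show ?thesis by simp
qed

lemma gauss_cubic:
  fixes a0 a1 a2 a3 :: complex
  shows "has_bochner_integral lborel
    (\<lambda>y. of_real (std_normal_density y) * (a0 + a1 * of_real y + a2 * of_real y ^ 2 + a3 * of_real y ^ 3)) (a0 + a2)"
proof -
  have m: "has_bochner_integral lborel (\<lambda>y. complex_of_real (std_normal_density y * y ^ k)) (of_real c)"
    if "has_bochner_integral lborel (\<lambda>y. std_normal_density y * y ^ k) c" for k c
    by (rule has_bochner_integral_of_real[OF that])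
  note e0 = m[OF std_normal_moment_even[of 0, unfolded mult_0_right]] and
    o1 = m[OF std_normal_moment_odd[of 0, unfolded mult_0_right add_0]] and
    e2 = m[OF std_normal_moment_even[of 1, unfolded mult_1_right]] and
    o3 = m[OF std_normal_moment_odd[of 1]]
  have "has_bochner_integral lborel
    (\<lambda>y. a0 * of_real (std_normal_density y * y ^ 0) + a1 * of_real (std_normal_density y * y ^ 1)
       + a2 * of_real (std_normal_density y * y ^ 2) + a3 * of_real (std_normal_density y * y ^ (2 * 1 + 1)))
    (a0 * of_real (fact 0 / (2 ^ 0 * fact 0)) + a1 * of_real 0 + a2 * of_real (fact 2 / (2 ^ 1 * fact 1)) + a3 * of_real 0)"
    by (intro has_bochner_integral_add has_bochner_integral_mult_right e0 o1 e2 o3)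
  then show ?thesis by (simp add: algebra_simps eval_nat_numeral)
qed

text \<open>The Gaussian mean of T along the line Re w = 2x. The factors are the Hermite
  polynomials y, y^2 - 1 and y^3 - 3y at y = 2x.\<close>

definition saddle_value :: "real \<Rightarrow> real \<Rightarrow> real \<Rightarrow> real \<Rightarrow> real \<Rightarrow> real" where
  "saddle_value c1 c2 c3 x \<tau> = c1 + \<tau> * (2 * c2 - 2 * c1 ^ 2) * (2 * x)
     + \<tau> ^ 2 * ((3 * c3 - 4 * c1 * c2 + 2 * c1 ^ 3) * (4 * x ^ 2 - 1) - 2 * x * c3 * (8 * x ^ 3 - 6 * x))"

context saddle
begin

abbreviation M :: "real \<Rightarrow> real" where "M \<equiv> saddle_value c1 c2 c3 x"

text \<open>The integrand in the variable t, for the height (x/c1) sqrt n.\<close>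

definition psi' :: "nat \<Rightarrow> complex \<Rightarrow> complex" where
  "psi' n t = exp (of_nat n * t ^ 2 / 2 - of_real (x / c1 * sqrt (real n) + 1) * DD t) * deriv S t"

text \<open>Only the even powers of y contribute, through the moments 1 and 1 of orders 0 and
  2.\<close>

lemma gauss_T: "has_bochner_integral lborel (\<lambda>y. of_real (std_normal_density y) * T (Complex (2 * x) y) \<tau>) (of_real (M \<tau>))"
proof -
  define A where "A = (3 * of_real c3 - 4 * of_real c1 * of_real c2 + 2 * of_real c1 ^ 3 :: complex)"
  define B where "B = (2 * of_real c2 - 2 * of_real c1 ^ 2 :: complex)"
  define G where "G = (2 * of_real (x * c3) :: complex)"
  define X where "X = (2 * of_real x :: complex)"
  let ?t = "of_real \<tau> :: complex"
  have T: "T w \<tau> = of_real c1 + ?t * B * w + ?t ^ 2 * (A * w ^ 2 - G * w ^ 3)" for w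
    by (simp add: T_def A_def B_def G_def)
  have "T (Complex (2 * x) y) \<tau> = (of_real c1 + ?t * B * X + ?t ^ 2 * (A * X ^ 2 - G * X ^ 3))
      + (\<i> * (?t * B + ?t ^ 2 * (2 * A * X - 3 * G * X ^ 2))) * of_real y
      + (?t ^ 2 * (3 * G * X - A)) * of_real y ^ 2 + (\<i> * (?t ^ 2 * G)) * of_real y ^ 3" for y
  proof -
    have "Complex (2 * x) y = X + \<i> * of_real y" by (simp add: X_def complex_eq_iff)
    moreover have "c + t * B * (X + \<i> * z) + t ^ 2 * (A * (X + \<i> * z) ^ 2 - G * (X + \<i> * z) ^ 3)
      = (c + t * B * X + t ^ 2 * (A * X ^ 2 - G * X ^ 3))
      + (\<i> * (t * B + t ^ 2 * (2 * A * X - 3 * G * X ^ 2))) * z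
      + (t ^ 2 * (3 * G * X - A)) * z ^ 2 + (\<i> * (t ^ 2 * G)) * z ^ 3" for c t z
    proof -
      have "(X + \<i> * z) ^ 2 = X ^ 2 + 2 * \<i> * X * z - z ^ 2"
        by (simp add: power2_eq_square algebra_simps)
      moreover have "(X + \<i> * z) ^ 3 = X ^ 3 + 3 * \<i> * X ^ 2 * z - 3 * X * z ^ 2 - \<i> * z ^ 3"
        by (simp add: power2_eq_square power3_eq_cube algebra_simps)
      ultimately show ?thesis by (simp only:) (simp add: algebra_simps)
    qed
    ultimately show ?thesis unfolding T by (simp only:)
  qed
  note T_eq = this
  have value_eq: "(of_real c1 + ?t * B * X + ?t ^ 2 * (A * X ^ 2 - G * X ^ 3)) + ?t ^ 2 * (3 * G * X - A) = of_real (M \<tau>)"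
    by (simp add: saddle_value_def A_def B_def G_def X_def algebra_simps power2_eq_square power3_eq_cube)
  show ?thesis
    unfolding T_eq value_eq[symmetric] by (rule gauss_cubic)
qed

text \<open>With w = 2x + iy the exponent w^2/2 - 2xw is -2x^2 - y^2/2: the line passes through
  the saddle point, where the oscillation disappears.\<close>

lemma psi'_vertical:
  assumes "n \<ge> 1" and \<tau>: "\<tau> = 1 / sqrt (real n)"
  shows "psi' n (of_real \<tau> * Complex (2 * x) y) =
    of_real (exp (- 2 * x ^ 2) * exp (- (y ^ 2) / 2)) * H (Complex (2 * x) y) \<tau>"
proof -
  define w where "w = Complex (2 * x) y"
  have w: "w = of_real (2 * x) + \<i> * of_real y" by (simp add: w_def complex_eq_iff)
  have n0: "sqrt (real n) > 0" using assms by simp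
  have t: "x / c1 * sqrt (real n) = x / (c1 * \<tau>)" using n0 by (simp add: \<tau>)
  have "of_nat n * (of_real \<tau> * w) ^ 2 = of_real (real n * \<tau> ^ 2) * w ^ 2" by (simp add: power_mult_distrib)
  also have "real n * \<tau> ^ 2 = 1" using assms(1) by (simp add: \<tau> power_divide)
  finally have nt: "of_nat n * (of_real \<tau> * w) ^ 2 = w ^ 2" by simp
  have "psi' n (of_real \<tau> * w) = exp (w ^ 2 / 2 - of_real (2 * x) * w + E w \<tau>) * deriv S (of_real \<tau> * w)"
    unfolding psi'_def nt t E_def by (simp add: algebra_simps)
  also have "w ^ 2 / 2 - of_real (2 * x) * w = of_real (- 2 * x ^ 2 + - (y ^ 2) / 2)"
    unfolding w by (simp add: power2_eq_square field_simps)
  finally show ?thesis unfolding w_def[symmetric] H_def exp_add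
    by (simp add: exp_of_real[symmetric] exp_add[symmetric])
qed

lemma T_bound: obtains K where "K \<ge> 0" "\<And>w \<tau>. 0 \<le> \<tau> \<Longrightarrow> \<tau> \<le> 1 \<Longrightarrow> norm (T w \<tau>) \<le> K * (1 + norm w) ^ 3"
proof -
  define A where "A = norm (3 * of_real c3 - 4 * of_real c1 * of_real c2 + 2 * of_real c1 ^ 3 :: complex)"
  define B where "B = norm (2 * of_real c2 - 2 * of_real c1 ^ 2 :: complex)"
  define G where "G = norm (2 * of_real (x * c3) :: complex)"
  have nn: "A \<ge> 0" "B \<ge> 0" "G \<ge> 0" by (auto simp: A_def B_def G_def)
  show ?thesis
  proof (rule that[of "c1 + B + (A + G)"])
    show "c1 + B + (A + G) \<ge> 0" using c1 nn by simp
    fix w :: complex and \<tau> :: real assume t: "0 \<le> \<tau>" "\<tau> \<le> 1"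
    have p: "norm w ^ k \<le> (1 + norm w) ^ 3" if "k \<le> 3" for k
      by (rule order_trans[OF power_mono[of "norm w" "1 + norm w"] power_increasing]) (use that in auto)
    have t2: "\<tau> ^ 2 \<le> 1" using t by (simp add: power_le_one)
    have "norm (T w \<tau>) \<le> norm (of_real c1 :: complex) + norm (of_real \<tau> * (2 * of_real c2 - 2 * of_real c1 ^ 2) * w)
      + norm (of_real \<tau> ^ 2 * ((3 * of_real c3 - 4 * of_real c1 * of_real c2 + 2 * of_real c1 ^ 3) * w ^ 2
                        - 2 * of_real (x * c3) * w ^ 3))"
      unfolding T_def by (intro norm_triangle_mono norm_triangle_ineq order_refl)
    also have "\<dots> \<le> c1 * 1 + B * norm w ^ 1 + (A * norm w ^ 2 + G * norm w ^ 3)"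
    proof (intro add_mono)
      have "\<tau> * B * norm w \<le> 1 * B * norm w" using t nn by (intro mult_right_mono) auto
      then show "norm (of_real \<tau> * (2 * of_real c2 - 2 * of_real c1 ^ 2) * w) \<le> B * norm w ^ 1"
        using t by (simp add: norm_mult B_def)
      have "norm ((3 * of_real c3 - 4 * of_real c1 * of_real c2 + 2 * of_real c1 ^ 3) * w ^ 2
                        - 2 * of_real (x * c3) * w ^ 3) \<le> A * norm w ^ 2 + G * norm w ^ 3"
        by (rule order_trans[OF norm_triangle_ineq4]) (simp add: norm_mult norm_power A_def G_def)
      then have "\<tau> ^ 2 * norm ((3 * of_real c3 - 4 * of_real c1 * of_real c2 + 2 * of_real c1 ^ 3) * w ^ 2
                        - 2 * of_real (x * c3) * w ^ 3) \<le> 1 * (A * norm w ^ 2 + G * norm w ^ 3)"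
        using t2 by (intro mult_mono) auto
      then show "norm (of_real \<tau> ^ 2 * ((3 * of_real c3 - 4 * of_real c1 * of_real c2 + 2 * of_real c1 ^ 3) * w ^ 2
                        - 2 * of_real (x * c3) * w ^ 3)) \<le> A * norm w ^ 2 + G * norm w ^ 3"
        by (simp add: norm_mult norm_power)
    qed (use c1 in auto)
    also have "\<dots> \<le> c1 * (1 + norm w) ^ 3 + B * (1 + norm w) ^ 3 + (A * (1 + norm w) ^ 3 + G * (1 + norm w) ^ 3)"
      using nn c1 p[of 0] p[of 1] p[of 2] p[of 3] by (intro add_mono mult_left_mono) auto
    finally show "norm (T w \<tau>) \<le> (c1 + B + (A + G)) * (1 + norm w) ^ 3" by (simp add: algebra_simps)
  qed
qed

lemma integrable_gauss_quarter: "integrable lborel (\<lambda>y::real. exp (- (y ^ 2) / 4))"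
proof -
  have "integrable lborel (\<lambda>y. sqrt (4 * pi) * normal_density 0 (sqrt 2) y)" by simp
  moreover have "sqrt (4 * pi) * normal_density 0 (sqrt 2) y = exp (- (y ^ 2) / 4)" for y
    by (simp add: normal_density_def)
  ultimately show ?thesis by simp
qed

text \<open>Inside the segment the error is that of \<open>H_expansion\<close>. Outside it, at
  |y| of order sqrt n, the whole of T counts as error, and 1 is bounded by a multiple of (\<tau>
  (1 + |w|))^3.\<close>

lemma vertical_segment:
  assumes q0: "q0 > 0"
  obtains K where "eventually (\<lambda>n. \<forall>q \<Psi>. q0 \<le> q \<longrightarrow> q \<le> \<rho> / 2 \<longrightarrow>
     (\<forall>t. norm t < \<rho> \<longrightarrow> (\<Psi> has_field_derivative psi' n t) (at t)) \<longrightarrow>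
     norm ((\<Psi> (Complex (2 * x / sqrt (real n)) q) - \<Psi> (Complex (2 * x / sqrt (real n)) (- q))) / (2 * of_real pi * \<i>)
        * of_real (sqrt (2 * pi * real n) * exp (2 * x ^ 2) / c1) - of_real (M (1 / sqrt (real n)) / c1))
       \<le> K * (1 / sqrt (real n)) ^ 3) sequentially"
proof -
  obtain K0 \<tau>0 where K0: "K0 \<ge> 0" "0 < \<tau>0" "\<tau>0 \<le> 1"
    "\<And>w \<tau>. (w, \<tau>) \<in> region \<Longrightarrow> \<tau> \<le> \<tau>0 \<Longrightarrow>
       norm (H w \<tau> - T w \<tau>) \<le> K0 * \<tau> ^ 3 * (1 + norm w) ^ 15 * exp (norm w ^ 2 / 8)"
    by (rule H_expansion) (rule that)
  obtain KT where KT: "KT \<ge> 0" "\<And>w \<tau>. 0 \<le> \<tau> \<Longrightarrow> \<tau> \<le> 1 \<Longrightarrow> norm (T w \<tau>) \<le> KT * (1 + norm w) ^ 3"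
    by (rule T_bound) (rule that)
  define KK where "KK = (K0 + KT / q0 ^ 3)"
  have KK: "KK \<ge> 0" using K0 KT q0 by (simp add: KK_def)
  define KG where "KG = fact 15 * exp 3 * exp (x ^ 2)"
  define I where "I = (\<integral>y. exp (- (y ^ 2) / 4) \<partial>(lborel :: real measure))"
  have "eventually (\<lambda>n. 1 / sqrt (real n) < \<tau>0) sequentially"
    using K0(2) by real_asymp
  moreover have "eventually (\<lambda>n. 2 * x / sqrt (real n) < \<rho> / 2) sequentially"
    using rho by real_asymp
  moreover have "eventually (\<lambda>n. n \<ge> 1) sequentially" by (rule eventually_ge_at_top)
  ultimately have "eventually (\<lambda>n. \<forall>q \<Psi>. q0 \<le> q \<longrightarrow> q \<le> \<rho> / 2 \<longrightarrow>
     (\<forall>t. norm t < \<rho> \<longrightarrow> (\<Psi> has_field_derivative psi' n t) (at t)) \<longrightarrow>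
     norm ((\<Psi> (Complex (2 * x / sqrt (real n)) q) - \<Psi> (Complex (2 * x / sqrt (real n)) (- q))) / (2 * of_real pi * \<i>)
        * of_real (sqrt (2 * pi * real n) * exp (2 * x ^ 2) / c1) - of_real (M (1 / sqrt (real n)) / c1))
       \<le> (KK * KG * I / c1) * (1 / sqrt (real n)) ^ 3) sequentially"
  proof eventually_elim
    case (elim n)
    show ?case
    proof (intro allI impI)
      fix q \<Psi> assume q: "q0 \<le> q" "q \<le> \<rho> / 2"
        and \<Psi>: "\<forall>t. norm t < \<rho> \<longrightarrow> (\<Psi> has_field_derivative psi' n t) (at t)"
      define \<tau> where "\<tau> = 1 / sqrt (real n)"
      have \<tau>: "0 < \<tau>" "\<tau> \<le> 1" "\<tau> \<le> \<tau>0" "2 * x * \<tau> < \<rho> / 2" using elim K0(3) by (auto simp: \<tau>_def)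
      define Y where "Y = q / \<tau>"
      have Y: "Y > 0" "\<tau> * Y = q" using q q0 \<tau> by (auto simp: Y_def)
      define w where "w = (\<lambda>y. Complex (2 * x) y)"
      have nw: "norm (w y) \<le> 2 * x + \<bar>y\<bar>" "\<bar>y\<bar> \<le> norm (w y)" "norm (w y) ^ 2 = 4 * x ^ 2 + y ^ 2" for y
        using cmod_le[of "w y"] abs_Im_le_cmod[of "w y"] x cmod_power2[of "w y"] by (auto simp: w_def power_mult_distrib)
      have reg: "\<tau> * norm (w y) < \<rho>" if "\<bar>y\<bar> \<le> Y" for y
      proof -
        have "\<tau> * norm (w y) \<le> \<tau> * (2 * x + Y)" using nw(1)[of y] that \<tau> by (intro mult_left_mono) auto
        also have "\<dots> = 2 * x * \<tau> + q" using Y by (simp add: algebra_simps)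
        finally show ?thesis using \<tau> q by simp
      qed
      define f where "f = (\<lambda>y. psi' n (of_real \<tau> * w y) * (of_real \<tau> * \<i>))"
      have wy: "w = (\<lambda>y. of_real (2 * x) + \<i> * of_real y)" by (simp add: w_def complex_eq_iff fun_eq_iff)
      have dw: "((\<lambda>y. of_real \<tau> * w y) has_vector_derivative of_real \<tau> * \<i>) (at y within A)" for y A
        unfolding wy by (auto intro!: derivative_eq_intros)
      have nt: "norm (of_real \<tau> * w y) < \<rho>" if "y \<in> {-Y..Y}" for y
        using reg[of y] that \<tau> by (simp add: norm_mult abs_le_iff)
      have psi'_hol: "psi' n holomorphic_on ball 0 \<rho>"
      proof -
        have "(\<lambda>t. S (- t)) holomorphic_on ball 0 \<rho>"
          by (rule holomorphic_on_compose_gen[unfolded o_def, OF _ S_hol, where f = uminus])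
             (auto intro!: holomorphic_intros)
        then show ?thesis unfolding psi'_def DD_def
          by (intro holomorphic_intros holomorphic_deriv S_hol) auto
      qed
      have contf: "continuous_on {-Y..Y} f"
        unfolding f_def
        by (intro continuous_intros continuous_on_compose2[OF holomorphic_on_imp_continuous_on[OF psi'_hol]])
           (use nt in \<open>auto simp: wy intro!: continuous_intros\<close>)
      have "has_bochner_integral lborel (\<lambda>y. indicator {-Y..Y} y *\<^sub>R f y)
          (\<Psi> (of_real \<tau> * w Y) - \<Psi> (of_real \<tau> * w (- Y)))"
      proof (rule has_bochner_integral_FTC_Icc[OF _ _ contf])
        show "- Y \<le> Y" using Y by simp
        fix y assume "- Y \<le> y" "y \<le> Y"
        then have "(\<Psi> has_field_derivative psi' n (of_real \<tau> * w y)) (at (of_real \<tau> * w y))"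
          using \<Psi> nt by auto
        from field_vector_diff_chain_within[OF dw has_field_derivative_at_within[OF this]]
        show "((\<lambda>y. \<Psi> (of_real \<tau> * w y)) has_vector_derivative f y) (at y within {-Y..Y})"
          by (simp add: f_def o_def mult.commute)
      qed
      also have "of_real \<tau> * w Y = Complex (2 * x / sqrt (real n)) q"
        using Y \<tau> by (simp add: w_def \<tau>_def complex_eq_iff)
      also have "of_real \<tau> * w (- Y) = Complex (2 * x / sqrt (real n)) (- q)"
        using Y \<tau> by (simp add: w_def \<tau>_def complex_eq_iff)
      finally have V: "has_bochner_integral lborel (\<lambda>y. indicator {-Y..Y} y *\<^sub>R f y)
        (\<Psi> (Complex (2 * x / sqrt (real n)) q) - \<Psi> (Complex (2 * x / sqrt (real n)) (- q)))"
        (is "has_bochner_integral _ _ ?V") .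
      define c where "c = of_real \<tau> * \<i> * of_real (exp (- 2 * x ^ 2) * sqrt (2 * pi)) "
      have c0: "c \<noteq> 0" using \<tau> by (simp add: c_def)
      have f_eq: "f y = c * (of_real (std_normal_density y) * H (w y) \<tau>)" for y
        unfolding f_def w_def psi'_vertical[OF elim(3) \<tau>_def]
        by (simp add: c_def std_normal_density_def mult_ac)
      have "has_bochner_integral lborel (\<lambda>y. (1 / c) * (indicator {-Y..Y} y *\<^sub>R f y)) ((1 / c) * ?V)"
        by (rule has_bochner_integral_mult_right[OF V])
      then have "has_bochner_integral lborel (\<lambda>y. indicator {-Y..Y} y *\<^sub>R (of_real (std_normal_density y) * H (w y) \<tau>)) (?V / c)"
        using c0 by (simp add: f_eq)
      from has_bochner_integral_diff[OF this gauss_T[of \<tau>]]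
      have D: "has_bochner_integral lborel (\<lambda>y. indicator {-Y..Y} y *\<^sub>R (of_real (std_normal_density y) * H (w y) \<tau>)
          - of_real (std_normal_density y) * T (w y) \<tau>) (?V / c - of_real (M \<tau>))"
        (is "has_bochner_integral _ ?D _") by (simp add: w_def)
      have bound: "norm (?D y) \<le> KK * KG * \<tau> ^ 3 * exp (- (y ^ 2) / 4)" for y
      proof -
        define s where "s = norm (w y)"
        have s: "s \<ge> 0" "s ^ 2 = 4 * x ^ 2 + y ^ 2" using nw(3)[of y] by (auto simp: s_def)
        have "norm (?D y) \<le> std_normal_density y * (KK * \<tau> ^ 3 * ((1 + s) ^ 15 * exp (s ^ 2 / 8)))"
        proof (cases "\<bar>y\<bar> \<le> Y")
          case True
          then have "(w y, \<tau>) \<in> region" using reg[OF True] \<tau> by (simp add: region_def)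
          then have "norm (H (w y) \<tau> - T (w y) \<tau>) \<le> K0 * \<tau> ^ 3 * (1 + s) ^ 15 * exp (s ^ 2 / 8)"
            using K0(4) \<tau>(3) by (simp add: s_def)
          also have "\<dots> = K0 * (\<tau> ^ 3 * ((1 + s) ^ 15 * exp (s ^ 2 / 8)))" by simp
          also have "\<dots> \<le> KK * (\<tau> ^ 3 * ((1 + s) ^ 15 * exp (s ^ 2 / 8)))"
            using KT q0 \<tau> s by (intro mult_right_mono) (auto simp: KK_def)
          finally have "std_normal_density y * norm (H (w y) \<tau> - T (w y) \<tau>) \<le>
              std_normal_density y * (KK * (\<tau> ^ 3 * ((1 + s) ^ 15 * exp (s ^ 2 / 8))))"
            by (intro mult_left_mono) auto
          moreover have "?D y = of_real (std_normal_density y) * (H (w y) \<tau> - T (w y) \<tau>)"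
            using True by (simp add: indicator_def algebra_simps abs_le_iff)
          ultimately show ?thesis by (simp add: norm_mult mult.assoc)
        next
          case False
          then have "q / \<tau> < \<bar>y\<bar>" by (simp add: Y_def)
          also have "\<dots> \<le> 1 + s" using nw(2)[of y] by (simp add: s_def)
          finally have "q \<le> \<tau> * (1 + s)" using \<tau> by (simp add: field_simps)
          then have "q0 ^ 3 \<le> (\<tau> * (1 + s)) ^ 3" using q q0 by (intro power_mono) auto
          then have "1 \<le> (\<tau> * (1 + s)) ^ 3 / q0 ^ 3" using q0 by simp
          then have "KT * (1 + s) ^ 3 * 1 \<le> KT * (1 + s) ^ 3 * ((\<tau> * (1 + s)) ^ 3 / q0 ^ 3)"
            using KT s by (intro mult_left_mono) auto
          also have "\<dots> = (KT / q0 ^ 3) * \<tau> ^ 3 * (1 + s) ^ 6"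
            by (simp add: power_mult_distrib flip: power_add)
          also have "\<dots> \<le> KK * \<tau> ^ 3 * (1 + s) ^ 15"
            using K0 KT q0 \<tau> s KK
            by (intro mult_mono[OF mult_right_mono] power_increasing) (auto simp: KK_def)
          also have "\<dots> * 1 \<le> KK * \<tau> ^ 3 * (1 + s) ^ 15 * exp (s ^ 2 / 8)"
            using KK \<tau> s by (intro mult_left_mono) auto
          finally have "norm (T (w y) \<tau>) \<le> KK * \<tau> ^ 3 * ((1 + s) ^ 15 * exp (s ^ 2 / 8))"
            using KT(2)[of \<tau> "w y"] \<tau> by (simp add: s_def mult.assoc)
          then have "std_normal_density y * norm (T (w y) \<tau>) \<le> std_normal_density y * (KK * \<tau> ^ 3 * ((1 + s) ^ 15 * exp (s ^ 2 / 8)))"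
            by (intro mult_left_mono) auto
          moreover have "indicator {-Y..Y} y = (0 :: real)"
            using False by (auto simp: indicator_def abs_le_iff)
          ultimately show ?thesis by (simp add: norm_mult)
        qed
        also have "\<dots> \<le> std_normal_density y * (KK * \<tau> ^ 3 * (fact 15 * exp 3 * exp (s ^ 2 / 4)))"
          using power_le_gauss[OF s(1), of 15] KK \<tau> by (intro mult_left_mono) auto
        also have "\<dots> = KK * \<tau> ^ 3 * (fact 15 * exp 3) * ((1 / sqrt (2 * pi)) * (exp (- (y ^ 2) / 2) * exp (s ^ 2 / 4)))"
          unfolding std_normal_density_def by (simp only: mult_ac)
        also have "exp (- (y ^ 2) / 2) * exp (s ^ 2 / 4) = exp (x ^ 2) * exp (- (y ^ 2) / 4)"
          unfolding s(2) exp_add[symmetric] by (simp add: field_simps)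
        also have "KK * \<tau> ^ 3 * (fact 15 * exp 3) * ((1 / sqrt (2 * pi)) * (exp (x ^ 2) * exp (- (y ^ 2) / 4)))
            \<le> KK * \<tau> ^ 3 * (fact 15 * exp 3) * (1 * (exp (x ^ 2) * exp (- (y ^ 2) / 4)))"
        proof (intro mult_left_mono mult_right_mono)
          have "1 \<le> sqrt (2 * pi)" using pi_gt3 by simp
          then show "1 / sqrt (2 * pi) \<le> 1" by simp
        qed (use KK \<tau> in auto)
        finally show ?thesis by (simp add: KG_def mult_ac)
      qed
      have intD: "integrable lborel ?D" using D by (rule integrable.intros)
      have "norm (?V / c - of_real (M \<tau>)) = norm (integral\<^sup>L lborel ?D)"
        using has_bochner_integral_integral_eq[OF D] by simp
      also have "\<dots> \<le> (\<integral>y. norm (?D y) \<partial>lborel)" by (rule integral_norm_bound)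
      also have "\<dots> \<le> (\<integral>y. KK * KG * \<tau> ^ 3 * exp (- (y ^ 2) / 4) \<partial>lborel)"
        by (intro integral_mono integrable_norm intD integrable_mult_right integrable_gauss_quarter bound)
      also have "\<dots> = KK * KG * \<tau> ^ 3 * I" by (simp add: I_def)
      finally have main: "norm (?V / c - of_real (M \<tau>)) \<le> KK * KG * \<tau> ^ 3 * I" .
      have "?V / (2 * of_real pi * \<i>) * of_real (sqrt (2 * pi * real n) * exp (2 * x ^ 2) / c1) = ?V / c / of_real c1"
      proof -
        define R where "R = sqrt (2 * pi)"
        have R: "R > 0" "2 * pi = R * R" by (auto simp: R_def)
        have e1: "sqrt (2 * pi * real n) = R / \<tau>" using elim(3) by (simp add: \<tau>_def R_def real_sqrt_mult)
        define X where "X = sqrt (2 * pi * real n) * exp (2 * x ^ 2)"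
        have "(R / \<tau>) * exp (2 * x ^ 2) / (R * R) = 1 / (\<tau> * (exp (- 2 * x ^ 2) * R))"
          using \<tau>(1) R(1) by (simp add: exp_minus field_simps)
        then have X: "X / (2 * pi) = 1 / (\<tau> * (exp (- 2 * x ^ 2) * R))"
          unfolding X_def e1 unfolding R(2) .
        have quot: "1 / (t * e) = j / (t * j * e)" "V * ((j / b) / j) / a = V / b / a"
            "V / (2 * P * j) * (b / a) = V * (b / (2 * P) / j) / a"
          if "j \<noteq> 0" for t e j V a b P :: complex
          using that by (simp_all add: mult.commute)
        have "complex_of_real X / (2 * of_real pi) = of_real (X / (2 * pi))" by (simp only: of_real_divide of_real_mult of_real_numeral)
        also have "\<dots> = 1 / (of_real \<tau> * of_real (exp (- 2 * x ^ 2) * R))"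
          unfolding X by (simp only: of_real_divide of_real_mult of_real_1)
        also have "\<dots> = \<i> / c" unfolding c_def R_def by (rule quot(1)) simp
        finally have Xc: "complex_of_real X / (2 * of_real pi) = \<i> / c" .
        have "?V / (2 * of_real pi * \<i>) * of_real (X / c1) = ?V * (of_real X / (2 * of_real pi) / \<i>) / of_real c1"
          unfolding of_real_divide by (rule quot(3)) simp
        also have "\<dots> = ?V / c / of_real c1"
          unfolding Xc by (rule quot(2)) simp
        finally show ?thesis unfolding X_def .
      qed
      then have "?V / (2 * of_real pi * \<i>) * of_real (sqrt (2 * pi * real n) * exp (2 * x ^ 2) / c1) - of_real (M \<tau> / c1)
          = (?V / c - of_real (M \<tau>)) / of_real c1" by (simp add: diff_divide_distrib)
      then have "norm (?V / (2 * of_real pi * \<i>) * of_real (sqrt (2 * pi * real n) * exp (2 * x ^ 2) / c1) - of_real (M \<tau> / c1))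
          \<le> KK * KG * \<tau> ^ 3 * I / c1"
        using main c1 by (simp add: norm_divide divide_right_mono)
      then show "norm (?V / (2 * of_real pi * \<i>) * of_real (sqrt (2 * pi * real n) * exp (2 * x ^ 2) / c1)
          - of_real (M (1 / sqrt (real n)) / c1)) \<le> (KK * KG * I / c1) * (1 / sqrt (real n)) ^ 3"
        unfolding \<tau>_def[symmetric] by (simp add: mult_ac)
    qed
  qed
  then show ?thesis by (rule that)
qed


end

lemma bigo_of_real_bound:
  fixes f :: "nat \<Rightarrow> complex" and G h :: "nat \<Rightarrow> real"
  assumes le: "eventually (\<lambda>n. norm (f n) \<le> G n) sequentially" and G: "G \<in> O(h)"
  shows "f \<in> O(\<lambda>n. of_real (h n))"
proof -
  obtain c where c: "c > 0" "eventually (\<lambda>n. norm (G n) \<le> c * norm (h n)) sequentially"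
    using landau_o.bigE[OF G] by blast
  have "eventually (\<lambda>n. norm (f n) \<le> c * norm (complex_of_real (h n))) sequentially"
    using le c(2) by eventually_elim simp
  then show ?thesis by (rule landau_o.bigI[OF c(1)])
qed

context saddle
begin

text \<open>On the part with Re t \<ge> e0/4 the factor exp(-h Re(S(t) - S(-t))) is of order
  exp(-c sqrt n), while exp(n t^2/2) is bounded because Re t^2 = O(1/n) at the outer end. On the
  rest Re t^2 < 0 is bounded away from 0, and exp(n t^2/2) is of order exp(-c n).\<close>

lemma horizontal_segment:
  obtains e1 where "e1 > 0" "6 * e1 < \<rho>"
    "\<And>e0 B. 0 < e0 \<Longrightarrow> e0 \<le> e1 \<Longrightarrow> 0 \<le> B \<Longrightarrow> \<exists>K \<kappa>. \<kappa> > 0 \<and>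
      eventually (\<lambda>n. \<forall>\<alpha> q j \<Psi>. e0 / 2 \<le> q \<longrightarrow> q \<le> e0 \<longrightarrow> e0 \<le> \<alpha> \<longrightarrow> \<alpha> \<le> 2 * e0 \<longrightarrow>
        real n * (\<alpha> ^ 2 - q ^ 2) \<le> B \<longrightarrow> j \<in> {q, - q} \<longrightarrow>
        (\<forall>t. norm t < \<rho> \<longrightarrow> (\<Psi> has_field_derivative psi' n t) (at t)) \<longrightarrow>
        norm (\<Psi> (Complex \<alpha> j) - \<Psi> (Complex (2 * x / sqrt (real n)) j)) \<le> K * exp (- \<kappa> * sqrt (real n))) sequentially"
proof -
  define K3 where "K3 = 2 * \<bar>c3\<bar> + 2 * C"
  have K3: "K3 > 0" using C by (simp add: K3_def add_nonneg_pos)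
  define KS where "KS = c1 + 2 * \<bar>c2\<bar> + 3 * \<bar>c3\<bar> + C"
  have KS: "KS \<ge> 0" using c1 C by (simp add: KS_def)
  have S'_le: "norm (deriv S t) \<le> KS" if t: "norm t < \<rho>" for t
  proof -
    have t1: "norm t \<le> 1" using t rho by simp
    have "deriv S t = (deriv S t - (of_real c1 + 2 * of_real c2 * t + 3 * of_real c3 * t ^ 2))
        + of_real c1 + 2 * of_real c2 * t + 3 * of_real c3 * t ^ 2" by simp
    also have "norm \<dots> \<le> C * norm t ^ 3 + c1 + 2 * \<bar>c2\<bar> * norm t + 3 * \<bar>c3\<bar> * norm t ^ 2"
      by (intro norm_triangle_mono S'_bound t) (use c1 in \<open>auto simp: norm_mult norm_power\<close>)
    also have "\<dots> \<le> C * 1 + c1 + 2 * \<bar>c2\<bar> * 1 + 3 * \<bar>c3\<bar> * 1"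
      using t1 C by (intro add_mono mult_left_mono order_refl power_le_one) auto
    finally show ?thesis by (simp add: KS_def)
  qed
  have Re_DD: "Re (DD t) \<ge> 2 * c1 * Re t - K3 * norm t ^ 3" if t: "norm t < \<rho>" for t
  proof -
    have t1: "norm t \<le> 1" using t rho by simp
    have "DD t - 2 * of_real c1 * t = (DD t - (2 * of_real c1 * t + 2 * of_real c3 * t ^ 3)) + 2 * of_real c3 * t ^ 3"
      by simp
    also have "norm \<dots> \<le> 2 * C * norm t ^ 4 + 2 * \<bar>c3\<bar> * norm t ^ 3"
      by (intro norm_triangle_mono DD_bound t) (auto simp: norm_mult norm_power)
    also have "\<dots> \<le> 2 * C * norm t ^ 3 + 2 * \<bar>c3\<bar> * norm t ^ 3"
      using t1 C by (intro add_mono mult_left_mono power_decreasing order_refl) auto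
    finally have "norm (DD t - 2 * of_real c1 * t) \<le> K3 * norm t ^ 3" by (simp add: K3_def algebra_simps)
    then have "\<bar>Re (DD t - 2 * of_real c1 * t)\<bar> \<le> K3 * norm t ^ 3"
      using abs_Re_le_cmod order_trans by blast
    then show ?thesis by simp
  qed
  \<comment> \<open>the cubic error K3 |t|^3, with |t| at most 3 e0, must not exceed c1 e0 / 4\<close>
  define e1 where "e1 = min (\<rho> / 7) (sqrt (c1 / (4 * (27 * K3))))"
  have e1: "e1 > 0" "6 * e1 < \<rho>" using rho c1 K3 by (auto simp: e1_def min_def)
  have e1_sq: "27 * K3 * e0 ^ 2 \<le> c1 / 4" if "0 < e0" "e0 \<le> e1" for e0
  proof -
    have "e0 ^ 2 \<le> (sqrt (c1 / (4 * (27 * K3)))) ^ 2" using that by (intro power_mono) (auto simp: e1_def)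
    then have "e0 ^ 2 \<le> c1 / (4 * (27 * K3))" using c1 K3 by simp
    then show ?thesis using K3 by (simp add: field_simps)
  qed
  show ?thesis
  proof (rule that[OF e1])
    fix e0 B :: real assume e0: "0 < e0" "e0 \<le> e1" and B: "0 \<le> B"
    define \<kappa> where "\<kappa> = x * e0 / 4"
    have \<kappa>: "\<kappa> > 0" using x e0 by (simp add: \<kappa>_def)
    define A where "A = 3 * e0 ^ 2 / 32"
    have A: "A > 0" using e0 by (simp add: A_def)
    have "eventually (\<lambda>n. - A * real n + \<kappa> * sqrt (real n) + c1 * e0 / 4 \<le> - \<kappa> * sqrt (real n)) sequentially"
      using A \<kappa> by real_asymp
    moreover have "eventually (\<lambda>n. 2 * x / sqrt (real n) < e0) sequentially" using e0(1) by real_asymp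
    moreover have "eventually (\<lambda>n. n \<ge> 1) sequentially" by (rule eventually_ge_at_top)
    ultimately have "eventually (\<lambda>n. \<forall>\<alpha> q j \<Psi>. e0 / 2 \<le> q \<longrightarrow> q \<le> e0 \<longrightarrow> e0 \<le> \<alpha> \<longrightarrow> \<alpha> \<le> 2 * e0 \<longrightarrow>
        real n * (\<alpha> ^ 2 - q ^ 2) \<le> B \<longrightarrow> j \<in> {q, - q} \<longrightarrow>
        (\<forall>t. norm t < \<rho> \<longrightarrow> (\<Psi> has_field_derivative psi' n t) (at t)) \<longrightarrow>
        norm (\<Psi> (Complex \<alpha> j) - \<Psi> (Complex (2 * x / sqrt (real n)) j)) \<le> (KS * exp B * (2 * e0)) * exp (- \<kappa> * sqrt (real n))) sequentially"
    proof eventually_elim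
      case (elim n)
      show ?case
      proof (intro allI impI)
        fix \<alpha> q j \<Psi> assume q: "e0 / 2 \<le> q" "q \<le> e0" "e0 \<le> \<alpha>" "\<alpha> \<le> 2 * e0" "real n * (\<alpha> ^ 2 - q ^ 2) \<le> B" "j \<in> {q, - q}"
          and \<Psi>: "\<forall>t. norm t < \<rho> \<longrightarrow> (\<Psi> has_field_derivative psi' n t) (at t)"
        define x0 where "x0 = 2 * x / sqrt (real n)"
        have x0: "0 < x0" "x0 < e0" using elim x by (auto simp: x0_def)
        define a where "a = x / c1 * sqrt (real n) + 1"
        have a: "a > 0" using x c1 by (simp add: a_def add_nonneg_pos)
        have ac: "a * (c1 * e0 / 4) = \<kappa> * sqrt (real n) + c1 * e0 / 4"
          using c1 by (simp add: a_def \<kappa>_def field_simps)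
        define Seg where "Seg = closed_segment (Complex x0 j) (Complex \<alpha> j)"
        have seg: "Im t = j" "x0 \<le> Re t" "Re t \<le> \<alpha>" if t: "t \<in> Seg" for t
        proof -
          obtain s where s: "0 \<le> s" "s \<le> 1" "t = (1 - s) *\<^sub>R Complex x0 j + s *\<^sub>R Complex \<alpha> j"
            using t by (auto simp: Seg_def in_segment)
          have "s * x0 \<le> s * \<alpha>" "(1 - s) * x0 \<le> (1 - s) * \<alpha>"
            using s x0 q by (auto intro!: mult_left_mono)
          then show "Im t = j" "x0 \<le> Re t" "Re t \<le> \<alpha>" by (auto simp: s(3) algebra_simps)
        qed
        have nt: "norm t \<le> 3 * e0" "norm t < \<rho>" if t: "t \<in> Seg" for t
        proof -
          show "norm t \<le> 3 * e0" using cmod_le[of t] seg[OF t] x0 q by auto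
          then show "norm t < \<rho>" using e0 e1 by simp
        qed
        have bound: "norm (psi' n t) \<le> KS * exp B * exp (- \<kappa> * sqrt (real n))" if t: "t \<in> Seg" for t
        proof -
          define u where "u = Re t"
          have u: "x0 \<le> u" "u \<le> \<alpha>" using seg[OF t] by (auto simp: u_def)
          have j2: "j ^ 2 = q ^ 2" using q(6) by auto
          have "K3 * norm t ^ 3 \<le> K3 * (3 * e0) ^ 3" using nt(1)[OF t] K3 by (intro mult_left_mono power_mono) auto
          also have "\<dots> = (27 * K3 * e0 ^ 2) * e0" by (simp add: eval_nat_numeral)
          also have "\<dots> \<le> (c1 / 4) * e0" using e1_sq[OF e0] e0 by (intro mult_right_mono) auto
          finally have ReD: "Re (DD t) \<ge> 2 * c1 * u - c1 * e0 / 4"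
            using Re_DD[OF nt(2)[OF t]] by (simp add: u_def)
          have Re_t2: "Re (t ^ 2) = u ^ 2 - q ^ 2" using seg(1)[OF t] j2 by (simp add: Re_power2 u_def)
          have Re_exp: "Re (of_nat n * t ^ 2 / 2 - of_real a * DD t) = real n * (u ^ 2 - q ^ 2) / 2 - a * Re (DD t)"
          proof -
            have "Re (of_nat n * t ^ 2 / 2 - of_real a * DD t) = Re (of_real (real n / 2) * t ^ 2 - of_real a * DD t)"
              by (rule arg_cong[where f = Re]) simp
            also have "\<dots> = (real n / 2) * Re (t ^ 2) - a * Re (DD t)" by simp
            finally show ?thesis unfolding Re_t2 by simp
          qed
          have "real n * (u ^ 2 - q ^ 2) / 2 - a * Re (DD t) \<le> B - \<kappa> * sqrt (real n)"
          proof (cases "u \<ge> e0 / 4")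
            case True
            have "u ^ 2 \<le> \<alpha> ^ 2" using u x0 by (intro power_mono) auto
            then have "real n * (u ^ 2 - q ^ 2) \<le> real n * (\<alpha> ^ 2 - q ^ 2)" by (intro mult_left_mono) auto
            then have 1: "real n * (u ^ 2 - q ^ 2) / 2 \<le> B" using q(5) B by simp
            have "2 * c1 * u - c1 * e0 / 4 \<ge> c1 * e0 / 4"
              using mult_left_mono[OF True, of "2 * c1"] c1 by simp
            then have "a * (c1 * e0 / 4) \<le> a * Re (DD t)" using ReD a by (intro mult_left_mono) auto
            then show ?thesis using 1 ac mult_pos_pos[OF c1 e0(1)] by simp
          next
            case False
            have "u ^ 2 \<le> (e0 / 4) ^ 2" using False u x0 by (intro power_mono) auto
            moreover have "(e0 / 2) ^ 2 \<le> q ^ 2" using q e0 by (intro power_mono) auto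
            ultimately have "u ^ 2 - q ^ 2 \<le> - (2 * A)" by (simp add: A_def power_divide)
            then have "real n * (u ^ 2 - q ^ 2) \<le> real n * - (2 * A)" by (intro mult_left_mono) auto
            then have 1: "real n * (u ^ 2 - q ^ 2) / 2 \<le> - A * real n" by (simp add: mult_ac)
            have "0 \<le> 2 * c1 * u" using u x0 c1 by (intro mult_nonneg_nonneg) auto
            then have "- (c1 * e0 / 4) \<le> Re (DD t)" using ReD by linarith
            then have "a * - (c1 * e0 / 4) \<le> a * Re (DD t)" using a by (intro mult_left_mono) auto
            then have "- (a * (c1 * e0 / 4)) \<le> a * Re (DD t)" by (simp only: mult_minus_right)
            then show ?thesis using 1 ac elim(1) B by linarith
          qed
          then have "norm (exp (of_nat n * t ^ 2 / 2 - of_real a * DD t)) \<le> exp (B - \<kappa> * sqrt (real n))"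
            unfolding norm_exp_eq_Re Re_exp by simp
          then have "norm (exp (of_nat n * t ^ 2 / 2 - of_real a * DD t)) * norm (deriv S t) \<le> exp (B - \<kappa> * sqrt (real n)) * KS"
            using S'_le[OF nt(2)[OF t]] by (intro mult_mono) auto
          moreover have "exp (B - \<kappa> * sqrt (real n)) * KS = KS * exp B * exp (- \<kappa> * sqrt (real n))"
            by (simp add: exp_diff exp_minus field_simps)
          ultimately show ?thesis by (simp add: psi'_def norm_mult a_def)
        qed
        have "norm (\<Psi> (Complex \<alpha> j) - \<Psi> (Complex x0 j)) \<le> (KS * exp B * exp (- \<kappa> * sqrt (real n))) * norm (Complex \<alpha> j - Complex x0 j)"
        proof (rule field_differentiable_bound[where S = Seg and f' = "psi' n"])
          show "convex Seg" by (simp add: Seg_def)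
          show "(\<Psi> has_field_derivative psi' n t) (at t within Seg)" if "t \<in> Seg" for t
            using \<Psi> nt(2)[OF that] by (auto intro: has_field_derivative_at_within)
        qed (use bound in \<open>auto simp: Seg_def\<close>)
        also have "norm (Complex \<alpha> j - Complex x0 j) \<le> 2 * e0"
          using cmod_le[of "Complex \<alpha> j - Complex x0 j"] x0 q by simp
        then have "(KS * exp B * exp (- \<kappa> * sqrt (real n))) * norm (Complex \<alpha> j - Complex x0 j)
            \<le> (KS * exp B * exp (- \<kappa> * sqrt (real n))) * (2 * e0)" using KS by (intro mult_left_mono) auto
        finally show "norm (\<Psi> (Complex \<alpha> j) - \<Psi> (Complex (2 * x / sqrt (real n)) j)) \<le> (KS * exp B * (2 * e0)) * exp (- \<kappa> * sqrt (real n))"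
          by (simp add: x0_def mult_ac)
      qed
    qed
    then show "\<exists>K \<kappa>. \<kappa> > 0 \<and>
      eventually (\<lambda>n. \<forall>\<alpha> q j \<Psi>. e0 / 2 \<le> q \<longrightarrow> q \<le> e0 \<longrightarrow> e0 \<le> \<alpha> \<longrightarrow> \<alpha> \<le> 2 * e0 \<longrightarrow>
        real n * (\<alpha> ^ 2 - q ^ 2) \<le> B \<longrightarrow> j \<in> {q, - q} \<longrightarrow>
        (\<forall>t. norm t < \<rho> \<longrightarrow> (\<Psi> has_field_derivative psi' n t) (at t)) \<longrightarrow>
        norm (\<Psi> (Complex \<alpha> j) - \<Psi> (Complex (2 * x / sqrt (real n)) j)) \<le> K * exp (- \<kappa> * sqrt (real n))) sequentially"
      using \<kappa> by blast
  qed
qed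

text \<open>The image in the t-plane of an end of the arc |arg z| \<le> e0^2 of the circle with
  log(1/|z|) = L.\<close>

definition endpoint :: "real \<Rightarrow> real \<Rightarrow> complex" where
  "endpoint L e0 = csqrt (Complex (2 * L) (2 * e0 ^ 2))"

text \<open>The difference of values of a primitive at the two end points is independent of the
  path. It is split along a horizontal, a vertical and a second horizontal segment.\<close>

lemma saddle_asymptotics:
  obtains e1 where "e1 > 0" "6 * e1 < \<rho>"
    "\<And>e0 L \<Psi>. 0 < e0 \<Longrightarrow> e0 \<le> e1 \<Longrightarrow> (\<And>n. L n > 0) \<Longrightarrow> L \<in> O(\<lambda>n. 1 / real n) \<Longrightarrow>
      (\<And>n t. norm t < \<rho> \<Longrightarrow> (\<Psi> n has_field_derivative psi' n t) (at t)) \<Longrightarrow>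
      (\<lambda>n. (\<Psi> n (endpoint (L n) e0) - \<Psi> n (cnj (endpoint (L n) e0))) / (2 * of_real pi * \<i>)
         * of_real (sqrt (2 * pi * real n) * exp (2 * x ^ 2) / c1) - of_real (M (1 / sqrt (real n)) / c1))
      \<in> O(\<lambda>n. of_real (real n powr (- 3 / 2)))"
proof -
  obtain e1 where e1: "e1 > 0" "6 * e1 < \<rho>"
    and hor: "\<And>e0 B. 0 < e0 \<Longrightarrow> e0 \<le> e1 \<Longrightarrow> 0 \<le> B \<Longrightarrow> \<exists>K \<kappa>. \<kappa> > 0 \<and>
      eventually (\<lambda>n. \<forall>\<alpha> q j \<Psi>. e0 / 2 \<le> q \<longrightarrow> q \<le> e0 \<longrightarrow> e0 \<le> \<alpha> \<longrightarrow> \<alpha> \<le> 2 * e0 \<longrightarrow>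
        real n * (\<alpha> ^ 2 - q ^ 2) \<le> B \<longrightarrow> j \<in> {q, - q} \<longrightarrow>
        (\<forall>t. norm t < \<rho> \<longrightarrow> (\<Psi> has_field_derivative psi' n t) (at t)) \<longrightarrow>
        norm (\<Psi> (Complex \<alpha> j) - \<Psi> (Complex (2 * x / sqrt (real n)) j)) \<le> K * exp (- \<kappa> * sqrt (real n))) sequentially"
    by (rule horizontal_segment) (rule that)
  show ?thesis
  proof (rule that[OF e1])
    fix e0 :: real and L :: "nat \<Rightarrow> real" and \<Psi>
    assume e0: "0 < e0" "e0 \<le> e1" and L: "\<And>n. L n > 0" "L \<in> O(\<lambda>n. 1 / real n)"
      and \<Psi>: "\<And>n t. norm t < \<rho> \<Longrightarrow> (\<Psi> n has_field_derivative psi' n t) (at t)"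
    obtain B0 where B0: "B0 > 0" "eventually (\<lambda>n. norm (L n) \<le> B0 * norm (1 / real n)) sequentially"
      using landau_o.bigE[OF L(2)] by blast
    define B where "B = 2 * B0"
    have B: "B \<ge> 0" using B0 by (simp add: B_def)
    obtain K1 \<kappa> where \<kappa>: "\<kappa> > 0" and hor': "eventually (\<lambda>n. \<forall>\<alpha> q j \<Psi>. e0 / 2 \<le> q \<longrightarrow> q \<le> e0 \<longrightarrow> e0 \<le> \<alpha> \<longrightarrow> \<alpha> \<le> 2 * e0 \<longrightarrow>
        real n * (\<alpha> ^ 2 - q ^ 2) \<le> B \<longrightarrow> j \<in> {q, - q} \<longrightarrow>
        (\<forall>t. norm t < \<rho> \<longrightarrow> (\<Psi> has_field_derivative psi' n t) (at t)) \<longrightarrow>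
        norm (\<Psi> (Complex \<alpha> j) - \<Psi> (Complex (2 * x / sqrt (real n)) j)) \<le> K1 * exp (- \<kappa> * sqrt (real n))) sequentially"
      using hor[OF e0 B] by blast
    obtain K2 where ver: "eventually (\<lambda>n. \<forall>q \<Psi>. e0 / 2 \<le> q \<longrightarrow> q \<le> \<rho> / 2 \<longrightarrow>
     (\<forall>t. norm t < \<rho> \<longrightarrow> (\<Psi> has_field_derivative psi' n t) (at t)) \<longrightarrow>
     norm ((\<Psi> (Complex (2 * x / sqrt (real n)) q) - \<Psi> (Complex (2 * x / sqrt (real n)) (- q))) / (2 * of_real pi * \<i>)
        * of_real (sqrt (2 * pi * real n) * exp (2 * x ^ 2) / c1) - of_real (M (1 / sqrt (real n)) / c1))
       \<le> K2 * (1 / sqrt (real n)) ^ 3) sequentially"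
      by (rule vertical_segment[of "e0 / 2"]) (use e0 in auto)
    have "eventually (\<lambda>n. B0 / real n \<le> e0 ^ 2) sequentially" using e0 by real_asymp
    then have "eventually (\<lambda>n. norm ((\<Psi> n (endpoint (L n) e0) - \<Psi> n (cnj (endpoint (L n) e0))) / (2 * of_real pi * \<i>)
         * of_real (sqrt (2 * pi * real n) * exp (2 * x ^ 2) / c1) - of_real (M (1 / sqrt (real n)) / c1))
       \<le> K2 * (1 / sqrt (real n)) ^ 3 + (2 * (K1 * exp (- \<kappa> * sqrt (real n)))) / (2 * pi) * (sqrt (2 * pi * real n) * exp (2 * x ^ 2) / c1)) sequentially"
      using B0(2) hor' ver eventually_ge_at_top[of 1]
    proof eventually_elim
      case (elim n)
      define t where "t = endpoint (L n) e0"
      define \<alpha> q where "\<alpha> = Re t" and "q = Im t"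
      have t2: "t ^ 2 = Complex (2 * L n) (2 * e0 ^ 2)" by (simp add: t_def endpoint_def)
      have aq: "\<alpha> ^ 2 - q ^ 2 = 2 * L n" "\<alpha> * q = e0 ^ 2"
        using arg_cong[OF t2, of Re] arg_cong[OF t2, of Im] by (simp_all add: \<alpha>_def q_def Re_power2 Im_power2)
      have "\<alpha> \<ge> 0" using csqrt_principal[of "Complex (2 * L n) (2 * e0 ^ 2)"]
        by (auto simp: \<alpha>_def t_def endpoint_def)
      moreover have "\<alpha> \<noteq> 0" using aq(2) e0 by auto
      ultimately have \<alpha>: "\<alpha> > 0" by simp
      have "0 < \<alpha> * q" using aq(2) e0 by simp
      then have q: "q > 0" using \<alpha> by (simp add: zero_less_mult_iff)
      have L_le: "L n \<le> B0 / real n" using elim(2) L(1)[of n] by simp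
      have "q ^ 2 < \<alpha> ^ 2" using aq(1) L(1)[of n] by simp
      then have qa: "q < \<alpha>" by (rule power_less_imp_less_base) (use \<alpha> in simp)
      have "q * q \<le> \<alpha> * q" using qa q by (intro mult_right_mono) auto
      then have "q ^ 2 \<le> e0 ^ 2" unfolding aq(2) by (simp only: power2_eq_square)
      then have q_le: "q \<le> e0" by (rule power2_le_imp_le) (use e0 in simp)
      have "\<alpha> * q \<le> \<alpha> * \<alpha>" using qa \<alpha> by (intro mult_left_mono) auto
      then have "e0 ^ 2 \<le> \<alpha> ^ 2" unfolding aq(2) by (simp only: power2_eq_square)
      then have a_ge: "e0 \<le> \<alpha>" by (rule power2_le_imp_le) (use \<alpha> in simp)
      have "\<alpha> ^ 2 \<le> (2 * e0) ^ 2"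
      proof -
        have "\<alpha> ^ 2 \<le> 4 * e0 ^ 2"
          using aq(1) \<open>q ^ 2 \<le> e0 ^ 2\<close> L_le elim(1) zero_le_power2[of e0] by linarith
        then show ?thesis by (simp add: power_mult_distrib)
      qed
      then have a_le: "\<alpha> \<le> 2 * e0" using e0 power2_le_imp_le[of \<alpha> "2 * e0"] by simp
      have "\<alpha> * q \<le> (2 * e0) * q" using a_le q by (intro mult_right_mono) auto
      then have "e0 * e0 \<le> e0 * (2 * q)" unfolding aq(2) by (simp only: power2_eq_square mult_ac)
      then have "e0 \<le> 2 * q" using e0(1) by (rule mult_left_le_imp_le)
      then have q_ge: "e0 / 2 \<le> q" by simp
      have nB: "real n * (\<alpha> ^ 2 - q ^ 2) \<le> B"
        using L_le elim(5) by (simp add: aq B_def field_simps)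
      have tt: "t = Complex \<alpha> q" "cnj t = Complex \<alpha> (- q)" by (simp_all add: \<alpha>_def q_def complex_eq_iff)
      let ?x0 = "2 * x / sqrt (real n)"
      let ?c = "of_real (sqrt (2 * pi * real n) * exp (2 * x ^ 2) / c1) :: complex"
      have h: "norm (\<Psi> n (Complex \<alpha> j) - \<Psi> n (Complex ?x0 j)) \<le> K1 * exp (- \<kappa> * sqrt (real n))" if "j \<in> {q, - q}" for j
        using elim(3) q_ge q_le a_ge a_le nB that \<Psi> by blast
      have v: "norm ((\<Psi> n (Complex ?x0 q) - \<Psi> n (Complex ?x0 (- q))) / (2 * of_real pi * \<i>) * ?c - of_real (M (1 / sqrt (real n)) / c1))
          \<le> K2 * (1 / sqrt (real n)) ^ 3"
      proof -
        have "q \<le> \<rho> / 2" using q_le e0 e1 by simp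
        then show ?thesis using elim(4) q_ge \<Psi> by blast
      qed
      define P1 P2 where "P1 = \<Psi> n (Complex \<alpha> q) - \<Psi> n (Complex ?x0 q)"
        and "P2 = \<Psi> n (Complex \<alpha> (- q)) - \<Psi> n (Complex ?x0 (- q))"
      have split: "(\<Psi> n t - \<Psi> n (cnj t)) / (2 * of_real pi * \<i>) * ?c - of_real (M (1 / sqrt (real n)) / c1)
        = ((\<Psi> n (Complex ?x0 q) - \<Psi> n (Complex ?x0 (- q))) / (2 * of_real pi * \<i>) * ?c - of_real (M (1 / sqrt (real n)) / c1))
          + (P1 - P2) / (2 * of_real pi * \<i>) * ?c"
        unfolding tt(2) unfolding tt(1) P1_def P2_def
        by (simp add: diff_divide_distrib add_divide_distrib algebra_simps complex_cnj)
      have "norm (P1 - P2) \<le> 2 * (K1 * exp (- \<kappa> * sqrt (real n)))"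
        using norm_triangle_ineq4[of P1 P2] h[of q] h[of "- q"] by (simp add: P1_def P2_def)
      moreover have "norm ?c = sqrt (2 * pi * real n) * exp (2 * x ^ 2) / c1"
        using c1 by (simp only: norm_of_real) (simp add: abs_mult)
      ultimately have "norm ((P1 - P2) / (2 * of_real pi * \<i>) * ?c) \<le>
          (2 * (K1 * exp (- \<kappa> * sqrt (real n)))) / (2 * pi) * (sqrt (2 * pi * real n) * exp (2 * x ^ 2) / c1)"
      proof -
        assume P: "norm (P1 - P2) \<le> 2 * (K1 * exp (- \<kappa> * sqrt (real n)))"
          and c: "norm ?c = sqrt (2 * pi * real n) * exp (2 * x ^ 2) / c1"
        have "norm ((P1 - P2) / (2 * of_real pi * \<i>) * ?c) = norm (P1 - P2) / (2 * pi) * norm ?c"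
          by (simp only: norm_mult norm_divide) simp
        also have "\<dots> \<le> (2 * (K1 * exp (- \<kappa> * sqrt (real n)))) / (2 * pi) * norm ?c"
          using P by (intro mult_right_mono divide_right_mono) auto
        finally show ?thesis unfolding c .
      qed
      then show ?case unfolding t_def[symmetric] split by (rule norm_triangle_mono[OF v])
    qed
    moreover have "(\<lambda>n. K2 * (1 / sqrt (real n)) ^ 3 + (2 * (K1 * exp (- \<kappa> * sqrt (real n)))) / (2 * pi) * (sqrt (2 * pi * real n) * exp (2 * x ^ 2) / c1))
      \<in> O(\<lambda>n. real n powr (- 3 / 2))"
    proof (rule sum_in_bigo)
      show "(\<lambda>n. K2 * (1 / sqrt (real n)) ^ 3) \<in> O(\<lambda>n. real n powr (- 3 / 2))" by real_asymp
      have "(\<lambda>n. exp (- \<kappa> * sqrt (real n)) * sqrt (real n)) \<in> O(\<lambda>n. real n powr (- 3 / 2))"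
        using \<kappa> by real_asymp
      then have "(\<lambda>n. k * (exp (- \<kappa> * sqrt (real n)) * sqrt (real n))) \<in> O(\<lambda>n. real n powr (- 3 / 2))" for k
        by (cases "k = 0") (simp, subst landau_o.big.cmult_in_iff, simp_all)
      from this[of "2 * K1 / (2 * pi) * (sqrt (2 * pi) * exp (2 * x ^ 2) / c1)"]
      show "(\<lambda>n. (2 * (K1 * exp (- \<kappa> * sqrt (real n)))) / (2 * pi) * (sqrt (2 * pi * real n) * exp (2 * x ^ 2) / c1)) \<in> O(\<lambda>n. real n powr (- 3 / 2))"
        by (simp add: real_sqrt_mult mult_ac)
    qed
    ultimately show "(\<lambda>n. (\<Psi> n (endpoint (L n) e0) - \<Psi> n (cnj (endpoint (L n) e0))) / (2 * of_real pi * \<i>)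
         * of_real (sqrt (2 * pi * real n) * exp (2 * x ^ 2) / c1) - of_real (M (1 / sqrt (real n)) / c1))
      \<in> O(\<lambda>n. of_real (real n powr (- 3 / 2)))"
      by (rule bigo_of_real_bound)
  qed
qed

end

section \<open>The Cauchy integral for real heights\<close>

context lukasiewicz_roots
begin

text \<open>Taking the arc around z = 1 as an interval symmetric about 0 uses the periodicity of
  the integrand.\<close>

lemma circle_integral_split:
  assumes r: "0 < r" "r < 1" and D: "D > 0" "\<And>z u. outer_root r z u \<Longrightarrow> D \<le> norm (1 - z * dphi u)"
    and h: "h \<ge> 0" and \<epsilon>: "0 < \<epsilon>" "\<epsilon> < pi" and W: "W \<ge> 0"
    and near: "\<And>t. - \<epsilon> \<le> t \<Longrightarrow> t \<le> \<epsilon> \<Longrightarrow> norm (gen_fun d u1 v h (of_real r * cis t) - g t) \<le> W"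
    and far: "\<And>t. \<epsilon> \<le> t \<Longrightarrow> t \<le> 2 * pi - \<epsilon> \<Longrightarrow> norm (gen_fun d u1 v h (of_real r * cis t)) \<le> W"
    and J: "((\<lambda>t. g t / (of_real r * cis t) ^ n) has_integral J) {-\<epsilon>..\<epsilon>}"
  shows "norm (bridge_above_coeff d u1 v r n h - J / (2 * of_real pi)) \<le> W / r ^ n"
proof -
  define F where "F = (\<lambda>t. gen_fun d u1 v h (of_real r * cis t) / (of_real r * cis t) ^ n)"
  have nz: "norm (of_real r * cis t) = r" for t using r by (simp add: norm_mult)
  have nzn: "norm ((of_real r * cis t) ^ n) = r ^ n" for t using nz by (simp add: norm_power)
  have F_meas: "F \<in> borel_measurable borel"
    unfolding F_def
  proof (intro borel_measurable_divide)
    show "(\<lambda>t. gen_fun d u1 v h (of_real r * cis t)) \<in> borel_measurable borel"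
      by (rule gen_fun_measurable[OF r]) (use D in fastforce)
    show "(\<lambda>t. (of_real r * cis t) ^ n) \<in> borel_measurable borel"
      by (intro borel_measurable_continuous_onI continuous_intros)
  qed
  have F_bound: "norm (F t) \<le> real d * (1 / D) / r ^ n" for t
  proof -
    let ?z = "of_real r * cis t"
    have "norm (gen_fun d u1 v h ?z) \<le> (\<Sum>k=1..d. norm (root_term h ?z (v k ?z)))"
      using nz r by (subst gen_fun_eq) (auto intro: norm_sum)
    also have "\<dots> \<le> (\<Sum>k=1..d. 1 / D)"
    proof (rule sum_mono)
      fix k assume k: "k \<in> {1..d}"
      have "norm (v k ?z) > 1" "norm (u1 ?z) < 1" using nz r k by (auto intro!: norm_v norm_u1)
      then have q: "norm (u1 ?z / v k ?z) \<le> 1" by (simp add: norm_divide divide_le_eq_1)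
      have "norm (root_term h ?z (v k ?z)) \<le> (1 * 1) / D"
        unfolding norm_root_term using q h D(1) D(2)[OF outer_root_v[OF r nz k]]
        by (intro frac_le mult_mono powr_le1) auto
      then show "norm (root_term h ?z (v k ?z)) \<le> 1 / D" by simp
    qed
    also have "\<dots> = real d * (1 / D)" by simp
    finally show ?thesis unfolding F_def norm_divide nzn using r by (intro divide_right_mono) auto
  qed
  have F_int: "F integrable_on {a..b}" for a b
  proof -
    have "F absolutely_integrable_on {a..b}"
    proof (rule measurable_bounded_by_integrable_imp_absolutely_integrable[where g = "\<lambda>_. real d * (1 / D) / r ^ n"])
      show "F \<in> borel_measurable (lebesgue_on {a..b})"
        by (intro measurable_restrict_space1 measurable_completion) (use F_meas in simp)
    qed (use F_bound in auto)
    then show ?thesis by (simp add: absolutely_integrable_on_def)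
  qed
  have per: "F (t + 2 * pi) = F t" for t
    by (simp add: F_def cis_mult[symmetric])
  have "bridge_above_coeff d u1 v r n h = 1 / (2 * of_real pi * \<i>) *
      integral {0..2*pi} (\<lambda>t. gen_fun d u1 v h (0 + of_real r * cis t) / (0 + of_real r * cis t) ^ (n + 1) * of_real r * \<i> * cis t)"
    unfolding bridge_above_coeff_def circlepath_def
    by (subst contour_integral_part_circlepath_eq) auto
  also have "(\<lambda>t. gen_fun d u1 v h (0 + of_real r * cis t) / (0 + of_real r * cis t) ^ (n + 1) * of_real r * \<i> * cis t)
     = (\<lambda>t. \<i> * F t)"
    using r by (auto simp: F_def fun_eq_iff field_simps)
  also have "1 / (2 * of_real pi * \<i>) * integral {0..2*pi} (\<lambda>t. \<i> * F t) = integral {0..2*pi} F / (2 * of_real pi)"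
    by simp
  also have "integral {0..2*pi} F = integral {-\<epsilon>..\<epsilon>} F + integral {\<epsilon>..2*pi-\<epsilon>} F"
  proof -
    have "integral {0..2*pi} F = integral {0..2*pi-\<epsilon>} F + integral {2*pi-\<epsilon>..2*pi} F"
      by (rule Henstock_Kurzweil_Integration.integral_combine[symmetric]) (use \<epsilon> F_int in auto)
    also have "integral {2*pi-\<epsilon>..2*pi} F = integral {-\<epsilon>+2*pi..0+2*pi} F" by (simp add: add.commute)
    also have "\<dots> = integral {-\<epsilon>..0} (F \<circ> (+) (2*pi))" by (rule integral_shift_Icc_real[symmetric])
    also have "F \<circ> (+) (2*pi) = F" using per by (auto simp: fun_eq_iff add.commute)
    also have "integral {0..2*pi-\<epsilon>} F + integral {-\<epsilon>..0} F = integral {-\<epsilon>..2*pi-\<epsilon>} F"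
      by (subst add.commute, rule Henstock_Kurzweil_Integration.integral_combine) (use \<epsilon> F_int in auto)
    also have "\<dots> = integral {-\<epsilon>..\<epsilon>} F + integral {\<epsilon>..2*pi-\<epsilon>} F"
      by (rule Henstock_Kurzweil_Integration.integral_combine[symmetric]) (use \<epsilon> F_int in auto)
    finally show ?thesis .
  qed
  finally have b: "bridge_above_coeff d u1 v r n h = (integral {-\<epsilon>..\<epsilon>} F + integral {\<epsilon>..2*pi-\<epsilon>} F) / (2 * of_real pi)" .
  have "norm (integral {\<epsilon>..2*pi-\<epsilon>} F) \<le> integral {\<epsilon>..2*pi-\<epsilon>} (\<lambda>_. W / r ^ n)"
  proof (rule integral_norm_bound_integral[OF F_int])
    fix t assume "t \<in> {\<epsilon>..2*pi-\<epsilon>}"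
    then show "norm (F t) \<le> W / r ^ n"
      using far[of t] r unfolding F_def norm_divide nzn by (intro divide_right_mono) auto
  qed auto
  then have 1: "norm (integral {\<epsilon>..2*pi-\<epsilon>} F) \<le> (2 * pi - 2 * \<epsilon>) * (W / r ^ n)" using \<epsilon> by simp
  have "norm (integral {-\<epsilon>..\<epsilon>} (\<lambda>t. F t - g t / (of_real r * cis t) ^ n)) \<le> integral {-\<epsilon>..\<epsilon>} (\<lambda>_. W / r ^ n)"
  proof (rule integral_norm_bound_integral)
    show "(\<lambda>t. F t - g t / (of_real r * cis t) ^ n) integrable_on {-\<epsilon>..\<epsilon>}"
      using J by (intro integrable_diff F_int) auto
    fix t assume t: "t \<in> {-\<epsilon>..\<epsilon>}"
    have "F t - g t / (of_real r * cis t) ^ n = (gen_fun d u1 v h (of_real r * cis t) - g t) / (of_real r * cis t) ^ n"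
      by (simp add: F_def diff_divide_distrib)
    then show "norm (F t - g t / (of_real r * cis t) ^ n) \<le> W / r ^ n"
      using near[of t] t r by (simp only: norm_divide nzn) (intro divide_right_mono, auto)
  qed auto
  moreover have "integral {-\<epsilon>..\<epsilon>} (\<lambda>t. F t - g t / (of_real r * cis t) ^ n) = integral {-\<epsilon>..\<epsilon>} F - J"
    using J F_int by (subst integral_diff) (auto dest: integral_unique)
  ultimately have 2: "norm (integral {-\<epsilon>..\<epsilon>} F - J) \<le> 2 * \<epsilon> * (W / r ^ n)" using \<epsilon> by simp
  have "bridge_above_coeff d u1 v r n h - J / (2 * of_real pi) =
      ((integral {-\<epsilon>..\<epsilon>} F - J) + integral {\<epsilon>..2*pi-\<epsilon>} F) / (2 * of_real pi)"
    unfolding b by (simp add: field_simps)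
  also have "norm \<dots> = norm ((integral {-\<epsilon>..\<epsilon>} F - J) + integral {\<epsilon>..2*pi-\<epsilon>} F) / (2 * pi)"
    by (simp add: norm_divide norm_mult)
  also have "\<dots> \<le> (2 * \<epsilon> * (W / r ^ n) + (2 * pi - 2 * \<epsilon>) * (W / r ^ n)) / (2 * pi)"
    by (intro divide_right_mono norm_triangle_mono 1 2) auto
  also have "2 * \<epsilon> * (W / r ^ n) + (2 * pi - 2 * \<epsilon>) * (W / r ^ n) = (2 * pi) * (W / r ^ n)"
    unfolding distrib_right[symmetric] by simp
  also have "\<dots> / (2 * pi) = W / r ^ n" by simp
  finally show ?thesis .
qed

text \<open>In the variable t the near arc needs no contour: its integrand is the derivative of
  \<i> \<Psi>(t) along the circle, so its integral is a difference of values of \<Psi>.\<close>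

lemma coeff_asymptotics:
  assumes r: "\<And>n. 0 < r n \<and> r n < 1" and theta: "(\<lambda>n. 1 - r n) \<in> \<Theta>(\<lambda>n. 1 / real n)" and x: "x > 0"
  shows "(\<lambda>n. bridge_above_coeff d u1 v (r n) n (x * sg * sqrt (real n))
            * of_real (sqrt (2 * pi * real n) * exp (2 * x ^ 2) / c1)
         - of_real (saddle_value c1 c2 c3 x (1 / sqrt (real n)) / c1)) \<in> O(\<lambda>n. of_real (real n powr (- 3 / 2)))"
proof -
  have c1: "c1 > 0" using sg_pos by (simp add: c1_def)
  obtain S \<rho> C \<delta> where S: "S holomorphic_on ball 0 \<rho>" "\<rho> > 0" "\<rho> \<le> 1" "C > 0" "S 0 = 0" and \<delta>: "\<delta> > 0"
    and Sb: "\<And>t. norm t < \<rho> \<Longrightarrow> norm (S t - (of_real c1 * t + of_real c2 * t ^ 2 + of_real c3 * t ^ 3)) \<le> C * norm t ^ 4"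
    and S'b: "\<And>t. norm t < \<rho> \<Longrightarrow> norm (deriv S t - (of_real c1 + 2 * of_real c2 * t + 3 * of_real c3 * t ^ 2)) \<le> C * norm t ^ 3"
    and near: "\<And>t. norm t < \<rho> \<Longrightarrow> Re t > 0 \<Longrightarrow> \<bar>Im t\<bar> < Re t \<Longrightarrow> \<exists>k0\<in>{1..d}.
       (\<forall>h. root_term h (exp (- (t ^ 2 / 2))) (v k0 (exp (- (t ^ 2 / 2)))) =
         exp (- of_real (h + 1) * (S t - S (- t))) * deriv S t / t) \<and>
       (\<forall>k\<in>{1..d}-{k0}. norm (v k (exp (- (t ^ 2 / 2)))) \<ge> 1 + \<delta>)"
    by (rule near_param) (rule that)
  interpret sp: saddle S \<rho> C c1 c2 c3 x
    by unfold_locales (use S Sb S'b c1 x in auto)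
  obtain e1 where e1: "e1 > 0" "6 * e1 < \<rho>"
    and asym: "\<And>e0 L \<Psi>. 0 < e0 \<Longrightarrow> e0 \<le> e1 \<Longrightarrow> (\<And>n. L n > 0) \<Longrightarrow> L \<in> O(\<lambda>n. 1 / real n) \<Longrightarrow>
      (\<And>n t. norm t < \<rho> \<Longrightarrow> (\<Psi> n has_field_derivative sp.psi' n t) (at t)) \<Longrightarrow>
      (\<lambda>n. (\<Psi> n (sp.endpoint (L n) e0) - \<Psi> n (cnj (sp.endpoint (L n) e0))) / (2 * of_real pi * \<i>)
         * of_real (sqrt (2 * pi * real n) * exp (2 * x ^ 2) / c1) - of_real (saddle_value c1 c2 c3 x (1 / sqrt (real n)) / c1))
      \<in> O(\<lambda>n. of_real (real n powr (- 3 / 2)))"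
  proof (rule sp.saddle_asymptotics, goal_cases)
    case (1 e1)
    show ?case by (rule 1(1)) (fact 1)+
  qed
  define \<epsilon> where "\<epsilon> = e1 ^ 2"
  have e1_lt: "e1 < 1" using e1 S by simp
  have \<epsilon>: "0 < \<epsilon>" "\<epsilon> < 1" using e1 e1_lt by (auto simp: \<epsilon>_def power_less_one_iff)
  have eps_pi: "\<epsilon> < pi" using \<epsilon> pi_gt3 by simp
  obtain a where a: "a > 0" "eventually (\<lambda>n. a / real n \<le> 1 - r n) sequentially"
  proof -
    have "(\<lambda>n. 1 - r n) \<in> \<Omega>(\<lambda>n. 1 / real n)" using theta by (simp add: bigtheta_def)
    then obtain c where "c > 0" "eventually (\<lambda>n. norm (1 - r n) \<ge> c * norm (1 / real n)) sequentially"
      by (rule landau_omega.bigE)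
    then show ?thesis using r less_imp_le by (intro that[of c]) (auto elim!: eventually_mono simp: abs_of_pos)
  qed
  obtain b where b: "b > 0" "eventually (\<lambda>n. 1 - r n \<le> b / real n) sequentially"
  proof -
    have "(\<lambda>n. 1 - r n) \<in> O(\<lambda>n. 1 / real n)" using theta by (simp add: bigtheta_def)
    then obtain c where "c > 0" "eventually (\<lambda>n. norm (1 - r n) \<le> c * norm (1 / real n)) sequentially"
      by (rule landau_o.bigE)
    then show ?thesis using r less_imp_le by (intro that[of c]) (auto elim!: eventually_mono simp: abs_of_pos)
  qed
  have lim: "r \<longlonglongrightarrow> 1"
  proof -
    have "(\<lambda>n. 1 - r n) \<longlonglongrightarrow> 0"
    proof (rule tendsto_sandwich[of "\<lambda>_. 0" _ _ "\<lambda>n. b / real n"])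
      show "(\<lambda>n. b / real n) \<longlonglongrightarrow> 0" by real_asymp
    qed (use b(2) r in \<open>auto simp: less_imp_le\<close>)
    from tendsto_diff[OF tendsto_const[of 1] this] show ?thesis by simp
  qed
  have r_half: "eventually (\<lambda>n. r n \<ge> 1 / 2) sequentially"
    using order_tendstoD(1)[OF lim, of "1/2"] by (auto elim: eventually_mono)
  define L where "L = (\<lambda>n. - ln (r n))"
  have L_pos: "L n > 0" for n using r[of n] by (simp add: L_def)
  have exp_L: "exp (- L n) = r n" for n using r[of n] by (simp add: L_def)
  have L_ev: "eventually (\<lambda>n. L n \<le> 2 * b / real n) sequentially"
    using r_half b(2)
  proof eventually_elim
    case (elim n)
    have "L n = ln (1 / r n)" using r[of n] by (simp add: L_def ln_div)
    also have "\<dots> \<le> 1 / r n - 1" using r[of n] by (intro ln_le_minus_one) auto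
    also have "\<dots> = (1 - r n) / r n" using r[of n] by (simp add: field_simps)
    also have "\<dots> \<le> (b / real n) / (1 / 2)" using elim r[of n] by (intro frac_le) auto
    finally show ?case by (simp add: mult.commute)
  qed
  have L_O: "L \<in> O(\<lambda>n. 1 / real n)"
    using L_ev L_pos by (intro landau_o.bigI[of "2 * b"]) (use b in \<open>auto elim!: eventually_mono simp: abs_of_pos\<close>)
  obtain c m where c: "c > 0" and low: "eventually (\<lambda>n. \<forall>z u. outer_root (r n) z u \<longrightarrow> c / real n ^ m \<le> norm (1 - z * dphi u)) sequentially"
    by (rule deriv_lower_bound[OF r a lim]) (rule that)
  \<comment> \<open>the distance from 1 to the far arc, for radii at least 1/2\<close>
  define \<eta> where "\<eta> = sqrt (1 - cos \<epsilon>)"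
  have cos_lt: "cos \<epsilon> < 1" using cos_monotone_0_pi[of 0 \<epsilon>] \<epsilon> eps_pi by simp
  then have \<eta>: "\<eta> > 0" by (simp add: \<eta>_def)
  obtain \<delta>2 where \<delta>2: "\<delta>2 > 0" "\<delta>2 < 1" "\<And>z. norm z < 1 \<Longrightarrow> norm (z - 1) \<ge> \<eta> \<Longrightarrow> norm (u1 z) \<le> 1 - \<delta>2"
    using norm_u1_away_from_1[OF \<eta>] by metis
  define \<omega> where "\<omega> = max (1 / (1 + \<delta>)) (1 - \<delta>2)"
  have \<omega>: "0 < \<omega>" "\<omega> < 1" using \<delta> \<delta>2 by (auto simp: \<omega>_def max_def)
  have term_le: "norm (root_term h z (v k z)) \<le> \<omega> powr h * (1 / D)"
    if "h \<ge> 0" "0 < norm z" "norm z < 1" "k \<in> {1..d}" "norm (u1 z / v k z) \<le> \<omega>" "D > 0" "D \<le> norm (1 - z * dphi (v k z))" for h z k D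
  proof -
    have "norm (root_term h z (v k z)) \<le> (\<omega> powr h * 1) / D"
      unfolding norm_root_term using that \<omega> by (intro frac_le mult_mono powr_mono2) auto
    then show ?thesis by simp
  qed
  have "\<exists>g. \<forall>t. norm t < \<rho> \<longrightarrow> (g has_field_derivative sp.psi' n t) (at t)" for n
  proof -
    have hol: "sp.psi' n holomorphic_on ball 0 \<rho>"
    proof -
      have "(\<lambda>t. S (- t)) holomorphic_on ball 0 \<rho>"
        by (rule holomorphic_on_compose_gen[unfolded o_def, OF _ S(1), where f = uminus])
           (auto intro!: holomorphic_intros)
      then show ?thesis unfolding sp.psi'_def[abs_def] sp.DD_def
        by (intro holomorphic_intros holomorphic_deriv S(1)) auto
    qed
    obtain g where "\<And>t. t \<in> ball 0 \<rho> \<Longrightarrow> (g has_field_derivative sp.psi' n t) (at t within ball 0 \<rho>)"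
      using holomorphic_convex_primitive'[OF convex_ball open_ball hol] by blast
    then show ?thesis by (intro exI[of _ g]) (simp add: at_within_open[OF _ open_ball])
  qed
  then obtain \<Psi> where \<Psi>: "\<And>n t. norm t < \<rho> \<Longrightarrow> (\<Psi> n has_field_derivative sp.psi' n t) (at t)" by metis
  have main: "(\<lambda>n. (\<Psi> n (sp.endpoint (L n) e1) - \<Psi> n (cnj (sp.endpoint (L n) e1))) / (2 * of_real pi * \<i>)
         * of_real (sqrt (2 * pi * real n) * exp (2 * x ^ 2) / c1) - of_real (saddle_value c1 c2 c3 x (1 / sqrt (real n)) / c1))
      \<in> O(\<lambda>n. of_real (real n powr (- 3 / 2)))"
    by (rule asym[OF e1(1) order_refl L_pos L_O \<Psi>])
  have "eventually (\<lambda>n. L n \<le> \<epsilon>) sequentially"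
  proof -
    have "eventually (\<lambda>n. 2 * b / real n \<le> \<epsilon>) sequentially" using \<epsilon> by real_asymp
    with L_ev show ?thesis by eventually_elim simp
  qed
  then have err: "eventually (\<lambda>n. norm (bridge_above_coeff d u1 v (r n) n (x * sg * sqrt (real n))
      - (\<Psi> n (sp.endpoint (L n) e1) - \<Psi> n (cnj (sp.endpoint (L n) e1))) / (2 * of_real pi * \<i>))
      \<le> real d * (\<omega> powr (x * sg * sqrt (real n)) * (real n ^ m / c)) * exp (2 * b)) sequentially"
    using r_half low L_ev eventually_ge_at_top[of 1]
  proof eventually_elim
    case (elim n)
    define h where "h = x * sg * sqrt (real n)"
    define D where "D = c / real n ^ m"
    have h: "h \<ge> 0" using x sg_pos by (simp add: h_def)
    have D: "D > 0" using c elim by (simp add: D_def)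
    have rn: "0 < r n" "r n < 1" using r by auto
    define z where "z = (\<lambda>t. of_real (r n) * cis t)"
    have nz: "norm (z t) = r n" for t using rn by (simp add: z_def norm_mult)
    have low': "D \<le> norm (1 - z t * dphi (v k (z t)))" if "k \<in> {1..d}" for t k
      using elim(3) outer_root_v[OF rn nz that] by (simp add: D_def)
    define W where "W = real d * (\<omega> powr h * (1 / D))"
    have W: "W \<ge> 0" using D by (simp add: W_def)
    \<comment> \<open>the square root in the right half plane of -2 log z at the point z = r exp(i t)\<close>
    define T where "T = (\<lambda>t. csqrt (Complex (2 * L n) (- 2 * t)))"
    have T2: "T t ^ 2 = Complex (2 * L n) (- 2 * t)" for t by (simp add: T_def)
    have T_exp: "exp (- (T t ^ 2 / 2)) = z t" for t
    proof -
      have "- (T t ^ 2 / 2) = Complex (- L n) t" unfolding T2 by (simp add: complex_eq_iff)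
      then show ?thesis by (simp add: exp_eq_polar exp_L z_def)
    qed
    have T_props: "norm (T t) < \<rho>" "Re (T t) > 0" "\<bar>Im (T t)\<bar> < Re (T t)" "Complex (2 * L n) (- 2 * t) \<notin> \<real>\<^sub>\<le>\<^sub>0"
      if t: "- \<epsilon> \<le> t" "t \<le> \<epsilon>" for t
    proof -
      have "norm (T t) ^ 2 = norm (Complex (2 * L n) (- 2 * t))" by (simp add: T_def flip: norm_power)
      also have "\<dots> \<le> 2 * L n + 2 * \<bar>t\<bar>" using cmod_le[of "Complex (2 * L n) (- 2 * t)"] L_pos[of n] by simp
      also have "\<dots> \<le> (2 * e1) ^ 2" using elim(1) t by (simp add: \<epsilon>_def power_mult_distrib)
      finally have "norm (T t) \<le> 2 * e1" by (rule power2_le_imp_le) (use e1 in simp)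
      then show "norm (T t) < \<rho>" using e1 by simp
      have "Re (T t) ^ 2 - Im (T t) ^ 2 = 2 * L n" using arg_cong[OF T2[of t], of Re] by (simp add: Re_power2)
      then have lt: "Im (T t) ^ 2 < Re (T t) ^ 2" using L_pos[of n] by simp
      have Re0: "Re (T t) \<ge> 0"
        using csqrt_principal[of "Complex (2 * L n) (- 2 * t)"] by (auto simp: T_def)
      show "Re (T t) > 0" using Re0 lt zero_le_power2[of "Im (T t)"] by (cases "Re (T t) = 0") (auto simp del: zero_le_power2)
      show "\<bar>Im (T t)\<bar> < Re (T t)"
        using lt Re0 by (metis power2_abs power2_less_imp_less)
      show "Complex (2 * L n) (- 2 * t) \<notin> \<real>\<^sub>\<le>\<^sub>0" using L_pos[of n] by (auto simp: complex_nonpos_Reals_iff)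
    qed
    define g where "g = (\<lambda>t. exp (- of_real (h + 1) * (S (T t) - S (- T t))) * deriv S (T t) / T t)"
    have gen_sum: "gen_fun d u1 v h (z t) = (\<Sum>k=1..d. root_term h (z t) (v k (z t)))" for t
      by (rule gen_fun_eq) (simp_all only: nz rn)
    have near': "norm (gen_fun d u1 v h (z t) - g t) \<le> W" if t: "- \<epsilon> \<le> t" "t \<le> \<epsilon>" for t
    proof -
      obtain k0 where k0: "k0 \<in> {1..d}" "root_term h (z t) (v k0 (z t)) = g t"
        "\<And>k. k \<in> {1..d} - {k0} \<Longrightarrow> norm (v k (z t)) \<ge> 1 + \<delta>"
        using near[OF T_props(1-3)[OF t]] unfolding T_exp g_def by blast
      have "gen_fun d u1 v h (z t) - g t = (\<Sum>k\<in>{1..d}-{k0}. root_term h (z t) (v k (z t)))"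
        unfolding gen_sum using k0(1,2) by (subst sum.remove[of _ k0]) auto
      also have "norm \<dots> \<le> (\<Sum>k\<in>{1..d}-{k0}. \<omega> powr h * (1 / D))"
      proof (intro sum_norm_le term_le h D)
        fix k assume k: "k \<in> {1..d} - {k0}"
        show "norm (u1 (z t) / v k (z t)) \<le> \<omega>"
        proof -
          have "norm (u1 (z t)) / norm (v k (z t)) \<le> 1 / (1 + \<delta>)"
            using norm_u1[of "z t"] nz rn k0(3)[OF k] \<delta> by (intro frac_le) auto
          then show ?thesis by (simp add: norm_divide \<omega>_def)
        qed
      qed (use nz rn low' in auto)
      also have "\<dots> \<le> (\<Sum>k\<in>{1..d}. \<omega> powr h * (1 / D))"
        using D by (intro sum_mono2) auto
      also have "\<dots> = W" by (simp add: W_def)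
      finally show ?thesis .
    qed
    have far': "norm (gen_fun d u1 v h (z t)) \<le> W" if t: "\<epsilon> \<le> t" "t \<le> 2 * pi - \<epsilon>" for t
    proof -
      have cos_le: "cos t \<le> cos \<epsilon>"
      proof (cases "t \<le> pi")
        case True
        then show ?thesis using t \<epsilon> by (intro cos_monotone_0_pi_le) auto
      next
        case False
        have "cos t = cos (2 * pi - t)" by (simp add: cos_diff)
        also have "\<dots> \<le> cos \<epsilon>" using False t \<epsilon> by (intro cos_monotone_0_pi_le) auto
        finally show ?thesis .
      qed
      have "norm (z t - 1) ^ 2 = (r n * cos t - 1) ^ 2 + (r n * sin t) ^ 2"
        by (simp add: cmod_power2 z_def)
      also have "\<dots> = (1 - r n) ^ 2 + 2 * r n * (1 - cos t) + r n ^ 2 * ((cos t) ^ 2 + (sin t) ^ 2 - 1)"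
      proof -
        have "(\<rho> * c - 1) ^ 2 + (\<rho> * s) ^ 2 = (1 - \<rho>) ^ 2 + 2 * \<rho> * (1 - c) + \<rho> ^ 2 * (c ^ 2 + s ^ 2 - 1)" for \<rho> c s :: real
          by (simp add: power2_eq_square algebra_simps)
        then show ?thesis .
      qed
      also have "\<dots> = (1 - r n) ^ 2 + 2 * r n * (1 - cos t)" by simp
      also have "\<dots> \<ge> 2 * (1/2) * (1 - cos \<epsilon>)"
        using elim(2) cos_le cos_lt by (intro add_increasing mult_mono) auto
      finally have "\<eta> ^ 2 \<le> norm (z t - 1) ^ 2" using cos_lt by (simp add: \<eta>_def)
      then have "\<eta> \<le> norm (z t - 1)" by (rule power2_le_imp_le) simp
      then have u1_le: "norm (u1 (z t)) \<le> 1 - \<delta>2" using nz rn by (intro \<delta>2(3)) auto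
      have "norm (gen_fun d u1 v h (z t)) \<le> (\<Sum>k=1..d. \<omega> powr h * (1 / D))"
        unfolding gen_sum
      proof (intro sum_norm_le term_le h D)
        fix k assume k: "k \<in> {1..d}"
        have "norm (u1 (z t)) / norm (v k (z t)) \<le> (1 - \<delta>2) / 1"
          using u1_le norm_v[of "z t" k] nz rn k \<delta>2 by (intro frac_le) auto
        then show "norm (u1 (z t) / v k (z t)) \<le> \<omega>" by (simp add: norm_divide \<omega>_def)
      qed (use nz rn low' in auto)
      also have "\<dots> = W" by (simp add: W_def)
      finally show ?thesis .
    qed
    have zn: "1 / z t ^ n = exp (of_nat n * T t ^ 2 / 2)" for t
    proof -
      have "z t ^ n = exp (- (of_nat n * T t ^ 2 / 2))"
        unfolding T_exp[symmetric] exp_of_nat_mult[symmetric] by simp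
      then show ?thesis
        by (simp only: exp_minus inverse_eq_divide divide_divide_eq_right mult_1_left div_by_1)
    qed
    have hx: "x / c1 * sqrt (real n) + 1 = h + 1" by (simp add: h_def c1_def)
    have g_psi: "g t / z t ^ n = sp.psi' n (T t) / T t" for t
    proof -
      define X where "X = of_real (h + 1) * (S (T t) - S (- T t))"
      have g: "g t = exp (- X) * deriv S (T t) / T t" unfolding g_def X_def mult_minus_left ..
      have "a * b / c * w = (w * a) * b / c" for a b c w :: complex by simp
      from this[of "exp (- X)" "deriv S (T t)" "T t" "exp (of_nat n * T t ^ 2 / 2)"]
      have "g t * (1 / z t ^ n) = (exp (of_nat n * T t ^ 2 / 2) * exp (- X)) * deriv S (T t) / T t"
        unfolding zn g .
      also have "exp (of_nat n * T t ^ 2 / 2) * exp (- X) = exp (of_nat n * T t ^ 2 / 2 - X)"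
        by (simp only: exp_add[symmetric] diff_conv_add_uminus)
      also have "\<dots> * deriv S (T t) / T t = sp.psi' n (T t) / T t"
        unfolding sp.psi'_def sp.DD_def hx X_def ..
      finally show ?thesis by simp
    qed
    have "((\<lambda>t. g t / z t ^ n) has_integral (\<i> * \<Psi> n (T \<epsilon>) - \<i> * \<Psi> n (T (- \<epsilon>)))) {-\<epsilon>..\<epsilon>}"
    proof (rule fundamental_theorem_of_calculus)
      fix t assume t: "t \<in> {-\<epsilon>..\<epsilon>}"
      have T0: "T t \<noteq> 0" using T_props(2)[of t] t by auto
      define Z where "Z = (\<lambda>t. Complex (2 * L n) (- 2 * t))"
      have T_Z: "T = csqrt \<circ> Z" by (simp add: T_def Z_def fun_eq_iff)
      have "Z = (\<lambda>t. of_real (2 * L n) + of_real t * (- 2 * \<i>))" by (simp add: Z_def complex_eq_iff fun_eq_iff)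
      note Z_eq = this
      have "(Z has_vector_derivative 0 + of_real 1 * (- 2 * \<i>)) (at t within {-\<epsilon>..\<epsilon>})"
        unfolding Z_eq
        by (intro has_vector_derivative_add has_vector_derivative_const has_vector_derivative_mult_left
            has_vector_derivative_of_real DERIV_ident)
      then have dZ: "(Z has_vector_derivative - 2 * \<i>) (at t within {-\<epsilon>..\<epsilon>})" by simp
      have "Z t \<notin> \<real>\<^sub>\<le>\<^sub>0" unfolding Z_def by (rule T_props(4)) (use t in auto)
      then have "(csqrt has_field_derivative inverse (2 * csqrt (Z t))) (at (Z t) within Z ` {-\<epsilon>..\<epsilon>})"
        by (rule has_field_derivative_at_within[OF has_field_derivative_csqrt])
      from field_vector_diff_chain_within[OF dZ this]
      have dT: "(T has_vector_derivative (- 2 * \<i>) * inverse (2 * T t)) (at t within {-\<epsilon>..\<epsilon>})"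
        unfolding T_Z by (simp only: o_apply)
      have "((\<lambda>s. \<i> * \<Psi> n s) has_field_derivative \<i> * sp.psi' n (T t)) (at (T t) within T ` {-\<epsilon>..\<epsilon>})"
        by (rule has_field_derivative_at_within[OF DERIV_cmult[OF \<Psi>[OF T_props(1)]]]) (use t in auto)
      from field_vector_diff_chain_within[OF dT this]
      have "((\<lambda>t. \<i> * \<Psi> n (T t)) has_vector_derivative (- 2 * \<i>) * inverse (2 * T t) * (\<i> * sp.psi' n (T t))) (at t within {-\<epsilon>..\<epsilon>})"
        by (simp add: o_def)
      moreover have "(- 2 * \<i>) * inverse (2 * T t) * (\<i> * sp.psi' n (T t)) = g t / z t ^ n"
        unfolding g_psi using T0 by (simp add: field_simps)
      ultimately show "((\<lambda>t. \<i> * \<Psi> n (T t)) has_vector_derivative g t / z t ^ n) (at t within {-\<epsilon>..\<epsilon>})" by simp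
    qed (use \<epsilon> in auto)
    then have J: "((\<lambda>t. g t / (of_real (r n) * cis t) ^ n) has_integral (\<i> * \<Psi> n (T \<epsilon>) - \<i> * \<Psi> n (T (- \<epsilon>)))) {-\<epsilon>..\<epsilon>}"
      by (simp add: z_def)
    have "norm (bridge_above_coeff d u1 v (r n) n h - (\<i> * \<Psi> n (T \<epsilon>) - \<i> * \<Psi> n (T (- \<epsilon>))) / (2 * of_real pi)) \<le> W / r n ^ n"
    proof (rule circle_integral_split[OF rn D(1) _ h \<epsilon>(1) eps_pi W _ _ J])
      show "D \<le> norm (1 - z * dphi u)" if "outer_root (r n) z u" for z u
        using elim(3) that by (simp add: D_def)
    qed (use near' far' in \<open>auto simp: z_def\<close>)
    also have "T (- \<epsilon>) = sp.endpoint (L n) e1" by (simp add: T_def sp.endpoint_def \<epsilon>_def)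
    also have "T \<epsilon> = cnj (sp.endpoint (L n) e1)"
      using T_props(4)[of "- \<epsilon>"] \<epsilon> by (simp add: T_def sp.endpoint_def \<epsilon>_def cnj_csqrt complex_cnj)
    also have "(\<i> * \<Psi> n (cnj (sp.endpoint (L n) e1)) - \<i> * \<Psi> n (sp.endpoint (L n) e1)) / (2 * of_real pi) =
        (\<Psi> n (sp.endpoint (L n) e1) - \<Psi> n (cnj (sp.endpoint (L n) e1))) / (2 * of_real pi * \<i>)"
      by (simp add: field_simps)
    finally have "norm (bridge_above_coeff d u1 v (r n) n h -
        (\<Psi> n (sp.endpoint (L n) e1) - \<Psi> n (cnj (sp.endpoint (L n) e1))) / (2 * of_real pi * \<i>)) \<le> W * (1 / r n ^ n)" by simp
    also have "W * (1 / r n ^ n) \<le> W * exp (2 * b)"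
    proof (rule mult_left_mono[OF _ W])
      have "1 / r n ^ n = exp (real n * L n)" unfolding exp_L[symmetric] exp_of_nat_mult[symmetric] by (simp add: exp_minus inverse_eq_divide)
      also have "real n * L n \<le> 2 * b" using elim(4,5) by (simp add: field_simps)
      finally show "1 / r n ^ n \<le> exp (2 * b)" by simp
    qed
    finally show ?case by (simp add: W_def D_def h_def)
  qed
  define \<kappa> where "\<kappa> = - (x * sg * ln \<omega>)"
  have \<kappa>: "\<kappa> > 0" using x sg_pos \<omega> by (simp add: \<kappa>_def mult_pos_neg)
  have poly_exp: "real n ^ m * exp (- \<kappa> * sqrt (real n)) \<le> fact (2 * m) / (\<kappa> / 2) ^ (2 * m) * exp (- (\<kappa> / 2) * sqrt (real n))" for n
  proof -
    have "(\<kappa> / 2 * sqrt (real n)) ^ (2 * m) \<le> fact (2 * m) * exp (\<kappa> / 2 * sqrt (real n))"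
      using \<kappa> by (intro power_le_fact_exp) auto
    moreover have "(\<kappa> / 2 * sqrt (real n)) ^ (2 * m) = (\<kappa> / 2) ^ (2 * m) * real n ^ m"
      unfolding power_mult_distrib by (simp add: power_mult)
    ultimately have "real n ^ m \<le> fact (2 * m) / (\<kappa> / 2) ^ (2 * m) * exp (\<kappa> / 2 * sqrt (real n))"
      using \<kappa> by (simp add: field_simps)
    then have "real n ^ m * exp (- \<kappa> * sqrt (real n)) \<le> fact (2 * m) / (\<kappa> / 2) ^ (2 * m) * exp (\<kappa> / 2 * sqrt (real n)) * exp (- \<kappa> * sqrt (real n))"
      by (intro mult_right_mono) auto
    also have "\<dots> = fact (2 * m) / (\<kappa> / 2) ^ (2 * m) * exp (\<kappa> / 2 * sqrt (real n) + - \<kappa> * sqrt (real n))"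
      by (simp only: exp_add mult.assoc)
    also have "\<kappa> / 2 * sqrt (real n) + - \<kappa> * sqrt (real n) = - (\<kappa> / 2) * sqrt (real n)" by (simp add: field_simps)
    finally show ?thesis .
  qed
  define K where "K = real d * exp (2 * b) / c * (fact (2 * m) / (\<kappa> / 2) ^ (2 * m))"
  have K0: "K \<ge> 0" using c \<kappa> by (simp add: K_def)
  have err': "eventually (\<lambda>n. norm ((bridge_above_coeff d u1 v (r n) n (x * sg * sqrt (real n))
      - (\<Psi> n (sp.endpoint (L n) e1) - \<Psi> n (cnj (sp.endpoint (L n) e1))) / (2 * of_real pi * \<i>))
        * of_real (sqrt (2 * pi * real n) * exp (2 * x ^ 2) / c1))
      \<le> K * exp (- (\<kappa> / 2) * sqrt (real n)) * (sqrt (2 * pi * real n) * exp (2 * x ^ 2) / c1)) sequentially"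
    using err
  proof eventually_elim
    case (elim n)
    have "\<omega> powr (x * sg * sqrt (real n)) = exp (- \<kappa> * sqrt (real n))"
      using \<omega> by (simp add: powr_def \<kappa>_def mult_ac)
    then have "real d * (\<omega> powr (x * sg * sqrt (real n)) * (real n ^ m / c)) * exp (2 * b)
       = real d * exp (2 * b) / c * (real n ^ m * exp (- \<kappa> * sqrt (real n)))" by simp
    also have "\<dots> \<le> real d * exp (2 * b) / c * (fact (2 * m) / (\<kappa> / 2) ^ (2 * m) * exp (- (\<kappa> / 2) * sqrt (real n)))"
      using c by (intro mult_left_mono poly_exp) auto
    also have "\<dots> = K * exp (- (\<kappa> / 2) * sqrt (real n))" by (simp add: K_def)
    finally have "norm (bridge_above_coeff d u1 v (r n) n (x * sg * sqrt (real n))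
      - (\<Psi> n (sp.endpoint (L n) e1) - \<Psi> n (cnj (sp.endpoint (L n) e1))) / (2 * of_real pi * \<i>)) \<le> K * exp (- (\<kappa> / 2) * sqrt (real n))"
      using elim by simp
    moreover have "norm (complex_of_real (sqrt (2 * pi * real n) * exp (2 * x ^ 2) / c1)) = sqrt (2 * pi * real n) * exp (2 * x ^ 2) / c1"
      using c1 by (simp only: norm_of_real) (simp add: abs_mult)
    ultimately show ?case unfolding norm_mult using c1 K0 by (intro mult_mono) auto
  qed
  have "(\<lambda>n. K * exp (- (\<kappa> / 2) * sqrt (real n)) * (sqrt (2 * pi * real n) * exp (2 * x ^ 2) / c1)) \<in> O(\<lambda>n. real n powr (- 3 / 2))"
  proof -
    have "(\<lambda>n. exp (- (\<kappa> / 2) * sqrt (real n)) * sqrt (real n)) \<in> O(\<lambda>n. real n powr (- 3 / 2))"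
      using \<kappa> by real_asymp
    then have "(\<lambda>n. k * (exp (- (\<kappa> / 2) * sqrt (real n)) * sqrt (real n))) \<in> O(\<lambda>n. real n powr (- 3 / 2))" for k
      by (cases "k = 0") (simp, subst landau_o.big.cmult_in_iff, simp_all)
    from this[of "K * (sqrt (2 * pi) * exp (2 * x ^ 2) / c1)"] show ?thesis
      by (simp add: real_sqrt_mult mult_ac)
  qed
  from sum_in_bigo(1)[OF bigo_of_real_bound[OF err' this] main]
  show ?thesis by (simp add: algebra_simps diff_divide_distrib)
qed

end

section \<open>The generating function for integer heights\<close>

text \<open>The interpolation formula of Lagrange, read off at the highest coefficient.\<close>

lemma lagrange_leading_coeff:
  fixes rho :: "'a \<Rightarrow> complex" and q :: "complex poly"
  assumes I: "finite I" "card I = Suc N" and inj: "inj_on rho I" and q: "degree q \<le> N"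
  shows "(\<Sum>i\<in>I. poly q (rho i) / (\<Prod>j\<in>I-{i}. rho i - rho j)) = coeff q N"
proof -
  define c where "c = (\<lambda>i. poly q (rho i) / (\<Prod>j\<in>I-{i}. rho i - rho j))"
  define B where "B = (\<lambda>i. \<Prod>j\<in>I-{i}. [:- rho j, 1:])"
  define D where "D = q - (\<Sum>i\<in>I. smult (c i) (B i))"
  have deg_B: "degree (B i) = N" if "i \<in> I" for i
    unfolding B_def using I that by (subst degree_prod_eq_sum_degree) (auto simp: card_Diff_singleton)
  have lead_B: "coeff (B i) N = 1" if "i \<in> I" for i
  proof -
    have "lead_coeff (B i) = 1" unfolding B_def by (simp add: lead_coeff_prod)
    then show ?thesis using deg_B[OF that] by simp
  qed
  have deg_D: "degree D \<le> N"
    unfolding D_def using q deg_B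
    by (intro degree_diff_le degree_sum_le I(1)) (auto intro: order_trans[OF degree_smult_le])
  have root: "poly D (rho k) = 0" if k: "k \<in> I" for k
  proof -
    have "poly (B i) (rho k) = 0" if "i \<in> I - {k}" for i
      unfolding B_def poly_prod using that k I(1) by (intro prod_zero) auto
    then have "(\<Sum>i\<in>I. c i * poly (B i) (rho k)) = c k * poly (B k) (rho k)"
      using k I(1) by (subst sum.remove[of _ k]) auto
    moreover have "poly (B k) (rho k) = (\<Prod>j\<in>I-{k}. rho k - rho j)"
      by (simp add: B_def poly_prod)
    moreover have "(\<Prod>j\<in>I-{k}. rho k - rho j) \<noteq> 0"
      using I(1) inj k by (auto simp: inj_on_def)
    ultimately show ?thesis by (simp add: D_def poly_sum c_def)
  qed
  have "D = 0"
  proof (rule ccontr)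
    assume "D \<noteq> 0"
    have "card (rho ` I) \<le> card {x. poly D x = 0}"
      using root by (intro card_mono poly_roots_finite[OF \<open>D \<noteq> 0\<close>]) auto
    also have "\<dots> \<le> degree D" by (rule card_poly_roots_bound[OF \<open>D \<noteq> 0\<close>])
    finally show False using deg_D I(2) card_image[OF inj] by simp
  qed
  then have "coeff q N = (\<Sum>i\<in>I. c i * coeff (B i) N)"
    by (simp add: D_def coeff_sum)
  also have "\<dots> = (\<Sum>i\<in>I. c i)" using lead_B by simp
  finally show ?thesis by (simp add: c_def)
qed

context lukasiewicz
begin

text \<open>The iterates of the contraction u \<mapsto> z phi(u) are polynomials in z and
  converge uniformly on every smaller disc.\<close>

lemma small_root_exists: "\<exists>u1. small_root d p u1"
proof -
  define g where "g = (\<lambda>n z. ((\<lambda>u. z * poly phi u) ^^ n) (0::complex))"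
  have g0: "g 0 z = 0" and gS: "g (Suc n) z = z * poly phi (g n z)" for n z by (simp_all add: g_def)
  have g_le: "norm (g n z) \<le> 1" if "norm z \<le> 1" for n z
  proof (induction n)
    case (Suc n)
    have "norm (g (Suc n) z) \<le> 1 * 1" unfolding gS norm_mult
      using that norm_phi_le[OF Suc.IH] by (intro mult_mono) auto
    then show ?case by simp
  qed (simp add: g0)
  have g_diff: "norm (g (Suc n) z - g n z) \<le> norm z ^ n" if z: "norm z \<le> 1" for n z
  proof (induction n)
    case 0 show ?case using g_le[OF z, of "Suc 0"] by (simp add: g0)
  next
    case (Suc n)
    have "norm (g (Suc (Suc n)) z - g (Suc n) z) = norm z * norm (poly phi (g (Suc n) z) - poly phi (g n z))"
      by (simp only: gS right_diff_distrib[symmetric] norm_mult)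
    also have "\<dots> \<le> norm z * norm (g (Suc n) z - g n z)"
      by (intro mult_left_mono phi_nonexpansive g_le z) auto
    also have "\<dots> \<le> norm z * norm z ^ n" by (intro mult_left_mono Suc.IH) auto
    finally show ?case by simp
  qed
  have g_hol: "g n holomorphic_on A" for n A
  proof (induction n)
    case 0 show ?case by (simp add: g0[abs_def])
  next
    case (Suc n)
    have "g (Suc n) = (\<lambda>z. z * poly phi (g n z))" by (simp add: gS fun_eq_iff)
    then show ?case using Suc.IH by (auto intro!: holomorphic_intros)
  qed
  define u1 where "u1 = (\<lambda>z. \<Sum>k. g (Suc k) z - g k z)"
  have unif: "uniform_limit (cball 0 r) g u1 sequentially" if r: "0 \<le> r" "r < 1" for r
  proof -
    have "uniform_limit (cball 0 r) (\<lambda>n z. \<Sum>k<n. g (Suc k) z - g k z) u1 sequentially"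
      unfolding u1_def
    proof (rule Weierstrass_m_test)
      show "summable (\<lambda>k. r ^ k)" using r by (intro summable_geometric) auto
      fix n and z :: complex assume z: "z \<in> cball 0 r"
      then have "norm (g (Suc n) z - g n z) \<le> norm z ^ n" using r by (intro g_diff) auto
      also have "\<dots> \<le> r ^ n" using z by (intro power_mono) auto
      finally show "norm (g (Suc n) z - g n z) \<le> r ^ n" .
    qed
    moreover have "(\<Sum>k<n. g (Suc k) z - g k z) = g n z" for n z
      using sum_lessThan_telescope[of "\<lambda>k. g k z" n] by (simp add: g0)
    ultimately show ?thesis by simp
  qed
  have lim: "(\<lambda>n. g n z) \<longlonglongrightarrow> u1 z" if "norm z < 1" for z
    by (rule tendsto_uniform_limitI[OF unif[of "norm z"]]) (use that in auto)
  have hol: "u1 holomorphic_on ball 0 1"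
  proof (rule holomorphic_uniform_sequence[of "ball 0 1" g])
    fix z :: complex assume z: "z \<in> ball 0 1"
    define e where "e = (1 - norm z) / 2"
    have e: "e > 0" "norm z + e < 1" using z by (auto simp: e_def field_simps)
    have sub: "cball z e \<subseteq> cball 0 (norm z + e)"
    proof
      fix w assume "w \<in> cball z e"
      then show "w \<in> cball 0 (norm z + e)"
        using norm_triangle_ineq[of z "w - z"] by (simp add: dist_norm norm_minus_commute)
    qed
    have "uniform_limit (cball z e) g u1 sequentially"
      by (rule uniform_limit_on_subset[OF unif[of "norm z + e"] sub]) (use e in auto)
    moreover have "cball z e \<subseteq> ball 0 1"
      using sub e by (auto simp: subset_iff)
    ultimately show "\<exists>e>0. cball z e \<subseteq> ball 0 1 \<and> uniform_limit (cball z e) g u1 sequentially"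
      using e(1) by blast
  qed (auto intro: g_hol)
  have fixp: "u1 z = z * poly phi (u1 z)" if "norm z < 1" for z
  proof -
    have "(\<lambda>n. z * poly phi (g n z)) \<longlonglongrightarrow> z * poly phi (u1 z)"
      by (intro tendsto_intros lim that)
    then have "(\<lambda>n. g (Suc n) z) \<longlonglongrightarrow> z * poly phi (u1 z)" by (simp only: gS)
    moreover have "(\<lambda>n. g (Suc n) z) \<longlonglongrightarrow> u1 z" by (rule LIMSEQ_Suc[OF lim[OF that]])
    ultimately show ?thesis using LIMSEQ_unique by blast
  qed
  have nz: "u1 z \<noteq> 0" if "0 < norm z" "norm z < 1" for z
  proof
    assume "u1 z = 0"
    then have "0 = z * poly phi 0" using fixp[OF that(2)] by simp
    then show False using that(1) p_first by (simp add: phi_0)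
  qed
  have "u1 0 = 0" using fixp[of 0] by simp
  moreover have "isCont u1 0"
    using hol by (meson centre_in_ball holomorphic_on_imp_continuous_on continuous_on_eq_continuous_at open_ball zero_less_one)
  ultimately have "(u1 \<longlongrightarrow> 0) (at 0)" by (simp add: isCont_def)
  then have "small_root d p u1"
    unfolding small_root_def using hol nz fixp zP_iff by blast
  then show ?thesis by blast
qed

text \<open>If |v| \<le> R with R \<ge> 1, then 1 = |z P(v)| \<le> |z| R^d, so large roots are
  large when z is small.\<close>

lemma large_roots_exist:
  assumes small: "small_root d p u1"
  shows "\<exists>v. large_roots d p u1 v"
proof -
  have ex: "\<exists>w. \<forall>u. u \<noteq> 0 \<longrightarrow> 1 - z * char_P d p u =
      - (z * of_real (p (int d)) / u) * (u - u1 z) * (\<Prod>k=1..d. u - w k)"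
    if z: "0 < norm z" "norm z < 1" for z
  proof -
    have z0: "z \<noteq> 0" using z by auto
    have f0: "fz z \<noteq> 0" using degree_fz[OF z0] by auto
    obtain A where A: "size A = degree (fz z)" "fz z = smult (lead_coeff (fz z)) (\<Prod>x\<in>#A. [:-x, 1:])"
      using alg_closed_imp_factorization[OF f0] by blast
    have "u1 z \<noteq> 0 \<and> 1 - z * char_P d p (u1 z) = 0" using small z unfolding small_root_def by blast
    then have root0: "poly (fz z) (u1 z) = 0" using zP_iff[of "u1 z" z] by (simp add: poly_fz)
    have polyA: "poly (fz z) u = lead_coeff (fz z) * (\<Prod>x\<in>#A. u - x)" for u
      using arg_cong[OF A(2), of "\<lambda>q. poly q u"]
      by (simp only: poly_smult poly_prod_mset image_mset.compositionality o_def) simp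
    have "(\<Prod>x\<in>#A. u1 z - x) = 0"
      using root0 f0 unfolding polyA by (simp only: mult_eq_0_iff leading_coeff_0_iff) simp
    then have "0 \<in># image_mset (\<lambda>x. u1 z - x) A" by (simp only: prod_mset_zero_iff)
    then have "u1 z \<in># A" by auto
    from multi_member_split[OF this] obtain A' where A': "A = add_mset (u1 z) A'" by blast
    obtain xs where xs: "mset xs = A'" using ex_mset by blast
    have len: "length xs = d" using A(1) A' degree_fz[OF z0] xs by (metis Suc_eq_plus1 diff_Suc_1 size_add_mset size_mset)
    have pr: "(\<Prod>x\<in>#A'. f x) = (\<Prod>k=1..d. f (xs ! (k - 1)))" for f :: "complex \<Rightarrow> complex"
    proof -
      have "(\<Prod>x\<in>#A'. f x) = prod_list (map f xs)"
        by (simp add: xs[symmetric] prod_mset_prod_list flip: mset_map)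
      also have "\<dots> = (\<Prod>i=0..<d. f (xs ! i))" by (simp add: prod.list_conv_set_nth len)
      also have "\<dots> = (\<Prod>k=1..d. f (xs ! (k - 1)))"
        by (rule prod.reindex_bij_witness[of _ "\<lambda>k. k - 1" Suc]) auto
      finally show ?thesis .
    qed
    have "1 - z * char_P d p u = - (z * of_real (p (int d)) / u) * (u - u1 z) * (\<Prod>k=1..d. u - xs ! (k - 1))"
      if u: "u \<noteq> 0" for u
    proof -
      have "u - z * poly phi u = poly (fz z) u" by (simp add: poly_fz)
      also have "\<dots> = - z * of_real (p (int d)) * ((u - u1 z) * (\<Prod>x\<in>#A'. u - x))"
        unfolding polyA lead_coeff_fz[OF z0] A' by simp
      finally have e: "u - z * poly phi u = - z * of_real (p (int d)) * ((u - u1 z) * (\<Prod>k=1..d. u - xs ! (k - 1)))"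
        unfolding pr .
      have "1 - z * char_P d p u = (u - z * poly phi u) / u" using u by (simp add: char_P_eq diff_divide_distrib)
      then show ?thesis unfolding e by simp
    qed
    then show ?thesis by (intro exI[of _ "\<lambda>k. xs ! (k - 1)"]) blast
  qed
  define v where "v = (\<lambda>k z. (SOME w. \<forall>u. u \<noteq> 0 \<longrightarrow> 1 - z * char_P d p u =
      - (z * of_real (p (int d)) / u) * (u - u1 z) * (\<Prod>k=1..d. u - w k)) k)"
  have v: "1 - z * char_P d p u = - (z * of_real (p (int d)) / u) * (u - u1 z) * (\<Prod>k=1..d. u - v k z)"
    if "0 < norm z" "norm z < 1" "u \<noteq> 0" for z u
    using someI_ex[OF ex[OF that(1,2)]] that(3) unfolding v_def by blast
  interpret lukasiewicz_roots d p u1 v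
    by unfold_locales (use small v in auto)
  have "filterlim (v k) at_infinity (at 0)" if k: "k \<in> {1..d}" for k
    unfolding filterlim_at_infinity[OF order_refl]
  proof (intro allI impI)
    fix R :: real assume "R > 0"
    define R' where "R' = max 1 R"
    have R': "R' \<ge> 1" "R' \<ge> R" by (auto simp: R'_def)
    have "R \<le> norm (v k z)" if z: "z \<noteq> 0" "norm z < 1 / R' ^ d" for z
    proof (rule ccontr)
      assume "\<not> R \<le> norm (v k z)"
      then have lt: "norm (v k z) \<le> R'" using R' by simp
      have "1 / R' ^ d \<le> 1" using R' by simp
      then have nz: "0 < norm z" "norm z < 1" using z by auto
      have v1: "norm (v k z) > 1" by (rule norm_v[OF nz k])
      have "norm (poly phi (v k z)) \<le> (\<Sum>j\<le>d+1. p (int j - 1) * norm (v k z) ^ (d + 1))"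
        unfolding poly_phi
      proof (intro order_trans[OF norm_sum] sum_mono)
        fix j assume j: "j \<in> {..d+1}"
        have "norm (v k z) ^ j \<le> norm (v k z) ^ (d + 1)" using j v1 by (intro power_increasing) auto
        then show "norm (of_real (p (int j - 1)) * v k z ^ j) \<le> p (int j - 1) * norm (v k z) ^ (d + 1)"
          using weight_nonneg[of j] j unfolding norm_mult norm_power norm_of_real
          by (simp only: abs_of_nonneg atMost_iff mult_left_mono)
      qed
      also have "\<dots> = norm (v k z) ^ (d + 1)" by (simp only: sum_distrib_right[symmetric] sum_p mult_1)
      finally have "norm z * norm (poly phi (v k z)) \<le> norm z * norm (v k z) ^ (d + 1)"
        by (intro mult_left_mono) auto
      then have "norm (v k z) \<le> norm z * norm (v k z) ^ (d + 1)"
        using v_root[OF nz k] by (metis norm_mult)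
      then have "norm (v k z) * 1 \<le> norm (v k z) * (norm z * norm (v k z) ^ d)" by (simp add: mult_ac)
      then have "1 \<le> norm z * norm (v k z) ^ d" by (rule mult_left_le_imp_le) (use v1 in linarith)
      also have "\<dots> \<le> norm z * R' ^ d" using lt by (intro mult_left_mono power_mono) auto
      also have "\<dots> < 1" using z(2) R' by (simp add: field_simps)
      finally show False by simp
    qed
    then show "eventually (\<lambda>z. R \<le> norm (v k z)) (at 0)"
      unfolding eventually_at using R' by (intro exI[of _ "1 / R' ^ d"]) (auto simp: dist_norm)
  qed
  then show ?thesis using v unfolding large_roots_def by blast
qed



text \<open>The probability that a walk started at s is at 0 after n steps, by first-step
  decomposition.\<close>

primrec ret :: "nat \<Rightarrow> int \<Rightarrow> real" where
  "ret 0 s = (if s = 0 then 1 else 0)"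
| "ret (Suc n) s = (\<Sum>i\<in>{-1..int d}. p i * ret n (s + i))"

text \<open>The same for walks that are at a or above at some time; once they are, only the
  return matters.\<close>

primrec hit :: "int \<Rightarrow> nat \<Rightarrow> int \<Rightarrow> real" where
  "hit a 0 s = (if s \<ge> a then ret 0 s else 0)"
| "hit a (Suc n) s = (if s \<ge> a then ret (Suc n) s else (\<Sum>i\<in>{-1..int d}. p i * hit a n (s + i)))"

lemma sum_p_int: "(\<Sum>i\<in>{-1..int d}. p i) = 1"
  using sum_p by (simp only: sum_jumps)

lemma ret_bounds: "0 \<le> ret n s \<and> ret n s \<le> 1"
proof (induction n arbitrary: s)
  case (Suc n)
  have "(\<Sum>i\<in>{-1..int d}. p i * ret n (s + i)) \<le> (\<Sum>i\<in>{-1..int d}. p i)"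
    using Suc.IH p_nonneg by (intro sum_mono) (auto intro: mult_left_le)
  moreover have "0 \<le> (\<Sum>i\<in>{-1..int d}. p i * ret n (s + i))"
    using Suc.IH p_nonneg by (intro sum_nonneg) auto
  ultimately show ?case by (simp add: sum_p_int)
qed auto

lemma hit_bounds: "0 \<le> hit a n s \<and> hit a n s \<le> 1"
proof (induction n arbitrary: s)
  case 0 show ?case using ret_bounds[of 0 s] by auto
next
  case (Suc n)
  have "(\<Sum>i\<in>{-1..int d}. p i * hit a n (s + i)) \<le> (\<Sum>i\<in>{-1..int d}. p i)"
    using Suc.IH p_nonneg by (intro sum_mono) (auto intro: mult_left_le)
  moreover have "0 \<le> (\<Sum>i\<in>{-1..int d}. p i * hit a n (s + i))"
    using Suc.IH p_nonneg by (intro sum_nonneg) auto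
  ultimately show ?case using ret_bounds[of "Suc n" s] by (simp add: sum_p_int)
qed

definition ret_gf :: "int \<Rightarrow> complex \<Rightarrow> complex" where
  "ret_gf s z = (\<Sum>n. of_real (ret n s) * z ^ n)"

definition hit_gf :: "int \<Rightarrow> int \<Rightarrow> complex \<Rightarrow> complex" where
  "hit_gf a s z = (\<Sum>n. of_real (hit a n s) * z ^ n)"

lemma bounded_gf:
  fixes f :: "nat \<Rightarrow> real" and z :: complex
  assumes f: "\<And>n. 0 \<le> f n \<and> f n \<le> 1" and z: "norm z < 1"
  shows "summable (\<lambda>n. of_real (f n) * z ^ n)"
    and "norm (\<Sum>n. of_real (f n) * z ^ n) \<le> 1 / (1 - norm z)"
proof -
  have g: "summable (\<lambda>n. norm z ^ n)" using z by (intro summable_geometric) auto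
  have le: "norm (of_real (f n) * z ^ n) \<le> norm z ^ n" for n
    using f[of n] by (auto simp: norm_mult norm_power intro!: mult_left_le_one_le)
  then show "summable (\<lambda>n. of_real (f n) * z ^ n)" by (intro summable_comparison_test'[OF g]) auto
  have "norm (\<Sum>n. of_real (f n) * z ^ n) \<le> (\<Sum>n. norm z ^ n)"
    by (rule norm_suminf_le[OF le g])
  then show "norm (\<Sum>n. of_real (f n) * z ^ n) \<le> 1 / (1 - norm z)"
    using suminf_geometric[of "norm z"] z by simp
qed

lemma gf_Suc:
  fixes f g :: "nat \<Rightarrow> int \<Rightarrow> real" and z :: complex
  assumes "\<And>n s. 0 \<le> g n s \<and> g n s \<le> 1" and z: "norm z < 1"
    and f0: "f 0 s = c" and fS: "\<And>n. f (Suc n) s = (\<Sum>i\<in>{-1..int d}. p i * g n (s + i))"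
    and sf: "summable (\<lambda>n. of_real (f n s) * z ^ n)"
  shows "(\<Sum>n. of_real (f n s) * z ^ n) =
    of_real c + z * (\<Sum>i\<in>{-1..int d}. of_real (p i) * (\<Sum>n. of_real (g n (s + i)) * z ^ n))"
proof -
  have sg: "summable (\<lambda>n. of_real (g n (s + i)) * z ^ n)" for i
    using assms(1) z by (rule bounded_gf(1))
  have "(\<Sum>n. of_real (f n s) * z ^ n) = of_real (f 0 s) + (\<Sum>n. of_real (f (Suc n) s) * z ^ Suc n)"
    using suminf_split_head[OF sf] by simp
  also have "(\<lambda>n. of_real (f (Suc n) s) * z ^ Suc n) =
      (\<lambda>n. z * (\<Sum>i\<in>{-1..int d}. of_real (p i) * (of_real (g n (s + i)) * z ^ n)))"
    by (simp add: fS fun_eq_iff sum_distrib_left sum_distrib_right mult_ac)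
  also have "(\<Sum>n. z * (\<Sum>i\<in>{-1..int d}. of_real (p i) * (of_real (g n (s + i)) * z ^ n)))
     = z * (\<Sum>i\<in>{-1..int d}. of_real (p i) * (\<Sum>n. of_real (g n (s + i)) * z ^ n))"
    by (subst suminf_mult, intro summable_sum summable_mult sg)
       (subst suminf_sum, intro summable_mult sg, simp add: suminf_mult[OF sg])
  finally show ?thesis by (simp add: f0)
qed

lemma ret_gf_eq: "norm z < 1 \<Longrightarrow> ret_gf s z = of_real (if s = 0 then 1 else 0) + z * (\<Sum>i\<in>{-1..int d}. of_real (p i) * ret_gf (s + i) z)"
  unfolding ret_gf_def using ret_bounds by (intro gf_Suc bounded_gf(1)) auto

lemma hit_gf_above: "s \<ge> a \<Longrightarrow> hit_gf a s z = ret_gf s z"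
proof -
  assume "s \<ge> a"
  then have "hit a n s = ret n s" for n by (cases n) auto
  then show ?thesis by (simp add: hit_gf_def ret_gf_def)
qed

lemma hit_gf_below: "norm z < 1 \<Longrightarrow> s < a \<Longrightarrow> hit_gf a s z = z * (\<Sum>i\<in>{-1..int d}. of_real (p i) * hit_gf a (s + i) z)"
  unfolding hit_gf_def using hit_bounds gf_Suc[of "hit a" z "hit a" s 0] bounded_gf(1)[of "\<lambda>n. hit a n s" z] by simp

text \<open>A bounded solution of the homogeneous recursion is at most |z| times its own bound,
  because the weights sum to 1.\<close>

lemma bounded_harmonic_zero:
  fixes e :: "int \<Rightarrow> complex"
  assumes z: "norm z < 1" and B: "\<And>s. norm (e s) \<le> B"
    and e: "\<And>s. e s = 0 \<or> e s = z * (\<Sum>i\<in>{-1..int d}. of_real (p i) * e (s + i))"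
  shows "e s = 0"
proof -
  have B0: "B \<ge> 0" using B[of 0] norm_ge_zero order_trans by blast
  have le: "norm (e s) \<le> norm z ^ n * B" for n s
  proof (induction n arbitrary: s)
    case (Suc n)
    show ?case
    proof (cases "e s = 0")
      case False
      then have "norm (e s) = norm z * norm (\<Sum>i\<in>{-1..int d}. of_real (p i) * e (s + i))"
        using e[of s] by (metis norm_mult)
      also have "norm (\<Sum>i\<in>{-1..int d}. of_real (p i) * e (s + i)) \<le> (\<Sum>i\<in>{-1..int d}. p i * (norm z ^ n * B))"
        using p_nonneg Suc.IH by (intro order_trans[OF norm_sum] sum_mono) (auto simp: norm_mult intro!: mult_left_mono)
      also have "\<dots> = norm z ^ n * B" by (simp only: sum_distrib_right[symmetric] sum_p_int mult_1)
      finally show ?thesis by (simp add: mult_left_mono mult.assoc)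
    qed (use B0 in auto)
  qed (use B in auto)
  have "(\<lambda>n. norm z ^ n * B) \<longlonglongrightarrow> 0 * B"
    using z by (intro tendsto_intros LIMSEQ_power_zero) auto
  then have "norm (e s) \<le> 0" by (intro LIMSEQ_le_const) (use le in auto)
  then show ?thesis by simp
qed

end

context lukasiewicz_roots
begin

text \<open>The functions s \<mapsto> rho^s, for rho a root, solve the homogeneous recursion.
  Bounded solutions may use u1^s for s \<ge> 0 and the v_k^s for s < 0, and by the Lagrange
  identity the two halves fit together at the boundary with the right inhomogeneity at s = 0.
  For the walks that reach a, descending steps of size 1 make the factor u1^a appear.\<close>

lemma hit_gf_eq_gen_fun:
  assumes z: "0 < norm z" "norm z < 1" and simple: "\<And>k. k \<in> {1..d} \<Longrightarrow> 1 - z * dphi (v k z) \<noteq> 0"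
  shows "hit_gf (int h + 1) 0 z = gen_fun d u1 v (real h) z"
proof -
  define a where "a = int h + 1"
  define rho where "rho = (\<lambda>k. if k = 0 then u1 z else v k z)"
  define w where "w = (\<lambda>k. 1 - z * dphi (rho k))"
  have z0: "z \<noteq> 0" using z by auto
  have rho0: "rho 0 = u1 z" and rhok: "k \<in> {1..d} \<Longrightarrow> rho k = v k z" for k by (auto simp: rho_def)
  have split: "(\<Sum>k\<in>{0..d}. f k) = f 0 + (\<Sum>k=1..d. f k)" for f :: "nat \<Rightarrow> complex"
    using sum.atLeast_Suc_atMost[of 0 d f] by simp
  have root: "rho k = z * poly phi (rho k)" if "k \<in> {0..d}" for k
    using that u1_root[OF z(2)] v_root[OF z, of k] by (cases "k = 0") (auto simp: rho_def)
  have rho_nz: "rho k \<noteq> 0" if "k \<in> {0..d}" for k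
    using that u1_nonzero[OF z] v_nonzero[OF z, of k] by (cases "k = 0") (auto simp: rho_def)
  have w_nz: "w k \<noteq> 0" if "k \<in> {0..d}" for k
    using that root_in_disc_simple[OF z(2), of "u1 z"] norm_u1[OF z(2)] simple[of k]
    by (cases "k = 0") (auto simp: rho_def w_def)
  let ?c = "- z * of_real (p (int d))"
  have c: "?c \<noteq> 0" using z0 p_last by auto
  have w_prod: "w k = ?c * (\<Prod>j\<in>{0..d}-{k}. rho k - rho j)" if k: "k \<in> {0..d}" for k
  proof (cases "k = 0")
    case True
    have "{0..d} - {0} = {1..d}" by auto
    then show ?thesis using deriv_fz_u1[OF z] True by (auto simp: w_def rho_def intro!: prod.cong)
  next
    case False
    then have k1: "k \<in> {1..d}" using k by auto
    have "{0..d} - {k} = insert 0 ({1..d} - {k})" using k1 by auto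
    moreover have "(\<Prod>j\<in>{1..d}-{k}. rho k - rho j) = (\<Prod>j\<in>{1..d}-{k}. v k z - v j z)"
      using k1 by (intro prod.cong) (auto simp: rho_def)
    ultimately show ?thesis using deriv_fz_v[OF z k1] rhok[OF k1] rho0 by (simp add: w_def mult_ac)
  qed
  have inj: "inj_on rho {0..d}"
  proof (rule inj_onI, rule ccontr)
    fix k m assume km: "k \<in> {0..d}" "m \<in> {0..d}" "rho k = rho m" "k \<noteq> m"
    then have "(\<Prod>j\<in>{0..d}-{k}. rho k - rho j) = 0" by (intro prod_zero bexI[of _ m]) auto
    then show False using w_prod[OF km(1)] w_nz[OF km(1)] by simp
  qed
  have lag: "(\<Sum>k\<in>{0..d}. poly q (rho k) / w k) = coeff q d / ?c" if "degree q \<le> d" for q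
  proof -
    have "(\<Sum>k\<in>{0..d}. poly q (rho k) / w k) = (\<Sum>k\<in>{0..d}. poly q (rho k) / (\<Prod>j\<in>{0..d}-{k}. rho k - rho j)) / ?c"
      unfolding sum_divide_distrib by (intro sum.cong refl) (simp add: w_prod)
    then show ?thesis using lagrange_leading_coeff[OF _ _ inj that] by simp
  qed
  define Et where "Et = (\<lambda>s::int. \<Sum>k\<in>{0..d}. rho k powi s / w k)"
  define Ut where "Ut = (\<lambda>s::int. u1 z powi s / w 0)"
  have hom: "rho k powi s / w k = z * (\<Sum>i\<in>{-1..int d}. of_real (p i) * (rho k powi (s + i) / w k))"
    if k: "k \<in> {0..d}" for k s
  proof -
    have "1 = z * char_P d p (rho k)" using zP_iff[OF rho_nz[OF k], of z] root[OF k] by simp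
    then have "rho k powi s / w k = (z * char_P d p (rho k)) * (rho k powi s / w k)" by simp
    also have "\<dots> = z * (\<Sum>i\<in>{-1..int d}. of_real (p i) * (rho k powi (s + i) / w k))"
      unfolding char_P_def sum_distrib_left sum_distrib_right
      by (intro sum.cong refl) (simp add: power_int_add[OF disjI1[OF rho_nz[OF k]]] mult_ac)
    finally show ?thesis .
  qed
  have Ut_hom: "Ut s = z * (\<Sum>i\<in>{-1..int d}. of_real (p i) * Ut (s + i))" for s
    using hom[of 0 s] by (simp add: Ut_def rho0)
  have Et_hom: "Et s = z * (\<Sum>i\<in>{-1..int d}. of_real (p i) * Et (s + i))" for s
  proof -
    have "Et s = (\<Sum>k\<in>{0..d}. z * (\<Sum>i\<in>{-1..int d}. of_real (p i) * (rho k powi (s + i) / w k)))"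
      unfolding Et_def by (intro sum.cong refl hom)
    also have "\<dots> = z * (\<Sum>k\<in>{0..d}. \<Sum>i\<in>{-1..int d}. of_real (p i) * (rho k powi (s + i) / w k))"
      by (simp only: sum_distrib_left)
    also have "(\<Sum>k\<in>{0..d}. \<Sum>i\<in>{-1..int d}. of_real (p i) * (rho k powi (s + i) / w k)) =
        (\<Sum>i\<in>{-1..int d}. of_real (p i) * Et (s + i))"
      unfolding Et_def sum_distrib_left by (rule sum.swap)
    finally show ?thesis .
  qed
  have Et_0: "Et s = 0" if "0 \<le> s" "s < int d" for s
  proof -
    have "Et s = (\<Sum>k\<in>{0..d}. poly (monom 1 (nat s)) (rho k) / w k)"
      using that by (simp add: Et_def poly_monom power_int_def)
    also have "\<dots> = coeff (monom 1 (nat s)) d / ?c"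
      using that by (intro lag) (simp add: degree_monom_eq)
    finally show ?thesis using that by (simp add: nat_less_iff)
  qed
  have Et_m1: "z * of_real (p (-1)) * Et (-1) = 1"
  proof -
    \<comment> \<open>the value at -1 is the residue at 0, computed by dividing out the constant coefficient\<close>
    obtain g where g: "fz z = pCons (- z * of_real (p (-1))) g"
      by (cases "fz z") (use poly_fz[of z 0] phi_0 in auto)
    have deg_g: "degree g \<le> d" using degree_fz[OF z0] g by (cases "g = 0") auto
    have cg: "coeff g d = ?c" using lead_coeff_fz[OF z0] degree_fz[OF z0] by (simp add: g)
    have "poly g (rho k) = z * of_real (p (-1)) * rho k powi (-1)" if k: "k \<in> {0..d}" for k
    proof -
      have "0 = poly (fz z) (rho k)" using root[OF k] by (simp add: poly_fz)
      then have "rho k * poly g (rho k) = z * of_real (p (-1))" by (simp add: g)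
      then show ?thesis using rho_nz[OF k] by (simp add: power_int_minus field_simps)
    qed
    then have "z * of_real (p (-1)) * Et (-1) = (\<Sum>k\<in>{0..d}. poly g (rho k) / w k)"
      by (simp add: Et_def sum_distrib_left)
    also have "\<dots> = 1" using lag[OF deg_g] cg c by simp
    finally show ?thesis .
  qed
  \<comment> \<open>the bounded solution: powers of u1 to the right of 0, of the large roots to the left\<close>
  define cand where "cand = (\<lambda>s. Ut s - (if s < 0 then Et s else 0))"
  have cand_neg: "cand s = - (\<Sum>k=1..d. v k z powi s / w k)" if "s < 0" for s
    using that by (simp add: cand_def Ut_def Et_def split rho0 rhok)
  have cand_rec: "cand s = of_real (if s = 0 then 1 else 0) + z * (\<Sum>i\<in>{-1..int d}. of_real (p i) * cand (s + i))" for s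
  proof -
    have dist: "(\<Sum>i\<in>{-1..int d}. of_real (p i) * cand (s + i)) = (\<Sum>i\<in>{-1..int d}. of_real (p i) * Ut (s + i))
        - (\<Sum>i\<in>{-1..int d}. of_real (p i) * (if s + i < 0 then Et (s + i) else 0))"
      by (simp add: cand_def right_diff_distrib sum_subtractf)
    show ?thesis
    proof (cases "s < 0")
      case True
      have "(\<Sum>i\<in>{-1..int d}. of_real (p i) * (if s + i < 0 then Et (s + i) else 0)) = (\<Sum>i\<in>{-1..int d}. of_real (p i) * Et (s + i))"
        using True Et_0 by (intro sum.cong) auto
      then show ?thesis using True Ut_hom[of s] Et_hom[of s] unfolding dist
        by (simp add: cand_def right_diff_distrib)
    next
      case False
      have "(\<Sum>i\<in>{-1..int d}. of_real (p i) * (if s + i < 0 then Et (s + i) else 0))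
         = (\<Sum>i\<in>{-1..int d}. if i = -1 then (if s = 0 then of_real (p (-1)) * Et (-1) else 0) else 0)"
        using False by (intro sum.cong) auto
      also have "\<dots> = (if s = 0 then of_real (p (-1)) * Et (-1) else 0)" by simp
      finally show ?thesis using False Ut_hom[of s] Et_m1 unfolding dist
        by (auto simp: cand_def right_diff_distrib mult.assoc)
    qed
  qed
  define B0 where "B0 = 1 / norm (w 0) + (\<Sum>k=1..d. 1 / norm (w k))"
  have cand_bound: "norm (cand s) \<le> B0" for s
  proof (cases "s < 0")
    case True
    have "norm (cand s) \<le> (\<Sum>k=1..d. norm (v k z powi s / w k))"
      unfolding cand_neg[OF True] norm_minus_cancel by (rule norm_sum)
    also have "\<dots> \<le> (\<Sum>k=1..d. 1 / norm (w k))"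
    proof (rule sum_mono)
      fix k assume k: "k \<in> {1..d}"
      have "norm (v k z powi s) = inverse (norm (v k z) ^ nat (- s))"
        using True by (simp add: power_int_def norm_inverse norm_power power_inverse)
      also have "\<dots> \<le> 1" using norm_v[OF z k] by (intro inverse_le_1_iff[THEN iffD2] disjI2 one_le_power) auto
      finally show "norm (v k z powi s / w k) \<le> 1 / norm (w k)" by (simp add: norm_divide divide_right_mono)
    qed
    finally show ?thesis by (simp add: B0_def add_increasing)
  next
    case False
    have "norm (cand s) = norm (u1 z) ^ nat s / norm (w 0)"
      using False by (simp add: cand_def Ut_def norm_divide power_int_def norm_power)
    also have "\<dots> \<le> 1 / norm (w 0)" using norm_u1[OF z(2)] by (intro divide_right_mono power_le_one) auto
    finally show ?thesis by (simp add: B0_def add_increasing2 sum_nonneg)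
  qed
  have ret_cand: "ret_gf s z = cand s" for s
  proof -
    have "ret_gf s z - cand s = 0"
    proof (rule bounded_harmonic_zero[OF z(2), where e = "\<lambda>s. ret_gf s z - cand s" and B = "1 / (1 - norm z) + B0"])
      fix s
      have "norm (ret_gf s z) \<le> 1 / (1 - norm z)"
        unfolding ret_gf_def using ret_bounds z(2) by (rule bounded_gf(2))
      then show "norm (ret_gf s z - cand s) \<le> 1 / (1 - norm z) + B0"
        using norm_triangle_ineq4[of "ret_gf s z" "cand s"] cand_bound[of s] by simp
      show "ret_gf s z - cand s = 0 \<or> ret_gf s z - cand s = z * (\<Sum>i\<in>{-1..int d}. of_real (p i) * (ret_gf (s + i) z - cand (s + i)))"
        by (rule disjI2, subst ret_gf_eq[OF z(2)], subst cand_rec)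
           (simp add: right_diff_distrib sum_subtractf)
    qed
    then show ?thesis by simp
  qed
  \<comment> \<open>shifting the source from 0 to a, scaled so as to agree with cand from a onwards\<close>
  define Dc where "Dc = (\<lambda>s. u1 z powi a * cand (s - a))"
  have u0: "u1 z \<noteq> 0" by (rule u1_nonzero[OF z])
  have Dc_above: "Dc s = cand s" if "s \<ge> a" for s
    using that u0 by (simp add: Dc_def cand_def Ut_def a_def power_int_diff)
  have Dc_below: "Dc s = z * (\<Sum>i\<in>{-1..int d}. of_real (p i) * Dc (s + i))" if "s < a" for s
  proof -
    have "Dc s = u1 z powi a * (z * (\<Sum>i\<in>{-1..int d}. of_real (p i) * cand (s - a + i)))"
      unfolding Dc_def using that by (subst cand_rec) simp
    also have "\<dots> = z * (\<Sum>i\<in>{-1..int d}. of_real (p i) * Dc (s + i))"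
      unfolding Dc_def sum_distrib_left by (intro sum.cong refl) (simp add: algebra_simps)
    finally show ?thesis .
  qed
  have "hit_gf a 0 z - Dc 0 = 0"
  proof (rule bounded_harmonic_zero[OF z(2), where e = "\<lambda>s. hit_gf a s z - Dc s" and B = "1 / (1 - norm z) + norm (u1 z powi a) * B0"])
    fix s
    have "norm (hit_gf a s z) \<le> 1 / (1 - norm z)"
      unfolding hit_gf_def using hit_bounds z(2) by (rule bounded_gf(2))
    moreover have "norm (Dc s) \<le> norm (u1 z powi a) * B0"
      unfolding Dc_def norm_mult by (intro mult_left_mono cand_bound) auto
    ultimately show "norm (hit_gf a s z - Dc s) \<le> 1 / (1 - norm z) + norm (u1 z powi a) * B0"
      using norm_triangle_ineq4[of "hit_gf a s z" "Dc s"] by simp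
    show "hit_gf a s z - Dc s = 0 \<or> hit_gf a s z - Dc s = z * (\<Sum>i\<in>{-1..int d}. of_real (p i) * (hit_gf a (s + i) z - Dc (s + i)))"
    proof (cases "s \<ge> a")
      case True
      then show ?thesis by (simp add: hit_gf_above ret_cand Dc_above)
    next
      case False
      then have "s < a" by simp
      show ?thesis
        by (rule disjI2, subst hit_gf_below[OF z(2) \<open>s < a\<close>], subst Dc_below[OF \<open>s < a\<close>])
           (simp add: right_diff_distrib sum_subtractf)
    qed
  qed
  then have "hit_gf a 0 z = u1 z powi a * cand (- a)" by (simp add: Dc_def)
  also have "\<dots> = (\<Sum>k=1..d. - (u1 z powi a * (v k z powi (- a) / w k)))"
    by (subst cand_neg) (simp_all add: a_def sum_distrib_left sum_negf)
  also have "\<dots> = (\<Sum>k=1..d. root_term (real h) z (v k z))"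
  proof (rule sum.cong[OF refl])
    fix k assume k: "k \<in> {1..d}"
    have q0: "u1 z / v k z \<noteq> 0" using u0 v_nonzero[OF z k] by simp
    have pw: "(u1 z / v k z) powr of_real (real h) = (u1 z / v k z) ^ h"
      using powr_nat[of "u1 z / v k z" h] q0 by simp
    have "u1 z powi a * v k z powi (- a) = (u1 z / v k z) ^ h * (u1 z / v k z)"
    proof -
      have "a = int (Suc h)" by (simp add: a_def)
      then show ?thesis
        by (simp only: power_int_minus power_int_of_nat power_divide power_Suc) (simp add: field_simps)
    qed
    then show "- (u1 z powi a * (v k z powi (- a) / w k)) = root_term (real h) z (v k z)"
      unfolding root_term_def pw by (simp add: w_def rhok[OF k] divide_inverse mult.assoc[symmetric])
  qed
  also have "\<dots> = gen_fun d u1 v (real h) z" using gen_fun_eq[OF z] by simp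
  finally show ?thesis by (simp add: a_def)
qed

lemma coeff_eq_hit:
  assumes r: "0 < r" "r < 1" and simple: "\<And>z u. outer_root r z u \<Longrightarrow> 1 - z * dphi u \<noteq> 0"
  shows "bridge_above_coeff d u1 v r n (real h) = of_real (hit (int h + 1) n 0)"
proof -
  define F where "F = Abs_fps (\<lambda>n. complex_of_real (hit (int h + 1) n 0))"
  have rad: "fps_conv_radius F \<ge> 1"
    unfolding fps_conv_radius_def
  proof (rule conv_radius_geI_ex)
    fix r :: real assume "0 < r" "ereal r < 1"
    then have "norm (complex_of_real r) < 1" by simp
    from bounded_gf(1)[OF hit_bounds this]
    show "\<exists>z. norm z = r \<and> summable (\<lambda>n. fps_nth F n * z ^ n)"
      using \<open>0 < r\<close> by (intro exI[of _ "of_real r"]) (simp add: F_def)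
  qed
  have ev: "eval_fps F z = hit_gf (int h + 1) 0 z" for z
    by (simp add: eval_fps_def hit_gf_def F_def)
  have "ball (0::complex) 1 \<subseteq> eball 0 (fps_conv_radius F)"
  proof
    fix x :: complex assume "x \<in> ball 0 1"
    then have "ereal (norm x) < 1" by simp
    also note rad
    finally show "x \<in> eball 0 (fps_conv_radius F)" by (simp add: in_eball_iff)
  qed
  then have hol: "eval_fps F holomorphic_on ball 0 1"
    by (rule holomorphic_on_eval_fps)
  have "(0::ereal) < 1" by simp
  also note rad
  finally have exp: "eval_fps F has_fps_expansion F"
    by (rule eval_fps_has_fps_expansion)
  have sub: "cball 0 r \<subseteq> ball (0::complex) 1" using r by auto
  have "contour_integral (circlepath 0 r) (\<lambda>u. eval_fps F u / (u - 0) ^ Suc n) = (2 * pi) * \<i> / fact n * (deriv ^^ n) (eval_fps F) 0"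
    by (rule contour_integral_unique, rule Cauchy_has_contour_integral_higher_derivative_circlepath)
       (use r sub hol in \<open>auto intro: holomorphic_on_subset holomorphic_on_imp_continuous_on\<close>)
  then have "contour_integral (circlepath 0 r) (\<lambda>u. eval_fps F u / u ^ (n + 1)) = 2 * of_real pi * \<i> * fps_nth F n"
    using fps_nth_fps_expansion[OF exp, of n] by simp
  moreover have "contour_integral (circlepath 0 r) (\<lambda>z. gen_fun d u1 v (real h) z / z ^ (n + 1))
    = contour_integral (circlepath 0 r) (\<lambda>u. eval_fps F u / u ^ (n + 1))"
  proof (rule contour_integral_eq)
    fix z assume "z \<in> path_image (circlepath 0 r)"
    then have nz: "norm z = r" using r by (simp add: path_image_circlepath)
    then have "hit_gf (int h + 1) 0 z = gen_fun d u1 v (real h) z"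
      using r simple outer_root_v[OF r nz] by (intro hit_gf_eq_gen_fun) auto
    then show "gen_fun d u1 v (real h) z / z ^ (n + 1) = eval_fps F z / z ^ (n + 1)" by (simp add: ev)
  qed
  ultimately show ?thesis unfolding bridge_above_coeff_def by (simp add: F_def)
qed

end

section \<open>From random walks to weighted words\<close>

context lukasiewicz
begin

definition words :: "nat \<Rightarrow> int list set" where
  "words n = {xs. set xs \<subseteq> {-1..int d} \<and> length xs = n}"

definition weight :: "int list \<Rightarrow> real" where "weight xs = prod_list (map p xs)"

definition reaches :: "int \<Rightarrow> int \<Rightarrow> int list \<Rightarrow> bool" where
  "reaches a s xs \<longleftrightarrow> (\<exists>k\<le>length xs. s + sum_list (take k xs) \<ge> a)"

lemma finite_words: "finite (words n)"
  unfolding words_def by (rule finite_lists_length_eq) simp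

lemma words_0: "words 0 = {[]}"
  by (auto simp: words_def)

lemma sum_words_Suc: "(\<Sum>xs\<in>words (Suc n). f xs) = (\<Sum>i\<in>{-1..int d}. \<Sum>ys\<in>words n. f (i # ys))"
proof -
  have "(\<Sum>i\<in>{-1..int d}. \<Sum>ys\<in>words n. f (i # ys)) = (\<Sum>(i, ys)\<in>{-1..int d} \<times> words n. f (i # ys))"
    by (rule sum.cartesian_product)
  also have "\<dots> = (\<Sum>xs\<in>words (Suc n). f xs)"
    by (rule sum.reindex_bij_witness[of _ "\<lambda>xs. (hd xs, tl xs)" "\<lambda>(i, ys). i # ys"])
       (auto simp: words_def length_Suc_conv)
  finally show ?thesis by simp
qed

lemma reaches_Cons: "reaches a s (i # ys) \<longleftrightarrow> s \<ge> a \<or> reaches a (s + i) ys"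
proof
  assume "reaches a s (i # ys)"
  then obtain k where k: "k \<le> Suc (length ys)" "s + sum_list (take k (i # ys)) \<ge> a" by (auto simp: reaches_def)
  then show "s \<ge> a \<or> reaches a (s + i) ys"
    by (cases k) (auto simp: reaches_def add.assoc)
next
  assume "s \<ge> a \<or> reaches a (s + i) ys"
  then show "reaches a s (i # ys)"
  proof
    assume "s \<ge> a" then show ?thesis unfolding reaches_def by (intro exI[of _ 0]) simp
  next
    assume "reaches a (s + i) ys"
    then obtain k where "k \<le> length ys" "s + i + sum_list (take k ys) \<ge> a" by (auto simp: reaches_def)
    then show ?thesis unfolding reaches_def by (intro exI[of _ "Suc k"]) (simp add: add.assoc)
  qed
qed

lemma sum_weight: "(\<Sum>xs\<in>words n. weight xs) = 1"
proof (induction n)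
  case 0 show ?case by (simp add: words_0 weight_def)
next
  case (Suc n)
  have "(\<Sum>xs\<in>words (Suc n). weight xs) = (\<Sum>i\<in>{-1..int d}. p i * (\<Sum>ys\<in>words n. weight ys))"
    by (simp add: sum_words_Suc weight_def sum_distrib_left)
  then show ?case using Suc sum_p_int by simp
qed

lemma ret_words: "ret n s = (\<Sum>xs\<in>words n. if s + sum_list xs = 0 then weight xs else 0)"
proof (induction n arbitrary: s)
  case 0 show ?case by (simp add: words_0 weight_def)
next
  case (Suc n)
  show ?case
    by (simp add: sum_words_Suc Suc.IH sum_distrib_left weight_def add.assoc if_distrib cong: if_cong)
qed

lemma hit_words: "hit a n s = (\<Sum>xs\<in>words n. if s + sum_list xs = 0 \<and> reaches a s xs then weight xs else 0)"
proof (induction n arbitrary: s)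
  case 0 show ?case by (auto simp: words_0 weight_def reaches_def)
next
  case (Suc n)
  show ?case
  proof (cases "s \<ge> a")
    case True
    then have "hit a (Suc n) s = ret (Suc n) s" by simp
    also have "\<dots> = (\<Sum>xs\<in>words (Suc n). if s + sum_list xs = 0 \<and> reaches a s xs then weight xs else 0)"
      unfolding ret_words sum_words_Suc using True by (simp add: reaches_Cons)
    finally show ?thesis .
  next
    case False
    then show ?thesis
      by (simp add: sum_words_Suc Suc.IH sum_distrib_left weight_def add.assoc reaches_Cons if_distrib cong: if_cong)
  qed
qed

text \<open>The words over the possible steps already carry the full mass 1, so other values of
  the steps have probability 0.\<close>

lemma prob_words:
  fixes M :: "'a measure" and X :: "nat \<Rightarrow> 'a \<Rightarrow> int"
  assumes M: "prob_space M"
    and indep: "prob_space.indep_vars M (\<lambda>_. count_space UNIV) X {1..}"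
    and distr: "\<And>i j. i \<ge> 1 \<Longrightarrow> -1 \<le> j \<Longrightarrow> j \<le> int d \<Longrightarrow> measure M {\<omega> \<in> space M. X i \<omega> = j} = p j"
  defines "V \<equiv> (\<lambda>n \<omega>. map (\<lambda>i. X i \<omega>) [1..<Suc n])"
  shows "measure M {\<omega> \<in> space M. V n \<omega> \<in> A} = (\<Sum>xs\<in>words n. if xs \<in> A then weight xs else 0)"
proof -
  interpret prob_space M by (rule M)
  have meas_X: "X i \<in> measurable M (count_space UNIV)" if "i \<ge> 1" for i
    using indep that unfolding indep_vars_def by auto
  have lenV: "length (V n \<omega>) = n" for n \<omega> by (simp add: V_def)
  have V_eq: "{\<omega> \<in> space M. V n \<omega> = xs} = {\<omega> \<in> space M. \<forall>i\<in>{1..n}. X i \<omega> = xs ! (i - 1)}"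
    if "length xs = n" for xs n
  proof -
    have "V n \<omega> = xs \<longleftrightarrow> (\<forall>i\<in>{1..n}. X i \<omega> = xs ! (i - 1))" for \<omega>
    proof -
      have "V n \<omega> = xs \<longleftrightarrow> (\<forall>j<n. X (Suc j) \<omega> = xs ! j)"
        using that by (auto simp: V_def list_eq_iff_nth_eq simp del: upt_Suc)
      also have "\<dots> \<longleftrightarrow> (\<forall>i\<in>{1..n}. X i \<omega> = xs ! (i - 1))"
      proof (intro iffI ballI allI impI)
        fix i assume "\<forall>j<n. X (Suc j) \<omega> = xs ! j" "i \<in> {1..n}"
        then show "X i \<omega> = xs ! (i - 1)" by (cases i) auto
      next
        fix j assume *: "\<forall>i\<in>{1..n}. X i \<omega> = xs ! (i - 1)" "j < n"
        then show "X (Suc j) \<omega> = xs ! j" using bspec[OF *(1), of "Suc j"] by simp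
      qed
      finally show ?thesis .
    qed
    then show ?thesis by simp
  qed
  have ev1: "{\<omega> \<in> space M. X i \<omega> = j} \<in> events" if "i \<ge> 1" for i j
    using measurable_sets[OF meas_X[OF that], of "{j}"] by (simp add: vimage_def Int_def conj_commute)
  have evV: "{\<omega> \<in> space M. V n \<omega> = xs} \<in> events" for xs
  proof (cases "length xs = n")
    case True
    have "{\<omega> \<in> space M. \<forall>i\<in>{1..n}. X i \<omega> = xs ! (i - 1)} \<in> events"
      by (intro sets.sets_Collect_finite_All ev1) auto
    then show ?thesis using V_eq[OF True] by simp
  next
    case False
    then have empty: "{\<omega> \<in> space M. V n \<omega> = xs} = {}" using lenV by auto
    show ?thesis unfolding empty by (rule sets.empty_sets)
  qed
  have probV: "prob {\<omega> \<in> space M. V n \<omega> = xs} = weight xs" if xs: "xs \<in> words n" for xs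
  proof (cases "n = 0")
    case True
    then show ?thesis using xs by (simp add: words_0 V_def weight_def prob_space)
  next
    case False
    have len: "length xs = n" and rng: "set xs \<subseteq> {-1..int d}" using xs by (auto simp: words_def)
    have "prob {\<omega> \<in> space M. V n \<omega> = xs} = prob (\<Inter>i\<in>{1..n}. X i -` {xs ! (i - 1)} \<inter> space M)"
      unfolding V_eq[OF len] using False by (intro arg_cong[where f = prob]) auto
    also have "\<dots> = (\<Prod>i\<in>{1..n}. prob (X i -` {xs ! (i - 1)} \<inter> space M))"
      using False by (intro indep_varsD[OF indep]) auto
    also have "\<dots> = (\<Prod>i\<in>{1..n}. p (xs ! (i - 1)))"
    proof (rule prod.cong[OF refl])
      fix i assume i: "i \<in> {1..n}"
      then have "xs ! (i - 1) \<in> set xs" using len by (intro nth_mem) auto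
      then have "xs ! (i - 1) \<in> {-1..int d}" using rng by (rule subsetD[rotated])
      moreover have "X i -` {xs ! (i - 1)} \<inter> space M = {\<omega> \<in> space M. X i \<omega> = xs ! (i - 1)}" by auto
      ultimately show "prob (X i -` {xs ! (i - 1)} \<inter> space M) = p (xs ! (i - 1))"
        using distr[of i "xs ! (i - 1)"] i by simp
    qed
    also have "\<dots> = (\<Prod>j=0..<n. p (xs ! j))"
      by (rule prod.reindex_bij_witness[of _ Suc "\<lambda>i. i - 1"]) auto
    also have "\<dots> = weight xs" by (simp add: weight_def prod.list_conv_set_nth len)
    finally show ?thesis .
  qed
  have evA: "{\<omega> \<in> space M. V n \<omega> \<in> B} \<in> events" for B
  proof -
    have "{\<omega> \<in> space M. V n \<omega> \<in> B} = (\<Union>xs\<in>B. {\<omega> \<in> space M. V n \<omega> = xs})" by auto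
    also have "\<dots> \<in> events"
      by (rule sets.countable_UN') (auto simp: evV)
    finally show ?thesis .
  qed
  have fin: "prob {\<omega> \<in> space M. V n \<omega> \<in> B} = (\<Sum>xs\<in>B. weight xs)" if B: "B \<subseteq> words n" for B
  proof -
    have "{\<omega> \<in> space M. V n \<omega> \<in> B} = (\<Union>xs\<in>B. {\<omega> \<in> space M. V n \<omega> = xs})" by auto
    also have "prob \<dots> = (\<Sum>xs\<in>B. prob {\<omega> \<in> space M. V n \<omega> = xs})"
      using finite_subset[OF B finite_words] evV
      by (intro finite_measure_finite_Union) (auto simp: disjoint_family_on_def)
    also have "\<dots> = (\<Sum>xs\<in>B. weight xs)" using B probV by (intro sum.cong) auto
    finally show ?thesis .
  qed
  have one: "prob {\<omega> \<in> space M. V n \<omega> \<in> words n} = 1" using fin[of "words n"] sum_weight by simp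
  have "AE \<omega> in M. V n \<omega> \<in> A \<longleftrightarrow> V n \<omega> \<in> words n \<inter> A"
    using AE_prob_1[OF one] by eventually_elim auto
  then have "prob {\<omega> \<in> space M. V n \<omega> \<in> A} = prob {\<omega> \<in> space M. V n \<omega> \<in> words n \<inter> A}"
    by (rule prob_eq_AE) (rule evA)+
  also have "\<dots> = (\<Sum>xs\<in>words n \<inter> A. weight xs)" by (rule fin) auto
  also have "\<dots> = (\<Sum>xs\<in>words n. if xs \<in> A then weight xs else 0)"
    by (simp add: sum.inter_restrict[OF finite_words])
  finally show ?thesis .
qed

lemma bridge_above_prob_eq_hit:
  fixes M :: "'a measure" and X :: "nat \<Rightarrow> 'a \<Rightarrow> int"
  assumes M: "prob_space M"
    and indep: "prob_space.indep_vars M (\<lambda>_. count_space UNIV) X {1..}"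
    and distr: "\<And>i j. i \<ge> 1 \<Longrightarrow> -1 \<le> j \<Longrightarrow> j \<le> int d \<Longrightarrow> measure M {\<omega> \<in> space M. X i \<omega> = j} = p j"
  shows "bridge_above_prob M X n (real h) = hit (int h + 1) n 0"
proof -
  define V where "V = (\<lambda>n \<omega>. map (\<lambda>i. X i \<omega>) [1..<Suc n])"
  have walk_V: "walk X k \<omega> = sum_list (take k (V n \<omega>))" if "k \<le> n" for k \<omega>
  proof -
    have "take k (V n \<omega>) = map (\<lambda>i. X i \<omega>) [1..<Suc k]"
      using that by (simp add: V_def take_map del: upt_Suc)
    then have "sum_list (take k (V n \<omega>)) = (\<Sum>i\<in>set [1..<Suc k]. X i \<omega>)"
      by (simp add: sum_list_distinct_conv_sum_set del: upt_Suc set_upt)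
    also have "set [1..<Suc k] = {1..k}" by auto
    finally show ?thesis by (simp add: walk_def)
  qed
  have "walk X n \<omega> = 0 \<and> of_int (Max ((\<lambda>k. walk X k \<omega>) ` {0..n})) > real h \<longleftrightarrow>
      V n \<omega> \<in> {xs. sum_list xs = 0 \<and> reaches (int h + 1) 0 xs}" for \<omega>
  proof -
    have len: "length (V n \<omega>) = n" by (simp add: V_def)
    have "walk X n \<omega> = sum_list (V n \<omega>)" using walk_V[of n \<omega>] len by simp
    moreover have "of_int (Max ((\<lambda>k. walk X k \<omega>) ` {0..n})) > real h \<longleftrightarrow> int h < Max ((\<lambda>k. walk X k \<omega>) ` {0..n})"
      by (metis of_int_less_iff of_int_of_nat_eq)
    moreover have "\<dots> \<longleftrightarrow> (\<exists>k\<in>{0..n}. int h < walk X k \<omega>)" by (subst Max_gr_iff) auto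
    moreover have "\<dots> \<longleftrightarrow> reaches (int h + 1) 0 (V n \<omega>)"
      unfolding reaches_def len using walk_V[of _ \<omega>] by (auto simp: Bex_def)
    ultimately show ?thesis by simp
  qed
  then have "bridge_above_prob M X n (real h) = measure M {\<omega> \<in> space M. V n \<omega> \<in> {xs. sum_list xs = 0 \<and> reaches (int h + 1) 0 xs}}"
    unfolding bridge_above_prob_def by simp
  also have "\<dots> = hit (int h + 1) n 0"
  proof -
    have "measure M {\<omega> \<in> space M. V n \<omega> \<in> A} = (\<Sum>xs\<in>words n. if xs \<in> A then weight xs else 0)" for A
      unfolding V_def by (rule prob_words[OF M indep distr])
    from this[of "{xs. sum_list xs = 0 \<and> reaches (int h + 1) 0 xs}"]
    show ?thesis unfolding hit_words by simp
  qed
  finally show ?thesis .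
qed

end

section \<open>The coefficients of the expansion\<close>

lemma He_values:
  "He 0 y = 1" "He 1 y = 4 * y" "He 2 y = 16 * y ^ 2 - 4" "He 3 y = 64 * y ^ 3 - 48 * y"
  "He 4 y = 256 * y ^ 4 - 384 * y ^ 2 + 48"
  by (simp_all add: He_def numeral_eq_Suc pderiv_pCons algebra_simps)

lemma expansion_He_eq_x:
  assumes s: "s > 0"
  shows "expansion_He s \<xi> \<theta> x n = expansion_x s \<xi> \<theta> x n"
proof -
  have s0: "s \<noteq> 0" using s by simp
  have 1: "He 1 x / sqrt n * (- 3 / (2 * s) - \<xi> / (6 * s ^ 3)) = x / sqrt n * (- 6 / s - 2 * \<xi> / (3 * s ^ 3))"
  proof -
    have e: "- 6 / s - 2 * \<xi> / (3 * s ^ 3) = 4 * (- 3 / (2 * s) - \<xi> / (6 * s ^ 3))"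
      using s0 by (simp add: field_simps)
    show ?thesis unfolding He_values e by simp
  qed
  have 2: "He 4 x / 128
        + He 3 x * (- 1 / (12 * s^2) - \<xi> / (24 * s^4) + \<theta> / (96 * s^4) - 5 * \<xi>^2 / (288 * s^6) - 1 / 16) * x
        + He 2 x * (5 / (4 * s^2) + 7 * \<xi> / (24 * s^4) - \<theta> / (32 * s^4) + 5 * \<xi>^2 / (96 * s^6) + 3 / 16)
     = - 5 / s^2 + 1 / s^4 * (- 7 * \<xi> / 6 + \<theta> / 8) - 5 * \<xi>^2 / (24 * s^6) - 3 / 8
        + (24 / s^2 + 1 / s^4 * (20 * \<xi> / 3 - \<theta>) + 5 * \<xi>^2 / (3 * s^6) + 3) * x^2
        + (- 16 / (3 * s^2) + 1 / (3 * s^4) * (- 8 * \<xi> + 2 * \<theta>) - 10 * \<xi>^2 / (9 * s^6) - 2) * x^4"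
    unfolding He_values using s0 by (simp add: field_simps eval_nat_numeral)
  show ?thesis unfolding expansion_He_def expansion_x_def 1 2 He_values(1) ..
qed

context lukasiewicz
begin

text \<open>The raw moments of a step are turned into the factorial moments that the derivatives
  of P at 1 give.\<close>

lemma saddle_value_eq:
  assumes n: "n > 0"
  shows "saddle_value c1 c2 c3 x (1 / sqrt n) / c1 =
    expansion_x sg ((deriv ^^ 3) (char_P d p) 1) ((deriv ^^ 4) (char_P d p) 1) x n"
proof -
  define s \<xi> \<theta> where "s = sg" and "\<xi> = (deriv ^^ 3) (char_P d p) (1::real)" and "\<theta> = (deriv ^^ 4) (char_P d p) (1::real)"
  have s0: "s \<noteq> 0" using sg_pos by (simp add: s_def)
  have mu: "mu 3 = \<xi> + 3 * s ^ 2" "mu 4 = \<theta> + 6 * \<xi> + 7 * s ^ 2"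
    using mu_3_deriv mu_4_deriv by (simp_all add: s_def \<xi>_def \<theta>_def)
  have c: "c1 = 1 / s" "c2 = - (\<xi> + 3 * s ^ 2) / (6 * s ^ 4)"
    "c3 = (1 / 8 - (\<theta> + 6 * \<xi> + 7 * s ^ 2) / (24 * s ^ 4) + 5 * (\<xi> + 3 * s ^ 2) ^ 2 / (72 * s ^ 6)) / s"
    unfolding c1_def c2_def c3_def mu s_def by simp_all
  have A: "(2 * c2 - 2 * c1 ^ 2) * 2 * s = - 6 / s - 2 * \<xi> / (3 * s ^ 3)"
    unfolding c using s0 by (simp add: field_simps eval_nat_numeral)
  have B: "(3 * c3 - 4 * c1 * c2 + 2 * c1 ^ 3) * s
      = 5 / s ^ 2 + 7 * \<xi> / (6 * s ^ 4) - \<theta> / (8 * s ^ 4) + 5 * \<xi> ^ 2 / (24 * s ^ 6) + 3 / 8"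
    unfolding c using s0 by (simp add: field_simps eval_nat_numeral)
  have G: "2 * c3 * s = 1 / 4 - (\<theta> + 6 * \<xi> + 7 * s ^ 2) / (12 * s ^ 4) + 5 * (\<xi> + 3 * s ^ 2) ^ 2 / (36 * s ^ 6)"
    unfolding c using s0 by (simp add: field_simps)
  have D: "(3 * c3 - 4 * c1 * c2 + 2 * c1 ^ 3) * s * (4 * x ^ 2 - 1) - x * (2 * c3 * s) * (8 * x ^ 3 - 6 * x)
     = - 5 / s^2 + 1 / s^4 * (- 7 * \<xi> / 6 + \<theta> / 8) - 5 * \<xi>^2 / (24 * s^6) - 3 / 8
        + (24 / s^2 + 1 / s^4 * (20 * \<xi> / 3 - \<theta>) + 5 * \<xi>^2 / (3 * s^6) + 3) * x^2
        + (- 16 / (3 * s^2) + 1 / (3 * s^4) * (- 8 * \<xi> + 2 * \<theta>) - 10 * \<xi>^2 / (9 * s^6) - 2) * x^4"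
    unfolding B G using s0 by (simp add: field_simps eval_nat_numeral)
  have tau: "(1 / sqrt n) ^ 2 = 1 / n" using n by (simp add: power_divide)
  have c1s: "1 / c1 = s" "c1 * s = 1" using s0 by (simp_all add: c(1))
  have "saddle_value c1 c2 c3 x (1 / sqrt n) / c1 = saddle_value c1 c2 c3 x (1 / sqrt n) * s"
    using c1s(1) by (metis divide_inverse inverse_eq_divide)
  also have "\<dots> = c1 * s + x / sqrt n * ((2 * c2 - 2 * c1 ^ 2) * 2 * s)
      + 1 / n * ((3 * c3 - 4 * c1 * c2 + 2 * c1 ^ 3) * s * (4 * x ^ 2 - 1) - x * (2 * c3 * s) * (8 * x ^ 3 - 6 * x))"
    unfolding saddle_value_def tau by (simp add: algebra_simps)
  also have "\<dots> = expansion_x s \<xi> \<theta> x n"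
    unfolding A D c1s(2) expansion_x_def ..
  finally show ?thesis by (simp only: s_def \<xi>_def \<theta>_def)
qed

end

theorem mainTheorem4:
  fixes d :: nat and p :: "int \<Rightarrow> real" and \<sigma> \<xi> \<theta> x :: real
    and M :: "'a measure" and X :: "nat \<Rightarrow> 'a \<Rightarrow> int"
  assumes d: "d \<ge> 1"
    and p_rat: "\<And>j. -1 \<le> j \<Longrightarrow> j \<le> int d \<Longrightarrow> p j \<in> \<rat>"
    and p_nonneg: "\<And>j. -1 \<le> j \<Longrightarrow> j \<le> int d \<Longrightarrow> p j \<ge> 0"
    and p_first: "p (-1) > 0"
    and p_last: "p (int d) > 0"
    and aper: "aperiodic d p"
    and P_1: "char_P d p (1::real) = 1"
    and P'_1: "deriv (char_P d p) (1::real) = 0"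
    and no_double: "\<not> (\<exists>\<upsilon>::complex. \<upsilon> \<noteq> 0 \<and> deriv (char_P d p) \<upsilon> = 0 \<and>
                          (deriv ^^ 2) (char_P d p) \<upsilon> = 0)"
    and \<sigma>: "\<sigma> = sqrt ((deriv ^^ 2) (char_P d p) 1)"
    and \<xi>: "\<xi> = (deriv ^^ 3) (char_P d p) 1"
    and \<theta>: "\<theta> = (deriv ^^ 4) (char_P d p) 1"
    and M: "prob_space M"
    and indep: "prob_space.indep_vars M (\<lambda>_. count_space UNIV) X {1..}"
    and distr: "\<And>i j. i \<ge> 1 \<Longrightarrow> -1 \<le> j \<Longrightarrow> j \<le> int d \<Longrightarrow>
                  measure M {\<omega> \<in> space M. X i \<omega> = j} = p j"
    and x: "x > 0"
  shows
    \<comment> \<open>\<open>h = x \<sigma> sqrt n\<close> an arbitrary real: \<open>b\<^sub>n\<close> is the Cauchy integral, on circles at distance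
        of order \<open>1/n\<close> from the singularity \<open>z = 1\<close>\<close>
    "(\<forall>u1 v r. small_root d p u1 \<and> large_roots d p u1 v \<and>
        (\<forall>n. 0 < r n \<and> r n < 1) \<and> (\<lambda>n. 1 - r n) \<in> \<Theta>(\<lambda>n. 1 / real n) \<longrightarrow>
        (\<lambda>n. bridge_above_coeff d u1 v (r n) n (x * \<sigma> * sqrt (real n))
               * of_real (\<sigma> * sqrt (2 * pi * real n) / exp (- 2 * x^2))
             - of_real (expansion_He \<sigma> \<xi> \<theta> x (real n)))
          \<in> O(\<lambda>n. of_real (real n powr (- 3 / 2))) \<and>
        (\<lambda>n. bridge_above_coeff d u1 v (r n) n (x * \<sigma> * sqrt (real n))
               * of_real (\<sigma> * sqrt (2 * pi * real n) / exp (- 2 * x^2))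
             - of_real (expansion_x \<sigma> \<xi> \<theta> x (real n)))
          \<in> O(\<lambda>n. of_real (real n powr (- 3 / 2))))
     \<and>
    \<comment> \<open>\<open>h = x \<sigma> sqrt n\<close> an integer: \<open>b\<^sub>n\<close> is the probability\<close>
     (\<lambda>n. bridge_above_prob M X n (x * \<sigma> * sqrt (real n))
            * (\<sigma> * sqrt (2 * pi * real n) / exp (- 2 * x^2))
          - expansion_He \<sigma> \<xi> \<theta> x (real n))
       \<in> O[inf sequentially (principal {n. x * \<sigma> * sqrt (real n) \<in> \<nat>})](\<lambda>n. real n powr (- 3 / 2))
     \<and>
     (\<lambda>n. bridge_above_prob M X n (x * \<sigma> * sqrt (real n))
            * (\<sigma> * sqrt (2 * pi * real n) / exp (- 2 * x^2))
          - expansion_x \<sigma> \<xi> \<theta> x (real n))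
       \<in> O[inf sequentially (principal {n. x * \<sigma> * sqrt (real n) \<in> \<nat>})](\<lambda>n. real n powr (- 3 / 2))"
proof -
  interpret lukasiewicz d p
    by unfold_locales (use d p_nonneg p_first p_last aper P_1 P'_1 in auto)
  have s: "\<sigma> = sg" using \<sigma> sg_deriv by simp
  have s_pos: "\<sigma> > 0" using s sg_pos by simp
  have c1_pos: "c1 > 0" using sg_pos by (simp add: c1_def)
  define K where "K = (\<lambda>n::nat. \<sigma> * sqrt (2 * pi * real n) / exp (- 2 * x ^ 2))"
  have K: "K n = sqrt (2 * pi * real n) * exp (2 * x ^ 2) / c1" for n
    by (simp add: K_def c1_def s exp_minus field_simps)
  have exp_eq: "expansion_He \<sigma> \<xi> \<theta> x y = expansion_x \<sigma> \<xi> \<theta> x y" for y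
    by (rule expansion_He_eq_x[OF s_pos])
  have A: "(\<lambda>n. bridge_above_coeff d u1 v (r n) n (x * \<sigma> * sqrt (real n)) * of_real (K n)
             - of_real (expansion_x \<sigma> \<xi> \<theta> x (real n))) \<in> O(\<lambda>n. of_real (real n powr (- 3 / 2)))"
    if small: "small_root d p u1" and large: "large_roots d p u1 v"
      and r: "\<And>n. 0 < r n \<and> r n < 1" and theta: "(\<lambda>n. 1 - r n) \<in> \<Theta>(\<lambda>n. 1 / real n)" for u1 v r
  proof -
    interpret lukasiewicz_roots d p u1 v
      by unfold_locales (use small large in \<open>auto simp: large_roots_def\<close>)
    have "eventually (\<lambda>n. bridge_above_coeff d u1 v (r n) n (x * sg * sqrt (real n))
            * of_real (sqrt (2 * pi * real n) * exp (2 * x ^ 2) / c1)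
         - of_real (saddle_value c1 c2 c3 x (1 / sqrt (real n)) / c1)
       = bridge_above_coeff d u1 v (r n) n (x * \<sigma> * sqrt (real n)) * of_real (K n)
             - of_real (expansion_x \<sigma> \<xi> \<theta> x (real n))) sequentially"
      using eventually_gt_at_top[of 0]
    proof eventually_elim
      case (elim n)
      then have "saddle_value c1 c2 c3 x (1 / sqrt (real n)) / c1 = expansion_x \<sigma> \<xi> \<theta> x (real n)"
        using saddle_value_eq[of "real n" x] by (simp only: s \<xi> \<theta> of_nat_0_less_iff)
      then show ?case by (simp only: K s)
    qed
    from landau_o.big.in_cong[OF this] show ?thesis
      using coeff_asymptotics[OF r theta x] by simp
  qed
  define F where "F = inf sequentially (principal {n. x * \<sigma> * sqrt (real n) \<in> \<nat>})"
  have B: "(\<lambda>n. bridge_above_prob M X n (x * \<sigma> * sqrt (real n)) * K n - expansion_x \<sigma> \<xi> \<theta> x (real n))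
       \<in> O[F](\<lambda>n. real n powr (- 3 / 2))"
  proof -
    obtain u1 where small: "small_root d p u1" using small_root_exists by blast
    obtain v where large: "large_roots d p u1 v" using large_roots_exist[OF small] by blast
    interpret lukasiewicz_roots d p u1 v
      by unfold_locales (use small large in \<open>auto simp: large_roots_def\<close>)
    define r :: "nat \<Rightarrow> real" where "r = (\<lambda>n. 1 - 1 / (real n + 2))"
    have r: "0 < r n \<and> r n < 1" for n by (simp add: r_def field_simps)
    have theta: "(\<lambda>n. 1 - r n) \<in> \<Theta>(\<lambda>n. 1 / real n)" unfolding r_def by real_asymp
    have lim: "r \<longlonglongrightarrow> 1" unfolding r_def by real_asymp
    have low: "eventually (\<lambda>n. (1 / 3) / real n \<le> 1 - r n) sequentially"
      using eventually_ge_at_top[of 1] by eventually_elim (simp add: r_def field_simps)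
    obtain c m where c: "c > 0" and ev: "eventually (\<lambda>n. \<forall>z u. outer_root (r n) z u \<longrightarrow> c / real n ^ m \<le> norm (1 - z * dphi u)) sequentially"
      by (rule deriv_lower_bound[OF r _ low lim]) (simp, rule that)
    obtain k where k: "k > 0" "eventually (\<lambda>n. norm (bridge_above_coeff d u1 v (r n) n (x * \<sigma> * sqrt (real n)) * of_real (K n)
             - of_real (expansion_x \<sigma> \<xi> \<theta> x (real n))) \<le> k * norm (complex_of_real (real n powr (- 3 / 2)))) sequentially"
      using landau_o.bigE[OF A[OF small large r theta]] by blast
    have "eventually (\<lambda>n. n \<in> {n. x * \<sigma> * sqrt (real n) \<in> \<nat>} \<longrightarrow>
        norm (bridge_above_prob M X n (x * \<sigma> * sqrt (real n)) * K n - expansion_x \<sigma> \<xi> \<theta> x (real n)) \<le> k * norm (real n powr (- 3 / 2))) sequentially"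
      using k(2) ev eventually_gt_at_top[of 0]
    proof eventually_elim
      case (elim n)
      show ?case
      proof
        assume "n \<in> {n. x * \<sigma> * sqrt (real n) \<in> \<nat>}"
        then obtain h where h: "x * \<sigma> * sqrt (real n) = real h" by (auto elim: Nats_cases)
        have "bridge_above_coeff d u1 v (r n) n (real h) = of_real (hit (int h + 1) n 0)"
        proof (rule coeff_eq_hit)
          show "1 - z * dphi u \<noteq> 0" if "outer_root (r n) z u" for z u
          proof -
            have "0 < c / real n ^ m" using c elim(3) by simp
            also have "\<dots> \<le> norm (1 - z * dphi u)" using elim(2) that by blast
            finally show ?thesis by simp
          qed
        qed (use r in auto)
        then have "bridge_above_coeff d u1 v (r n) n (x * \<sigma> * sqrt (real n)) = of_real (bridge_above_prob M X n (x * \<sigma> * sqrt (real n)))"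
          using bridge_above_prob_eq_hit[OF M indep distr, of n h] by (simp only: h)
        then have "norm (complex_of_real (bridge_above_prob M X n (x * \<sigma> * sqrt (real n)) * K n - expansion_x \<sigma> \<xi> \<theta> x (real n)))
            \<le> k * norm (complex_of_real (real n powr (- 3 / 2)))"
          using elim(1) by (simp only: of_real_mult of_real_diff)
        then show "norm (bridge_above_prob M X n (x * \<sigma> * sqrt (real n)) * K n - expansion_x \<sigma> \<xi> \<theta> x (real n)) \<le> k * norm (real n powr (- 3 / 2))"
          by (simp only: norm_of_real real_norm_def)
      qed
    qed
    then have "eventually (\<lambda>n. norm (bridge_above_prob M X n (x * \<sigma> * sqrt (real n)) * K n - expansion_x \<sigma> \<xi> \<theta> x (real n))
        \<le> k * norm (real n powr (- 3 / 2))) F"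
      unfolding F_def eventually_inf_principal by (auto elim: eventually_mono)
    then show ?thesis by (rule landau_o.bigI[OF k(1)])
  qed
  show ?thesis
    using A B unfolding exp_eq K_def F_def by blast
qed

end
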